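(* Let $N$ be any Nil 3-manifold in one of the families (1), (2), (3) or (4) (Nil-tori, vertical half-twist, horizontal half-twist, or double half-twist). Then, for every squarefree integer $d \geqslant 1$, $N$ occurs as a cusp cross-section in the commensurability class of the Picard modular group ${\rm PU}(2,1,\mathcal{O}_d)$.
   Context: **Complex hyperbolic plane.** Let $\mathbb{C}^{2,1}$ be $\mathbb{C}^3$ with the Hermitian form of signature $(2,1)$ given by the matrix $H=\begin{bmatrix}0&0&1\\0&1&0\\1&0&0\end{bmatrix}$. The complex hyperbolic plane ${\rm H}^2_{\mathbb{C}}\subset\mathbb{C}{\rm P}^2$ is the set of negative lines, with distance $\cosh^2\frac12 d(\pi(X),\pi(Y))=\frac{|\langle X,Y\rangle|^2}{\langle X,X\rangle\langle Y,Y\rangle}$; its ideal boundary $\partial_\infty{\rm H}^2_{\mathbb{C}}$ is the set of null lines. ${\rm U}(2,1)\subset{\rm GL}(3,\mathbb{C})$ is the group preserving the form and ${\rm PU}(2,1)$ is its image in ${\rm PGL}(3,\mathbb{C})$, which is the group of holomorphic isometries. The full isometry group ${\rm Isom}({\rm H}^2_{\mathbb{C}})$ is ${\rm PU}(2,1)\rtimes\langle\sigma\rangle$ with $\sigma$ the antiholomorphic involution given by complex conjugation of coordinates. An ${\rm H}^2_{\mathbb{C}}$-manifold is a quotient ${\rm H}^2_{\mathbb{C}}/\Gamma$ with $\Gamma$ a torsion-free discrete subgroup of ${\rm Isom}({\rm H}^2_{\mathbb{C}})$. **Cusps.** If $\Gamma<{\rm Isom}({\rm H}^2_{\mathbb{C}})$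 is discrete with ${\rm H}^2_{\mathbb{C}}/\Gamma$ of finite volume, a cusp point is a point $q\in\partial_\infty{\rm H}^2_{\mathbb{C}}$ fixed by a parabolic element of $\Gamma$; the corresponding cusp cross-section is the compact quotient of a horosphere based at $q$ by the stabilizer of $q$ in $\Gamma$. The manifold may have several cusps. **Picard modular groups.** For $d\geqslant1$ squarefree, $\mathcal{O}_d$ is the ring of integers of $\mathbb{Q}(i\sqrt d)$, and ${\rm PU}(2,1,\mathcal{O}_d)$ is the image in ${\rm PU}(2,1)$ of the matrices of ${\rm U}(2,1)$ (for the form $H$) with entries in $\mathcal{O}_d$. Two subgroups of ${\rm Isom}({\rm H}^2_{\mathbb{C}})$ are commensurable if some conjugate of one meets the other in a subgroup of finite index in both. We say $N$ *occurs as a cusp cross-section in the commensurability class of* ${\rm PU}(2,1,\mathcal{O}_d)$ if there is a torsion-free subgroup $\Gamma<{\rm Isom}({\rm H}^2_{\mathbb{C}})$ commensurable to ${\rm PU}(2,1,\mathcal{O}_d)$ such that $N$ is diffeomorphic to a cusp cross-section of the ${\rm H}^2_{\mathbb{C}}$-manifold ${\rm H}^2_{\mathbb{C}}/\Gamma$. **Nil 3-manifolds.** ${\rm Nil}$ is the Heisenberg group $\mathbb{C}\times\mathbb{R}$ with product $(z_1,t_1)\cdot(z_2,t_2)=(z_1+z_2,t_1+t_2+2{\rm Im}(z_1\overline{z_2}))$, with a left-invariant Riemannian metric whose isometry group is ${\rm Nil}\rtimes({\rm U}(1)\rtimes\mathbb{Z}_2)$, where $u\in{\rm U}(1)$ acts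 by $(z,t)\mapsto(uz,t)$ and $\mathbb{Z}_2$ acts by $(z,t)\mapsto(\overline z,-t)$. A Nil 3-manifold is a compact manifold $N\simeq{\rm Nil}/\Delta$ with $\Delta\simeq\pi_1(N)$ a discrete torsion-free subgroup of ${\rm Isom}({\rm Nil})$. $N$ belongs to one of the following families when $\pi_1(N)$ has the given presentation (with $\mathbb{N}$ the positive integers): (1) (Nil-tori) $\langle a,b,c \mid [b,a]=c^k,\ [c,a]=[c,b]=1\rangle$ with $k\in\mathbb{N}$. (2) (Vertical half-twist) $\langle a,b,c,\alpha \mid [b,a]=c^k,\ [c,a]=[c,b]=[c,\alpha]=1,\ \alpha a=a^{-1}\alpha,\ \alpha b=b^{-1}\alpha,\ \alpha^2=c\rangle$ with $k\in2\mathbb{N}$. (3) (Horizontal half-twist) $\langle a,b,c,\alpha \mid [b,a]=c^{2k},\ [c,a]=[c,b]=[a,\alpha]=1,\ \alpha b=b^{-1}\alpha c^{-k},\ \alpha c=c^{-1}\alpha,\ \alpha^2=a\rangle$ with $k\in\mathbb{N}$. (4) (Double half-twist) $\langle a,b,c,\alpha,\beta \mid [b,a]=c^{2k},\ [c,a]=[c,b]=[c,\alpha]=[a,\beta]=1,\ \alpha a=a^{-1}\alpha c^k,\ \alpha b=b^{-1}\alpha c^{-k},\ \beta b=b^{-1}\beta c^{-k},\ \beta c=c^{-1}\beta,\ \alpha\beta=a^{-1}b^{-1}\beta\alpha c^{-k-1},\ \alpha^2=c,\ \beta^2=a\rangle$ with $k\in2\mathbb{N}$. *)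

theory Defs
  imports
    "HOL-Analysis.Analysis"
    "HOL-Algebra.Group_Action"
    "HOL-Algebra.Coset"
    "HOL-Computational_Algebra.Polynomial"
    "HOL-Computational_Algebra.Squarefree"
begin

section \<open>Groups\<close>

definition torsion_free :: "('a, 'b) monoid_scheme \<Rightarrow> bool" where
  "torsion_free G \<longleftrightarrow>
     (\<forall>g\<in>carrier G. \<forall>n::nat. n > 0 \<longrightarrow> g [^]\<^bsub>G\<^esub> n = \<one>\<^bsub>G\<^esub> \<longrightarrow> g = \<one>\<^bsub>G\<^esub>)"

definition finite_index_in :: "('a, 'b) monoid_scheme \<Rightarrow> 'a set \<Rightarrow> 'a set \<Rightarrow> bool" where
  "finite_index_in G K H \<longleftrightarrow> finite (rcosets\<^bsub>G\<lparr>carrier := H\<rparr>\<^esub> K)"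

definition conjugate_by :: "('a, 'b) monoid_scheme \<Rightarrow> 'a \<Rightarrow> 'a set \<Rightarrow> 'a set" where
  "conjugate_by G g H = {g \<otimes>\<^bsub>G\<^esub> h \<otimes>\<^bsub>G\<^esub> inv\<^bsub>G\<^esub> g | h. h \<in> H}"

definition commensurable :: "('a, 'b) monoid_scheme \<Rightarrow> 'a set \<Rightarrow> 'a set \<Rightarrow> bool" where
  "commensurable G H K \<longleftrightarrow>
     (\<exists>g\<in>carrier G.
        finite_index_in G (conjugate_by G g H \<inter> K) (conjugate_by G g H) \<and>
        finite_index_in G (conjugate_by G g H \<inter> K) K)"


section \<open>Groups given by presentations\<close>

text \<open>A word is a list of letters; the letter \<open>(x, False)\<close> is the generator \<open>x\<close> and
  \<open>(x, True)\<close> its formal inverse. A relation \<open>u = v\<close> is the pair \<open>(u, v)\<close>.\<close>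

type_synonym 'g word = "('g \<times> bool) list"

abbreviation gen :: "'g \<Rightarrow> 'g word" where
  "gen x \<equiv> [(x, False)]"

definition winv :: "'g word \<Rightarrow> 'g word" where
  "winv w = rev (map (\<lambda>(x, e). (x, \<not> e)) w)"

definition wpow :: "'g word \<Rightarrow> nat \<Rightarrow> 'g word" where
  "wpow w n = concat (replicate n w)"

definition wcomm :: "'g word \<Rightarrow> 'g word \<Rightarrow> 'g word" where
  "wcomm u v = u @ v @ winv u @ winv v"

inductive word_eq :: "'g set \<Rightarrow> ('g word \<times> 'g word) set \<Rightarrow> 'g word \<Rightarrow> 'g word \<Rightarrow> bool"
  for X R where
  relation: "(u, v) \<in> R \<Longrightarrow> word_eq X R u v"
| cancel: "x \<in> X \<Longrightarrow> word_eq X R [(x, e), (x, \<not> e)] []"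
| refl: "w \<in> lists (X \<times> UNIV) \<Longrightarrow> word_eq X R w w"
| sym: "word_eq X R u v \<Longrightarrow> word_eq X R v u"
| trans: "word_eq X R u v \<Longrightarrow> word_eq X R v w \<Longrightarrow> word_eq X R u w"
| append: "word_eq X R u u' \<Longrightarrow> word_eq X R v v' \<Longrightarrow> word_eq X R (u @ v) (u' @ v')"

definition word_class :: "'g set \<Rightarrow> ('g word \<times> 'g word) set \<Rightarrow> 'g word \<Rightarrow> 'g word set" where
  "word_class X R w = {v. word_eq X R w v}"

text \<open>The group \<open>\<langle>X | R\<rangle>\<close>, where \<open>R\<close> consists of pairs of words over \<open>X\<close>.\<close>

definition presented_group :: "'g set \<Rightarrow> ('g word \<times> 'g word) set \<Rightarrow> 'g word set monoid" where
  "presented_group X R =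
     \<lparr>carrier = word_class X R ` lists (X \<times> UNIV),
      mult = (\<lambda>U V. \<Union>u\<in>U. \<Union>v\<in>V. word_class X R (u @ v)),
      one = word_class X R []\<rparr>"

datatype nil_gen = Ga | Gb | Gc | Galpha | Gbeta

definition nil_torus_group :: "nat \<Rightarrow> nil_gen word set monoid" where
  "nil_torus_group k =
    (let a = gen Ga; b = gen Gb; c = gen Gc in
     presented_group {Ga, Gb, Gc}
      {(wcomm b a, wpow c k), (wcomm c a, []), (wcomm c b, [])})"

definition vertical_half_twist_group :: "nat \<Rightarrow> nil_gen word set monoid" where
  "vertical_half_twist_group k =
    (let a = gen Ga; b = gen Gb; c = gen Gc; \<alpha> = gen Galpha in
     presented_group {Ga, Gb, Gc, Galpha}
      {(wcomm b a, wpow c k), (wcomm c a, []), (wcomm c b, []), (wcomm c \<alpha>, []),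
       (\<alpha> @ a, winv a @ \<alpha>), (\<alpha> @ b, winv b @ \<alpha>), (\<alpha> @ \<alpha>, c)})"

definition horizontal_half_twist_group :: "nat \<Rightarrow> nil_gen word set monoid" where
  "horizontal_half_twist_group k =
    (let a = gen Ga; b = gen Gb; c = gen Gc; \<alpha> = gen Galpha in
     presented_group {Ga, Gb, Gc, Galpha}
      {(wcomm b a, wpow c (2 * k)), (wcomm c a, []), (wcomm c b, []), (wcomm a \<alpha>, []),
       (\<alpha> @ b, winv b @ \<alpha> @ wpow (winv c) k), (\<alpha> @ c, winv c @ \<alpha>), (\<alpha> @ \<alpha>, a)})"

definition double_half_twist_group :: "nat \<Rightarrow> nil_gen word set monoid" where
  "double_half_twist_group k =
    (let a = gen Ga; b = gen Gb; c = gen Gc; \<alpha> = gen Galpha; \<beta> = gen Gbeta in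
     presented_group {Ga, Gb, Gc, Galpha, Gbeta}
      {(wcomm b a, wpow c (2 * k)), (wcomm c a, []), (wcomm c b, []), (wcomm c \<alpha>, []),
       (wcomm a \<beta>, []),
       (\<alpha> @ a, winv a @ \<alpha> @ wpow c k), (\<alpha> @ b, winv b @ \<alpha> @ wpow (winv c) k),
       (\<beta> @ b, winv b @ \<beta> @ wpow (winv c) k), (\<beta> @ c, winv c @ \<beta>),
       (\<alpha> @ \<beta>, winv a @ winv b @ \<beta> @ \<alpha> @ wpow (winv c) (k + 1)),
       (\<alpha> @ \<alpha>, c), (\<beta> @ \<beta>, a)})"


section \<open>Diffeomorphisms between quotient manifolds\<close>

text \<open>\<open>C\<^sup>n\<close> and \<open>C\<^sup>\<infinity>\<close> maps on an open subset of a Euclidean space.\<close>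

primrec ck_on :: "nat \<Rightarrow> 'a::euclidean_space set \<Rightarrow> ('a \<Rightarrow> 'b::euclidean_space) \<Rightarrow> bool" where
  "ck_on 0 S f \<longleftrightarrow> continuous_on S f"
| "ck_on (Suc n) S f \<longleftrightarrow>
     (\<forall>x\<in>S. f differentiable (at x)) \<and> (\<forall>v. ck_on n S (\<lambda>x. frechet_derivative f (at x) v))"

definition smooth_on :: "'a::euclidean_space set \<Rightarrow> ('a \<Rightarrow> 'b::euclidean_space) \<Rightarrow> bool" where
  "smooth_on S f \<longleftrightarrow> (\<forall>n. ck_on n S f)"

text \<open>A manifold is given as a set \<open>M\<close> with a map \<open>\<phi>\<close>, injective on \<open>M\<close>, identifying it with an
  embedded submanifold of a Euclidean space. As usual, a map defined on part of such a submanifold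
  is smooth if locally it is the restriction of a smooth map on an open set of the ambient space.
  If \<open>G\<close> acts freely and properly discontinuously on \<open>M\<close>, the projection of \<open>M\<close> onto its orbit
  space is a local diffeomorphism, so a map \<open>F\<close> from the orbit space of \<open>(M, G)\<close> to that of
  \<open>(N, H)\<close> is smooth iff near each point of \<open>M\<close> it is covered by a smooth map \<open>f\<close> into \<open>N\<close>.\<close>

abbreviation orbit_of :: "('p \<Rightarrow> 'p, 'c) monoid_scheme \<Rightarrow> 'p \<Rightarrow> 'p set" where
  "orbit_of G \<equiv> orbit G (\<lambda>g. g)"

abbreviation orbit_space :: "('p \<Rightarrow> 'p, 'c) monoid_scheme \<Rightarrow> 'p set \<Rightarrow> 'p set set" where
  "orbit_space G M \<equiv> orbits G M (\<lambda>g. g)"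

definition smooth_between_quotients ::
  "('p \<Rightarrow> 'a::euclidean_space) \<Rightarrow> 'p set \<Rightarrow> ('p \<Rightarrow> 'p, 'c) monoid_scheme \<Rightarrow>
   ('q \<Rightarrow> 'b::euclidean_space) \<Rightarrow> 'q set \<Rightarrow> ('q \<Rightarrow> 'q, 'd) monoid_scheme \<Rightarrow>
   ('p set \<Rightarrow> 'q set) \<Rightarrow> bool" where
  "smooth_between_quotients \<phi> M G \<psi> N H F \<longleftrightarrow>
     (\<forall>x\<in>M. \<exists>V h f. open V \<and> \<phi> x \<in> V \<and> smooth_on V h \<and>
        (\<forall>y\<in>M. \<phi> y \<in> V \<longrightarrow>
           f y \<in> N \<and> \<psi> (f y) = h (\<phi> y) \<and> F (orbit_of G y) = orbit_of H (f y)))"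

definition diffeomorphic_quotients ::
  "('p \<Rightarrow> 'a::euclidean_space) \<Rightarrow> 'p set \<Rightarrow> ('p \<Rightarrow> 'p, 'c) monoid_scheme \<Rightarrow>
   ('q \<Rightarrow> 'b::euclidean_space) \<Rightarrow> 'q set \<Rightarrow> ('q \<Rightarrow> 'q, 'd) monoid_scheme \<Rightarrow> bool" where
  "diffeomorphic_quotients \<phi> M G \<psi> N H \<longleftrightarrow>
     (\<exists>F. bij_betw F (orbit_space G M) (orbit_space H N) \<and>
        smooth_between_quotients \<phi> M G \<psi> N H F \<and>
        smooth_between_quotients \<psi> N H \<phi> M G (inv_into (orbit_space G M) F))"


section \<open>The complex hyperbolic plane\<close>

definition herm_matrix :: "complex^3^3" where
  "herm_matrix = vector [vector [0, 0, 1], vector [0, 1, 0], vector [1, 0, 0]]"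

definition herm :: "complex^3 \<Rightarrow> complex^3 \<Rightarrow> complex" where
  "herm X Y = (\<Sum>i\<in>UNIV. \<Sum>j\<in>UNIV. cnj (Y $ i) * herm_matrix $ i $ j * X $ j)"

text \<open>Points of the projective plane are complex lines, as subsets of \<open>\<complex>\<^sup>3\<close>; \<open>vec.span\<close> is the
  complex linear span.\<close>

abbreviation cline :: "complex^3 \<Rightarrow> (complex^3) set" where
  "cline X \<equiv> vec.span {X}"

definition CP2 :: "(complex^3) set set" where
  "CP2 = {cline X | X. X \<noteq> 0}"

definition H2C :: "(complex^3) set set" where
  "H2C = {cline X | X. Re (herm X X) < 0}"

definition ideal_boundary :: "(complex^3) set set" where
  "ideal_boundary = {cline X | X. X \<noteq> 0 \<and> herm X X = 0}"

definition hdist :: "(complex^3) set \<Rightarrow> (complex^3) set \<Rightarrow> real" where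
  "hdist L M = (THE r. r \<ge> 0 \<and>
     (\<forall>X\<in>L - {0}. \<forall>Y\<in>M - {0}.
        (cosh (r / 2))\<^sup>2 = (cmod (herm X Y))\<^sup>2 / (Re (herm X X) * Re (herm Y Y))))"

text \<open>Every negative line contains exactly one vector with last coordinate 1, so the affine chart
  identifies the complex hyperbolic plane with an open subset of \<open>\<complex>\<^sup>2\<close>.\<close>

definition affine_chart :: "(complex^3) set \<Rightarrow> complex \<times> complex" where
  "affine_chart L = (THE p. vector [fst p, snd p, 1] \<in> L)"

definition U21 :: "(complex^3^3) set" where
  "U21 = {A. invertible A \<and> (\<forall>X Y. herm (A *v X) (A *v Y) = herm X Y)}"

definition proj :: "complex^3^3 \<Rightarrow> (complex^3) set \<Rightarrow> (complex^3) set" where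
  "proj A = (\<lambda>L\<in>CP2. (*v) A ` L)"

definition PU21 :: "((complex^3) set \<Rightarrow> (complex^3) set) set" where
  "PU21 = proj ` U21"

definition proj_conj :: "(complex^3) set \<Rightarrow> (complex^3) set" where
  "proj_conj = (\<lambda>L\<in>CP2. (\<lambda>X. \<chi> i. cnj (X $ i)) ` L)"

definition isom_H2C :: "((complex^3) set \<Rightarrow> (complex^3) set) monoid" where
  "isom_H2C = (BijGroup CP2)\<lparr>carrier := PU21 \<union> (\<lambda>g. compose CP2 g proj_conj) ` PU21\<rparr>"

text \<open>Discreteness: the identity is isolated. \<open>PU21\<close> is open in the isometry group and carries the
  quotient topology of \<open>U21\<close>, so the images of the balls about the identity matrix are a basis of
  neighbourhoods of the identity.\<close>

definition discrete_in_isom_H2C :: "((complex^3) set \<Rightarrow> (complex^3) set) set \<Rightarrow> bool" where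
  "discrete_in_isom_H2C \<Gamma> \<longleftrightarrow>
     (\<exists>\<epsilon>>0. \<forall>A\<in>U21. dist A (mat 1) < \<epsilon> \<and> proj A \<in> \<Gamma> \<longrightarrow> proj A = \<one>\<^bsub>isom_H2C\<^esub>)"

definition parabolic :: "((complex^3) set \<Rightarrow> (complex^3) set) \<Rightarrow> bool" where
  "parabolic g \<longleftrightarrow> g \<in> carrier isom_H2C \<and>
     (\<forall>L\<in>H2C. g L \<noteq> L) \<and> (\<exists>!q. q \<in> ideal_boundary \<and> g q = q)"

definition cusp_point ::
  "((complex^3) set \<Rightarrow> (complex^3) set) set \<Rightarrow> (complex^3) set \<Rightarrow> bool" where
  "cusp_point \<Gamma> q \<longleftrightarrow> q \<in> ideal_boundary \<and> (\<exists>g\<in>\<Gamma>. parabolic g \<and> g q = q)"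

text \<open>Unit speed geodesic rays ending at the ideal point \<open>q\<close>. Convergence in the projective plane
  is convergence of suitable nonzero representatives.\<close>

definition geodesic_ray_to :: "(real \<Rightarrow> (complex^3) set) \<Rightarrow> (complex^3) set \<Rightarrow> bool" where
  "geodesic_ray_to \<gamma> q \<longleftrightarrow>
     (\<forall>t\<ge>0. \<gamma> t \<in> H2C) \<and>
     (\<forall>s\<ge>0. \<forall>t\<ge>0. hdist (\<gamma> s) (\<gamma> t) = \<bar>s - t\<bar>) \<and>
     (\<exists>X Q. (\<forall>t\<ge>0. \<gamma> t = cline (X t)) \<and> Q \<noteq> 0 \<and> q = cline Q \<and> (X \<longlongrightarrow> Q) at_top)"

text \<open>Horospheres are the level sets of the Busemann functions.\<close>

definition horosphere :: "(complex^3) set \<Rightarrow> (complex^3) set set \<Rightarrow> bool" where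
  "horosphere q S \<longleftrightarrow> q \<in> ideal_boundary \<and>
     (\<exists>\<gamma> c. geodesic_ray_to \<gamma> q \<and>
        S = {L \<in> H2C. ((\<lambda>t. hdist L (\<gamma> t) - t) \<longlongrightarrow> c) at_top})"


section \<open>Picard modular groups\<close>

definition ring_of_ints :: "nat \<Rightarrow> complex set" where
  "ring_of_ints d =
     {z. algebraic_int z \<and> (\<exists>x\<in>\<rat>. \<exists>y\<in>\<rat>. z = x + y * (\<i> * complex_of_real (sqrt (real d))))}"

definition picard_group :: "nat \<Rightarrow> ((complex^3) set \<Rightarrow> (complex^3) set) set" where
  "picard_group d = proj ` {A \<in> U21. \<forall>i j. A $ i $ j \<in> ring_of_ints d}"


section \<open>Nil manifolds\<close>

type_synonym nil_point = "complex \<times> real"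

definition nil_mult :: "nil_point \<Rightarrow> nil_point \<Rightarrow> nil_point" where
  "nil_mult p q = (fst p + fst q, snd p + snd q + 2 * Im (fst p * cnj (fst q)))"

text \<open>The isometry with translation part \<open>v\<close> and rotation part \<open>u\<close>; the flag says whether the
  involution \<open>(z, t) \<mapsto> (cnj z, - t)\<close> is applied first.\<close>

definition nil_isometry :: "nil_point \<Rightarrow> complex \<Rightarrow> bool \<Rightarrow> nil_point \<Rightarrow> nil_point" where
  "nil_isometry v u e =
     (\<lambda>(z, t). nil_mult v (if e then (u * cnj z, - t) else (u * z, t)))"

definition isom_nil :: "(nil_point \<Rightarrow> nil_point) monoid" where
  "isom_nil = (BijGroup UNIV)\<lparr>carrier := {nil_isometry v u e | v u e. cmod u = 1}\<rparr>"

text \<open>Again discreteness says that the identity is isolated; the isometry group is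
  homeomorphic to \<open>Nil \<times> U(1) \<times> \<int>\<^sub>2\<close>.\<close>

definition discrete_in_isom_nil :: "(nil_point \<Rightarrow> nil_point) set \<Rightarrow> bool" where
  "discrete_in_isom_nil \<Delta> \<longleftrightarrow>
     (\<exists>\<epsilon>>0. \<forall>v u. cmod u = 1 \<and> dist v 0 < \<epsilon> \<and> dist u 1 < \<epsilon> \<and> nil_isometry v u False \<in> \<Delta>
        \<longrightarrow> nil_isometry v u False = \<one>\<^bsub>isom_nil\<^esub>)"

text \<open>\<open>\<Delta>\<close> is the fundamental group of the Nil 3-manifold \<open>Nil / \<Delta>\<close>.\<close>

definition nil_manifold_group :: "(nil_point \<Rightarrow> nil_point) set \<Rightarrow> bool" where
  "nil_manifold_group \<Delta> \<longleftrightarrow>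
     subgroup \<Delta> isom_nil \<and> discrete_in_isom_nil \<Delta> \<and>
     torsion_free (isom_nil\<lparr>carrier := \<Delta>\<rparr>) \<and>
     (\<exists>T. quotient_map euclidean T (orbit_of (isom_nil\<lparr>carrier := \<Delta>\<rparr>)) \<and> compact_space T)"

definition is_nil_torus :: "(nil_point \<Rightarrow> nil_point) set \<Rightarrow> bool" where
  "is_nil_torus \<Delta> \<longleftrightarrow> (\<exists>k>0. isom_nil\<lparr>carrier := \<Delta>\<rparr> \<cong> nil_torus_group k)"

definition is_vertical_half_twist :: "(nil_point \<Rightarrow> nil_point) set \<Rightarrow> bool" where
  "is_vertical_half_twist \<Delta> \<longleftrightarrow>
     (\<exists>k>0. even k \<and> isom_nil\<lparr>carrier := \<Delta>\<rparr> \<cong> vertical_half_twist_group k)"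

definition is_horizontal_half_twist :: "(nil_point \<Rightarrow> nil_point) set \<Rightarrow> bool" where
  "is_horizontal_half_twist \<Delta> \<longleftrightarrow>
     (\<exists>k>0. isom_nil\<lparr>carrier := \<Delta>\<rparr> \<cong> horizontal_half_twist_group k)"

definition is_double_half_twist :: "(nil_point \<Rightarrow> nil_point) set \<Rightarrow> bool" where
  "is_double_half_twist \<Delta> \<longleftrightarrow>
     (\<exists>k>0. even k \<and> isom_nil\<lparr>carrier := \<Delta>\<rparr> \<cong> double_half_twist_group k)"


section \<open>Cusp cross-sections\<close>

text \<open>A subgroup commensurable to a Picard modular group is automatically a lattice, so finiteness
  of the volume of the quotient is not listed separately.\<close>

definition occurs_as_cusp_cross_section :: "(nil_point \<Rightarrow> nil_point) set \<Rightarrow> nat \<Rightarrow> bool" where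
  "occurs_as_cusp_cross_section \<Delta> d \<longleftrightarrow>
     (\<exists>\<Gamma>. subgroup \<Gamma> isom_H2C \<and> torsion_free (isom_H2C\<lparr>carrier := \<Gamma>\<rparr>) \<and>
        discrete_in_isom_H2C \<Gamma> \<and> commensurable isom_H2C \<Gamma> (picard_group d) \<and>
        (\<exists>q S. cusp_point \<Gamma> q \<and> horosphere q S \<and>
           diffeomorphic_quotients
             (\<lambda>x. x) UNIV (isom_nil\<lparr>carrier := \<Delta>\<rparr>)
             affine_chart S
             (isom_H2C\<lparr>carrier := stabilizer (isom_H2C\<lparr>carrier := \<Gamma>\<rparr>) (\<lambda>g. g) q\<rparr>)))"

end

theory Submission
  imports Defs "HOL-Real_Asymp.Real_Asymp"
begin

text \<open>The stabilizer of a point at infinity acts on horospheres as the isometry group of Nil. By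
  cocompactness the generators \<open>a\<close>, \<open>b\<close>, \<open>c\<close> of the fundamental group are translations of Nil: their
  displacement in the base plane is an invariant function, hence bounded. An affine map of Nil then
  conjugates the group to one whose elements are given by matrices with entries in \<open>\<int>[\<surd>-d]\<close> that
  are diagonal modulo 3.

  Let \<open>\<Gamma>\<close> consist of the integral isometries that are congruent modulo \<open>N\<close> to an element of this
  group. If \<open>N\<close> is sufficiently divisible, the stabilizer of the cusp in \<open>\<Gamma>\<close> is exactly the given
  group. A torsion element of \<open>\<Gamma>\<close> has a square congruent to 1 modulo 3, which is 1 by Minkowski's
  lemma; this contradicts the parity of the translation parts of the squares of half-turns, unless
  the element itself is congruent to 1 modulo 3.\<close>

section \<open>Semilinear maps of the projective plane\<close>

text \<open>The conclusion asks only for a diffeomorphism, so the lattice may be moved by any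
  automorphism of Nil, isometric or not. Up to these the only invariant of the translation lattice
  is the exponent in \<open>[b, a] = c^K\<close>, hence every \<open>d\<close> serves equally well.
  This needs \<open>c\<close> to be nontrivial in the abstract group, which is read off from a
  homomorphism to a known group. The order Z[sqrt(-d)] stands in for the ring of integers: its
  coordinates are plain integers whatever \<open>d\<close> modulo 4, its nonzero elements have
  modulus at least 1, and it contains twice every integer of the field, which suffices for
  commensurability. The obstacle is that the group must be torsion free and yet contain half-turns,
  whose linear parts are not trivial modulo 3; a principal congruence subgroup alone is therefore
  too small. Adding the residue classes of the given group modulo \<open>N\<close> repairs this,
  provided that the square of each half-turn has a translation part that is nonzero modulo
  \<open>N\<close>. This is why the coordinates record parities and residues modulo 8.\<close>

definition cnj_if :: "bool \<Rightarrow> complex \<Rightarrow> complex" where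
  "cnj_if e z = (if e then cnj z else z)"

definition cnj_vec :: "bool \<Rightarrow> complex^3 \<Rightarrow> complex^3" where
  "cnj_vec e X = (\<chi> i. cnj_if e (X $ i))"

definition cnj_mat :: "bool \<Rightarrow> complex^3^3 \<Rightarrow> complex^3^3" where
  "cnj_mat e A = (\<chi> i j. cnj_if e (A $ i $ j))"

text \<open>The flag carries the antiholomorphic isometries along: with \<open>e\<close> true the
  map is semilinear, so both components of the isometry group are handled by one family of
  maps.\<close>

definition proj_map :: "complex^3^3 \<Rightarrow> bool \<Rightarrow> (complex^3) set \<Rightarrow> (complex^3) set" where
  "proj_map A e = (\<lambda>L\<in>CP2. (\<lambda>X. A *v cnj_vec e X) ` L)"

text \<open>The permutation of the basis given by the form matrix; it turns conjugation by that
  matrix into a change of indices.\<close>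

definition swap13 :: "3 \<Rightarrow> 3" where
  "swap13 i = (if i = 1 then 3 else if i = 2 then 2 else 1)"

text \<open>The adjoint for the Hermitian form, that is H A^+ H with A^+ the conjugate
  transpose.\<close>

definition herm_adj :: "complex^3^3 \<Rightarrow> complex^3^3" where
  "herm_adj A = (\<chi> i j. cnj (A $ swap13 j $ swap13 i))"

lemma cnj_if_simps [simp]:
  "cnj_if e 0 = 0" "cnj_if e 1 = 1" "cnj_if e (a + b) = cnj_if e a + cnj_if e b" "cnj_if e (a * b) = cnj_if e a * cnj_if e b"
  "cnj_if e (a - b) = cnj_if e a - cnj_if e b" "cnj_if e (- a) = - cnj_if e a"
  "cnj_if e (cnj_if f a) = cnj_if (e \<noteq> f) a" "cnj_if False a = a" "cnj_if True a = cnj a" "cnj_if e (cnj a) = cnj (cnj_if e a)"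
  "cnj_if e (of_real r) = of_real r" "cmod (cnj_if e a) = cmod a" "Re (cnj_if e a) = Re a"
  "cnj_if e a = 0 \<longleftrightarrow> a = 0"
  by (auto simp: cnj_if_def)

lemma cnj_if_sum: "cnj_if e (sum f S) = (\<Sum>i\<in>S. cnj_if e (f i))"
  by (auto simp: cnj_if_def)

lemma swap13_simps [simp]: "swap13 1 = 3" "swap13 2 = 2" "swap13 3 = 1" "swap13 (swap13 i) = i"
  using exhaust_3[of i] by (auto simp: swap13_def)

lemma cnj_vec_scale: "cnj_vec e (c *s X) = cnj_if e c *s cnj_vec e X"
  by (simp add: cnj_vec_def vec_eq_iff)

lemma cnj_vec_cnj_vec [simp]: "cnj_vec e (cnj_vec f X) = cnj_vec (e \<noteq> f) X" "cnj_vec False X = X"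
  by (auto simp: cnj_vec_def vec_eq_iff)

lemma cnj_mat_cnj_mat [simp]: "cnj_mat e (cnj_mat f X) = cnj_mat (e \<noteq> f) X" "cnj_mat False X = X"
  by (auto simp: cnj_mat_def vec_eq_iff)

lemma cnj_vec_eq_0 [simp]: "cnj_vec e X = 0 \<longleftrightarrow> X = 0"
  by (simp add: cnj_vec_def vec_eq_iff)

lemma cnj_vec_mult: "cnj_vec e (A *v X) = cnj_mat e A *v cnj_vec e X"
  by (simp add: cnj_vec_def cnj_mat_def vec_eq_iff matrix_vector_mult_def cnj_if_sum)

lemma cnj_mat_mult: "cnj_mat e (A ** B) = cnj_mat e A ** cnj_mat e B"
  by (simp add: cnj_mat_def vec_eq_iff matrix_matrix_mult_def cnj_if_sum)

lemma cnj_mat_mat_1 [simp]: "cnj_mat e (mat 1) = mat 1"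
  by (auto simp: cnj_mat_def vec_eq_iff mat_def)

lemma herm_adj_mult: "herm_adj (A ** B) = herm_adj B ** herm_adj A"
proof -
  have "(\<Sum>k\<in>UNIV. A $ i $ k * B $ k $ j) = (\<Sum>k\<in>UNIV. A $ i $ swap13 k * B $ swap13 k $ j)" for i j
    by (simp add: sum_3)
  then show ?thesis
    by (simp add: herm_adj_def vec_eq_iff matrix_matrix_mult_def mult.commute)
qed

lemma herm_adj_herm_adj [simp]: "herm_adj (herm_adj A) = A"
  by (simp add: herm_adj_def vec_eq_iff)

lemma herm_adj_mat_1 [simp]: "herm_adj (mat 1) = mat 1"
proof -
  have "swap13 j = swap13 i \<longleftrightarrow> i = j" for i j by (metis swap13_simps(4))
  then show ?thesis by (auto simp: herm_adj_def vec_eq_iff mat_def)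
qed

lemma herm_adj_cnj_mat: "herm_adj (cnj_mat e A) = cnj_mat e (herm_adj A)"
  by (simp add: herm_adj_def cnj_mat_def vec_eq_iff)

section \<open>The Hermitian form and membership in U(2,1)\<close>

lemma herm_eq: "herm X Y = X $ 1 * cnj (Y $ 3) + X $ 2 * cnj (Y $ 2) + X $ 3 * cnj (Y $ 1)"
  by (simp add: herm_def herm_matrix_def sum_3 vector_3)

lemma herm_adjoint: "herm (A *v X) Y = herm X (herm_adj A *v Y)"
  by (simp add: herm_eq herm_adj_def matrix_vector_mult_def sum_3 algebra_simps)

lemma herm_nondegenerate:
  assumes "\<And>X. herm X Y = herm X Z"
  shows "Y = Z"
  using assms[of "axis 1 1"] assms[of "axis 2 1"] assms[of "axis 3 1"]
  by (simp add: herm_eq axis_def vec_eq_iff forall_3)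

lemma matrix_ext: "(\<And>X. A *v X = B *v X) \<Longrightarrow> A = (B :: complex^3^3)"
  by (simp add: matrix_eq)

lemma U21_iff: "A \<in> U21 \<longleftrightarrow> herm_adj A ** A = mat 1"
proof
  assume "A \<in> U21"
  then have "herm X (herm_adj A *v (A *v Y)) = herm X Y" for X Y
    unfolding U21_def by (simp flip: herm_adjoint)
  then have "herm_adj A *v (A *v Y) = Y" for Y
    by (rule herm_nondegenerate)
  then show "herm_adj A ** A = mat 1"
    by (intro matrix_ext) (simp add: matrix_vector_mul_assoc[symmetric])
next
  assume *: "herm_adj A ** A = mat 1"
  then have "herm (A *v X) (A *v Y) = herm X Y" for X Y
    by (simp add: herm_adjoint matrix_vector_mul_assoc)
  with * show "A \<in> U21"
    unfolding U21_def by (auto simp: invertible_left_inverse)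
qed

lemma U21_right_inv: "A \<in> U21 \<Longrightarrow> A ** herm_adj A = mat 1"
  unfolding U21_iff using matrix_left_right_inverse by blast

lemma U21_mult: "A \<in> U21 \<Longrightarrow> B \<in> U21 \<Longrightarrow> A ** B \<in> U21"
  unfolding U21_iff herm_adj_mult
  by (metis matrix_mul_assoc matrix_mul_lid)

lemma U21_herm_adj: "A \<in> U21 \<Longrightarrow> herm_adj A \<in> U21"
  by (simp add: U21_iff U21_right_inv[unfolded U21_iff])

lemma U21_cnj_mat: "A \<in> U21 \<Longrightarrow> cnj_mat e A \<in> U21"
  by (simp add: U21_iff herm_adj_cnj_mat flip: cnj_mat_mult)

lemma U21_mat_1 [simp]: "mat 1 \<in> U21"
  by (simp add: U21_iff)

lemma U21_mult_eq_0: "A \<in> U21 \<Longrightarrow> A *v X = 0 \<longleftrightarrow> X = 0"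
  by (metis U21_iff matrix_vector_mul_assoc matrix_vector_mul_lid matrix_vector_mult_0_right)

section \<open>Complex lines and the maps induced on them\<close>

lemma cline_eq: "cline X = range (\<lambda>c. c *s X)"
  by (rule vec.span_singleton)

lemma cline_in_CP2: "X \<noteq> 0 \<Longrightarrow> cline X \<in> CP2"
  by (auto simp: CP2_def)

lemma cline_eqE:
  assumes "cline X = cline Y" "Y \<noteq> 0"
  obtains c where "c \<noteq> 0" "Y = c *s X"
proof -
  have "Y \<in> cline X" using assms(1) vec.span_base[of Y "{Y}"] by simp
  then obtain c where "Y = c *s X" by (auto simp: cline_eq)
  with assms(2) that show thesis by force
qed

lemma cline_scale: "c \<noteq> 0 \<Longrightarrow> cline (c *s X) = cline X"
proof -
  assume c: "c \<noteq> 0"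
  have "d *s X \<in> range (\<lambda>k. (k * c) *s X)" for d
    by (rule image_eqI[of _ _ "d / c"]) (use c in auto)
  then show ?thesis
    by (auto simp: cline_eq vector_smult_assoc)
qed

lemma proj_map_cline:
  assumes "X \<noteq> 0"
  shows "proj_map A e (cline X) = cline (A *v cnj_vec e X)"
proof -
  have "c *s Y \<in> range (\<lambda>x. cnj_if e x *s Y)" for c and Y :: "complex^3"
    by (rule image_eqI[of _ _ "cnj_if e c"]) (auto simp: cnj_if_def)
  moreover have "proj_map A e (cline X) = range (\<lambda>c. cnj_if e c *s (A *v cnj_vec e X))"
    using cline_in_CP2[OF assms]
    by (simp add: proj_map_def cline_eq image_image cnj_vec_scale vector_scalar_commute)
  ultimately show ?thesis
    by (auto simp: cline_eq cnj_if_def)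
qed

lemma proj_map_CP2: "A \<in> U21 \<Longrightarrow> L \<in> CP2 \<Longrightarrow> proj_map A e L \<in> CP2"
  using U21_mult_eq_0 cnj_vec_eq_0 by (fastforce simp: CP2_def proj_map_cline)

text \<open>Moving the conjugation of the left factor past \<open>B\<close> conjugates the entries
  of \<open>B\<close>; this twisted product recurs in all computations below.\<close>

lemma proj_map_mult:
  assumes "A \<in> U21" "B \<in> U21"
  shows "compose CP2 (proj_map A e) (proj_map B f) = proj_map (A ** cnj_mat e B) (e \<noteq> f)"
proof
  fix L
  show "compose CP2 (proj_map A e) (proj_map B f) L = proj_map (A ** cnj_mat e B) (e \<noteq> f) L"
  proof (cases "L \<in> CP2")
    case True
    then obtain X where X: "L = cline X" "X \<noteq> 0" by (auto simp: CP2_def)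
    with True assms show ?thesis
      by (simp add: compose_def proj_map_cline U21_mult_eq_0 cnj_vec_mult matrix_vector_mul_assoc)
  qed (simp add: compose_def proj_map_def)
qed

lemma proj_map_mat_1: "proj_map (mat 1) False = (\<lambda>L\<in>CP2. L)"
  by (auto simp: proj_map_def)

lemma proj_map_inverse:
  assumes "A \<in> U21"
  shows "compose CP2 (proj_map A e) (proj_map (cnj_mat e (herm_adj A)) e) = (\<lambda>L\<in>CP2. L)"
    and "compose CP2 (proj_map (cnj_mat e (herm_adj A)) e) (proj_map A e) = (\<lambda>L\<in>CP2. L)"
  using assms
  by (simp_all add: proj_map_mult U21_cnj_mat U21_herm_adj U21_right_inv proj_map_mat_1 U21_iff[THEN iffD1] flip: cnj_mat_mult)

lemma proj_map_Bij:
  assumes "A \<in> U21"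
  shows "proj_map A e \<in> Bij CP2"
proof -
  let ?B = "proj_map (cnj_mat e (herm_adj A)) e"
  have "?B (proj_map A e L) = L" "proj_map A e (?B L) = L" if "L \<in> CP2" for L
    using fun_cong[OF proj_map_inverse(1)[OF assms, of e], of L]
      fun_cong[OF proj_map_inverse(2)[OF assms, of e], of L] that
    by (simp_all add: compose_def)
  then have "bij_betw (proj_map A e) CP2 CP2"
    by (intro bij_betw_byWitness[where f' = ?B])
      (auto intro: proj_map_CP2 simp: assms U21_cnj_mat U21_herm_adj)
  then show ?thesis by (simp add: Bij_def proj_map_def)
qed

lemma proj_eq_proj_map: "proj A = proj_map A False"
  by (simp add: proj_def proj_map_def)

lemma proj_conj_eq_proj_map: "proj_conj = proj_map (mat 1) True"
  by (simp add: proj_conj_def proj_map_def cnj_vec_def)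

section \<open>The full isometry group in terms of matrices and flags\<close>

lemma carrier_isom_H2C: "carrier isom_H2C = {proj_map A e | A e. A \<in> U21}"
proof -
  have "compose CP2 (proj A) proj_conj = proj_map A True" if "A \<in> U21" for A
    using that by (simp add: proj_eq_proj_map proj_conj_eq_proj_map proj_map_mult)
  then have 1: "carrier isom_H2C = (\<lambda>A. proj_map A False) ` U21 \<union> (\<lambda>A. proj_map A True) ` U21"
    by (simp add: isom_H2C_def PU21_def proj_eq_proj_map image_image)
  have "x \<in> (\<lambda>A. proj_map A False) ` U21 \<union> (\<lambda>A. proj_map A True) ` U21"
    if "x = proj_map A e" "A \<in> U21" for x A e
    using that by (cases e) auto
  then have "{proj_map A e | A e. A \<in> U21} \<subseteq> (\<lambda>A. proj_map A False) ` U21 \<union> (\<lambda>A. proj_map A True) ` U21"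
    by auto
  moreover have "(\<lambda>A. proj_map A False) ` U21 \<union> (\<lambda>A. proj_map A True) ` U21 \<subseteq> {proj_map A e | A e. A \<in> U21}"
    by auto
  ultimately show ?thesis using 1 by (simp only: subset_antisym)
qed

lemma mult_isom_H2C:
  assumes "A \<in> U21" "B \<in> U21"
  shows "proj_map A e \<otimes>\<^bsub>isom_H2C\<^esub> proj_map B f = proj_map (A ** cnj_mat e B) (e \<noteq> f)"
  using assms by (simp add: isom_H2C_def BijGroup_def proj_map_Bij proj_map_mult)

lemma one_isom_H2C: "\<one>\<^bsub>isom_H2C\<^esub> = proj_map (mat 1) False"
  by (simp add: isom_H2C_def BijGroup_def proj_map_mat_1)

lemma group_isom_H2C: "group isom_H2C"
proof (rule groupI)
  fix x assume "x \<in> carrier isom_H2C"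
  then obtain A e where x: "x = proj_map A e" "A \<in> U21" by (auto simp: carrier_isom_H2C)
  then have "proj_map (cnj_mat e (herm_adj A)) e \<otimes>\<^bsub>isom_H2C\<^esub> x = \<one>\<^bsub>isom_H2C\<^esub>"
    by (simp add: mult_isom_H2C U21_cnj_mat U21_herm_adj one_isom_H2C U21_iff[THEN iffD1] flip: cnj_mat_mult)
  with x show "\<exists>y\<in>carrier isom_H2C. y \<otimes>\<^bsub>isom_H2C\<^esub> x = \<one>\<^bsub>isom_H2C\<^esub>"
    by (auto simp: carrier_isom_H2C intro!: U21_cnj_mat U21_herm_adj)
next
  fix x y z assume "x \<in> carrier isom_H2C" "y \<in> carrier isom_H2C" "z \<in> carrier isom_H2C"
  then obtain A e B f C g where *: "x = proj_map A e" "y = proj_map B f" "z = proj_map C g"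
    "A \<in> U21" "B \<in> U21" "C \<in> U21"
    by (auto simp: carrier_isom_H2C)
  have "((e \<noteq> f) \<noteq> g) = (e \<noteq> (f \<noteq> g))" by (cases e; cases f; cases g) simp_all
  with * show "x \<otimes>\<^bsub>isom_H2C\<^esub> y \<otimes>\<^bsub>isom_H2C\<^esub> z = x \<otimes>\<^bsub>isom_H2C\<^esub> (y \<otimes>\<^bsub>isom_H2C\<^esub> z)"
    by (simp only: mult_isom_H2C U21_mult U21_cnj_mat cnj_mat_mult matrix_mul_assoc cnj_mat_cnj_mat)
next
  fix x y assume "x \<in> carrier isom_H2C" "y \<in> carrier isom_H2C"
  then show "x \<otimes>\<^bsub>isom_H2C\<^esub> y \<in> carrier isom_H2C"
    unfolding carrier_isom_H2C using mult_isom_H2C U21_mult U21_cnj_mat by blast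
next
  show "\<one>\<^bsub>isom_H2C\<^esub> \<in> carrier isom_H2C"
    unfolding carrier_isom_H2C one_isom_H2C using U21_mat_1 by blast
qed (auto simp: carrier_isom_H2C mult_isom_H2C one_isom_H2C)

lemma inv_isom_H2C:
  assumes "A \<in> U21"
  shows "inv\<^bsub>isom_H2C\<^esub> (proj_map A e) = proj_map (cnj_mat e (herm_adj A)) e"
proof -
  interpret group isom_H2C by (rule group_isom_H2C)
  have "proj_map (cnj_mat e (herm_adj A)) e \<in> carrier isom_H2C" "proj_map A e \<in> carrier isom_H2C"
    unfolding carrier_isom_H2C using assms U21_cnj_mat U21_herm_adj by blast+
  moreover have "proj_map (cnj_mat e (herm_adj A)) e \<otimes>\<^bsub>isom_H2C\<^esub> proj_map A e = \<one>\<^bsub>isom_H2C\<^esub>"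
    using assms by (simp add: mult_isom_H2C U21_cnj_mat U21_herm_adj one_isom_H2C U21_iff[THEN iffD1] flip: cnj_mat_mult)
  ultimately show ?thesis
    by (simp add: inv_equality)
qed

text \<open>The basis vectors force a diagonal matrix and (1, 1, 1) equal diagonal entries. The
  vector (1, i, 0) detects a conjugation, which fixes 1 and negates i.\<close>

lemma line_preserving_scalar:
  fixes A :: "complex^3^3"
  assumes "\<And>X. X \<noteq> 0 \<Longrightarrow> \<exists>c. A *v X = c *s cnj_vec e X"
  obtains c where "\<And>i j. A $ i $ j = (if i = j then c else 0)" "e = False \<or> c = 0"
proof -
  have 1: "\<exists>c. \<forall>i. (A *v X) $ i = c * cnj_if e (X $ i)" if "X \<noteq> 0" for X
    using assms[OF that] by (auto simp: vec_eq_iff cnj_vec_def)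
  have v: "vector [a, b, c] \<noteq> (0 :: complex^3)" if "a \<noteq> 0 \<or> b \<noteq> 0 \<or> c \<noteq> 0" for a b c
    using that by (auto simp: vec_eq_iff forall_3)
  note D = matrix_vector_mult_def sum_3 forall_3 vector_3
  obtain c1 where c1: "A $ 1 $ 1 = c1" "A $ 2 $ 1 = 0" "A $ 3 $ 1 = 0"
    using 1[OF v[of 1 0 0]] by (auto simp: D)
  obtain c2 where c2: "A $ 2 $ 2 = c2" "A $ 1 $ 2 = 0" "A $ 3 $ 2 = 0"
    using 1[OF v[of 0 1 0]] by (auto simp: D)
  obtain c3 where c3: "A $ 3 $ 3 = c3" "A $ 1 $ 3 = 0" "A $ 2 $ 3 = 0"
    using 1[OF v[of 0 0 1]] by (auto simp: D)
  have 12: "c1 = c2" "c2 = c3" using 1[OF v[of 1 1 1]] c1 c2 c3 by (auto simp: D)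
  have "e = False \<or> c1 = 0" using 1[OF v[of 1 \<i> 0]] c1 c2 c3 12 by (cases e) (auto simp: D)
  moreover have "\<forall>i j. A $ i $ j = (if i = j then c1 else 0)"
    using c1 c2 c3 12 by (simp add: forall_3)
  ultimately show thesis
    by (intro that[of c1]) simp_all
qed

text \<open>The matrix \<open>herm_adj B ** A\<close> preserves every line up to conjugation, so it
  is a scalar, and its unitarity relation at the entry (2, 2) gives the scalar modulus 1.\<close>

lemma proj_map_eq_imp:
  assumes "A \<in> U21" "B \<in> U21" "proj_map A e = proj_map B f"
  obtains c where "cmod c = 1" "\<And>i j. A $ i $ j = c * B $ i $ j" "e = f"
proof -
  let ?C = "herm_adj B ** A"
  have C: "?C \<in> U21" using assms by (simp add: U21_mult U21_herm_adj)
  have inv: "B *v (herm_adj B *v X) = X" "herm_adj B *v (B *v X) = X" for X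
    using assms(2) by (simp_all add: matrix_vector_mul_assoc U21_right_inv U21_iff[THEN iffD1])
  have "\<exists>c. ?C *v X = c *s cnj_vec (e \<noteq> f) X" if nz: "X \<noteq> 0" for X
  proof -
    \<comment> \<open>The argument is conjugated beforehand, so that \<open>A\<close> meets the
      plain vector and both flags end up on the side of \<open>B\<close>.\<close>
    have "proj_map A e (cline (cnj_vec e X)) = cline (A *v X)" "(e \<noteq> f) = (f \<noteq> e)"
      using nz by (auto simp: proj_map_cline)
    moreover have "proj_map B f (cline (cnj_vec e X)) = cline (B *v cnj_vec (f \<noteq> e) X)"
      using nz by (simp only: proj_map_cline cnj_vec_eq_0 not_False_eq_True cnj_vec_cnj_vec)
    ultimately have "cline (B *v cnj_vec (e \<noteq> f) X) = cline (A *v X)"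
      using assms(3) by simp
    then obtain c where "A *v X = c *s (B *v cnj_vec (e \<noteq> f) X)"
      by (rule cline_eqE) (use U21_mult_eq_0[OF assms(1)] nz in auto)
    then have "herm_adj B *v (A *v X) = c *s cnj_vec (e \<noteq> f) X"
      by (simp add: inv vector_scalar_commute)
    then show ?thesis by (auto simp: matrix_vector_mul_assoc)
  qed
  then obtain c where c: "\<And>i j. ?C $ i $ j = (if i = j then c else 0)" "(e \<noteq> f) = False \<or> c = 0"
    by (rule line_preserving_scalar) auto
  have "(herm_adj M ** M) $ 2 $ 2 = (\<Sum>k\<in>UNIV. cnj (M $ swap13 k $ 2) * M $ k $ 2)" for M
    by (simp add: matrix_matrix_mult_def herm_adj_def)
  moreover have "(herm_adj ?C ** ?C) $ 2 $ 2 = 1" using C by (simp add: U21_iff mat_def)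
  ultimately have "cnj c * c = 1" by (simp only: sum_3 c(1)) simp
  then have "(cmod c)\<^sup>2 = 1"
    by (metis complex_mod_cnj norm_mult norm_one power2_eq_square)
  then have n: "cmod c = 1" using norm_ge_zero[of c] by (auto simp: power2_eq_1_iff)
  have "B ** ?C = A" using assms(2) by (simp add: matrix_mul_assoc U21_right_inv)
  have BM: "(B ** M) $ i $ j = (\<Sum>k\<in>UNIV. B $ i $ k * M $ k $ j)" for M i j
    by (simp add: matrix_matrix_mult_def)
  have "(B ** ?C) $ i $ j = (\<Sum>k\<in>UNIV. B $ i $ k * (if k = j then c else 0))" for i j
    unfolding BM[of ?C] c(1) ..
  then have "(B ** ?C) $ i $ j = c * B $ i $ j" for i j
    by (simp add: if_distrib cong: if_cong)
  with \<open>B ** ?C = A\<close> have "A $ i $ j = c * B $ i $ j" for i j by (simp only:)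
  with n c(2) that show thesis by force
qed

lemma proj_map_scale:
  assumes "c \<noteq> 0" "\<And>i j. A $ i $ j = c * B $ i $ j" "B \<in> U21" 
  shows "proj_map A e = proj_map B e"
proof
  fix L
  show "proj_map A e L = proj_map B e L"
  proof (cases "L \<in> CP2")
    case True
    then obtain X where X: "L = cline X" "X \<noteq> 0" by (auto simp: CP2_def)
    have "A *v cnj_vec e X = c *s (B *v cnj_vec e X)"
      by (simp add: matrix_vector_mult_def vec_eq_iff assms(2) sum_distrib_left mult.assoc)
    with X show ?thesis by (simp add: proj_map_cline cline_scale assms(1))
  qed (simp add: proj_map_def)
qed

section \<open>Imaginary quadratic integers and congruences\<close>

text \<open>The order Z[sqrt(-d)], of index 1 or 2 in the ring of integers when \<open>d\<close> is
  squarefree.\<close>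

definition quad_ints :: "nat \<Rightarrow> complex set" where
  "quad_ints d = {of_int x + of_int y * (\<i> * of_real (sqrt (real d))) | x y. True}"

definition quad_mult :: "nat \<Rightarrow> int \<Rightarrow> complex set" where
  "quad_mult d N = {of_int N * z | z. z \<in> quad_ints d}"

definition int_mat :: "nat \<Rightarrow> complex^3^3 \<Rightarrow> bool" where
  "int_mat d A \<longleftrightarrow> (\<forall>i j. A $ i $ j \<in> quad_ints d)"

definition cong_mat :: "nat \<Rightarrow> int \<Rightarrow> complex^3^3 \<Rightarrow> complex^3^3 \<Rightarrow> bool" where
  "cong_mat d N A B \<longleftrightarrow> (\<forall>i j. A $ i $ j - B $ i $ j \<in> quad_mult d N)"

lemma gintI: "of_int x + of_int y * (\<i> * of_real (sqrt (real d))) \<in> quad_ints d"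
  by (auto simp: quad_ints_def)

lemma quad_ints_iff: "z \<in> quad_ints d \<longleftrightarrow> (\<exists>x y. Re z = of_int x \<and> Im z = of_int y * sqrt (real d))"
  by (auto simp: quad_ints_def complex_eq_iff)

lemma quad_ints_of_int [simp]: "of_int n \<in> quad_ints d"
  by (auto simp: quad_ints_iff intro!: exI[of _ 0])

lemma quad_ints_of_nat [simp]: "of_nat n \<in> quad_ints d"
  using quad_ints_of_int[of "int n" d] by simp

lemma quad_ints_0 [simp]: "0 \<in> quad_ints d" and quad_ints_1 [simp]: "1 \<in> quad_ints d"
  using quad_ints_of_int[of 0 d] quad_ints_of_int[of 1 d] by simp_all

lemma quad_ints_add [intro]: "a \<in> quad_ints d \<Longrightarrow> b \<in> quad_ints d \<Longrightarrow> a + b \<in> quad_ints d"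
  unfolding quad_ints_iff by (metis distrib_right of_int_add plus_complex.simps)

lemma quad_ints_minus [intro]: "a \<in> quad_ints d \<Longrightarrow> - a \<in> quad_ints d"
  unfolding quad_ints_iff by (metis mult_minus_left of_int_minus uminus_complex.simps)

lemma quad_ints_diff [intro]: "a \<in> quad_ints d \<Longrightarrow> b \<in> quad_ints d \<Longrightarrow> a - b \<in> quad_ints d"
  using quad_ints_add[OF _ quad_ints_minus] by fastforce

lemma quad_ints_cnj [intro]: "a \<in> quad_ints d \<Longrightarrow> cnj a \<in> quad_ints d"
  unfolding quad_ints_iff by (metis mult_minus_left of_int_minus cnj.simps)

lemma quad_ints_mult [intro]:
  assumes "a \<in> quad_ints d" "b \<in> quad_ints d"
  shows "a * b \<in> quad_ints d"
proof -
  obtain x y where a: "Re a = of_int x" "Im a = of_int y * sqrt (real d)" using assms(1) by (auto simp: quad_ints_iff)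
  obtain x' y' where b: "Re b = of_int x'" "Im b = of_int y' * sqrt (real d)" using assms(2) by (auto simp: quad_ints_iff)
  have "Re (a * b) = of_int (x * x' - int d * y * y')"
    by (simp add: a b algebra_simps)
  moreover have "Im (a * b) = of_int (x * y' + y * x') * sqrt (real d)"
    by (simp add: a b algebra_simps)
  ultimately show ?thesis unfolding quad_ints_iff by blast
qed

lemma quad_ints_sum: "(\<And>i. i \<in> S \<Longrightarrow> f i \<in> quad_ints d) \<Longrightarrow> sum f S \<in> quad_ints d"
  by (induction S rule: infinite_finite_induct) auto

lemma quad_mult_iff: "z \<in> quad_mult d N \<longleftrightarrow> (\<exists>x y. Re z = of_int (N * x) \<and> Im z = of_int (N * y) * sqrt (real d))"
proof
  assume "z \<in> quad_mult d N"
  then show "\<exists>x y. Re z = of_int (N * x) \<and> Im z = of_int (N * y) * sqrt (real d)"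
    by (auto simp: quad_mult_def quad_ints_def)
next
  assume "\<exists>x y. Re z = of_int (N * x) \<and> Im z = of_int (N * y) * sqrt (real d)"
  then obtain x y where "Re z = of_int (N * x)" "Im z = of_int (N * y) * sqrt (real d)" by auto
  then have "z = of_int N * (of_int x + of_int y * (\<i> * of_real (sqrt (real d))))"
    by (simp add: complex_eq_iff)
  then show "z \<in> quad_mult d N" unfolding quad_mult_def using gintI by blast
qed

lemma quad_mult_quad_ints: "z \<in> quad_mult d N \<Longrightarrow> z \<in> quad_ints d"
  by (auto simp: quad_mult_def)

lemma quad_mult_0 [simp]: "0 \<in> quad_mult d N"
  by (auto simp: quad_mult_def intro!: exI[of _ 0])

lemma quad_mult_add [intro]: "a \<in> quad_mult d N \<Longrightarrow> b \<in> quad_mult d N \<Longrightarrow> a + b \<in> quad_mult d N"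
  unfolding quad_mult_def by clarsimp (metis quad_ints_add distrib_left)

lemma quad_mult_minus [intro]: "a \<in> quad_mult d N \<Longrightarrow> - a \<in> quad_mult d N"
  unfolding quad_mult_def by clarsimp (metis quad_ints_minus mult_minus_right)

lemma quad_mult_cnj [intro]: "a \<in> quad_mult d N \<Longrightarrow> cnj a \<in> quad_mult d N"
  unfolding quad_mult_def by clarsimp (metis quad_ints_cnj complex_cnj_mult complex_cnj_of_int)

lemma quad_mult_mult_right [intro]: "a \<in> quad_mult d N \<Longrightarrow> b \<in> quad_ints d \<Longrightarrow> a * b \<in> quad_mult d N"
  unfolding quad_mult_def by clarsimp (metis quad_ints_mult mult.assoc)

lemma quad_mult_mult_left [intro]: "b \<in> quad_ints d \<Longrightarrow> a \<in> quad_mult d N \<Longrightarrow> b * a \<in> quad_mult d N"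
  using quad_mult_mult_right by (simp add: mult.commute)

lemma quad_mult_mult: "a \<in> quad_mult d M \<Longrightarrow> b \<in> quad_mult d N \<Longrightarrow> a * b \<in> quad_mult d (M * N)"
proof -
  assume "a \<in> quad_mult d M" "b \<in> quad_mult d N"
  then obtain x y where "a = of_int M * x" "b = of_int N * y" "x \<in> quad_ints d" "y \<in> quad_ints d"
    by (auto simp: quad_mult_def)
  then have "a * b = of_int (M * N) * (x * y)" "x * y \<in> quad_ints d" by auto
  then show ?thesis unfolding quad_mult_def by blast
qed

lemma quad_mult_sum: "(\<And>i. i \<in> S \<Longrightarrow> f i \<in> quad_mult d N) \<Longrightarrow> sum f S \<in> quad_mult d N"
  by (induction S rule: infinite_finite_induct) auto

lemma quad_mult_dvd: "M dvd N \<Longrightarrow> z \<in> quad_mult d N \<Longrightarrow> z \<in> quad_mult d M"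
  unfolding quad_mult_iff by (metis dvd_def mult.assoc)

lemma quad_mult_of_int: "N dvd n \<Longrightarrow> of_int n \<in> quad_mult d N"
  unfolding quad_mult_iff by (metis dvd_def Re_complex_of_real Im_complex_of_real complex_Re_of_int complex_Im_of_int mult_zero_right mult_zero_left of_int_0)

text \<open>The norm x^2 + d y^2 is a nonnegative integer that vanishes only at 0. Discreteness of
  the congruence group and the triviality of small units rest on this.\<close>

lemma quad_ints_norm_ge_1:
  assumes "d \<ge> 1" "z \<in> quad_ints d" "z \<noteq> 0"
  shows "cmod z \<ge> 1"
proof -
  obtain x y where z: "Re z = of_int x" "Im z = of_int y * sqrt (real d)"
    using assms(2) by (auto simp: quad_ints_iff)
  have "x \<noteq> 0 \<or> y \<noteq> 0" using assms(3) z by (auto simp: complex_eq_iff)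
  then have "x\<^sup>2 + y\<^sup>2 \<ge> 1"
    by (metis add_nonneg_nonneg int_one_le_iff_zero_less not_sum_power2_lt_zero sum_power2_gt_zero_iff)
  moreover have "y\<^sup>2 * int d \<ge> y\<^sup>2 * 1" using assms(1) by (intro mult_left_mono) auto
  ultimately have "x\<^sup>2 + y\<^sup>2 * int d \<ge> 1" by linarith
  then have "real_of_int (x\<^sup>2 + y\<^sup>2 * int d) \<ge> 1" by linarith
  then have "(cmod z)\<^sup>2 \<ge> 1"
    using assms(1) by (simp add: cmod_power2 z power_mult_distrib)
  then show ?thesis using power2_le_imp_le[of 1 "cmod z"] by simp
qed

lemma quad_mult_norm_ge:
  assumes "d \<ge> 1" "z \<in> quad_mult d N" "z \<noteq> 0" "N > 0"
  shows "cmod z \<ge> of_int N"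
proof -
  obtain w where w: "z = of_int N * w" "w \<in> quad_ints d" using assms(2) by (auto simp: quad_mult_def)
  then have "cmod w \<ge> 1" using quad_ints_norm_ge_1[OF assms(1)] assms(3) by auto
  then have "of_int N * 1 \<le> of_int N * cmod w" using assms(4) by (intro mult_left_mono) auto
  then show ?thesis using assms(4) by (simp add: w norm_mult)
qed

text \<open>Two numbers of modulus 1 have distance at most 2, less than the modulus of any nonzero
  element of \<open>quad_mult d N\<close>.\<close>

lemma unit_cong_1:
  assumes "d \<ge> 1" "cmod z = 1" "z - 1 \<in> quad_mult d N" "N \<ge> 3"
  shows "z = 1"
proof (rule ccontr)
  assume "z \<noteq> 1"
  then have "cmod (z - 1) \<ge> of_int N" using quad_mult_norm_ge[OF assms(1,3)] assms(4) by auto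
  moreover have "cmod (z - 1) \<le> 2" using norm_triangle_ineq4[of z 1] assms(2) by simp
  ultimately show False using assms(4) by linarith
qed

lemma cong_mat_refl [simp]: "cong_mat d N A A"
  by (simp add: cong_mat_def)

lemma cong_mat_sym: "cong_mat d N A B \<Longrightarrow> cong_mat d N B A"
  unfolding cong_mat_def using quad_mult_minus[of "A $ i $ j - B $ i $ j" d N for i j] by simp

lemma cong_mat_trans: "cong_mat d N A B \<Longrightarrow> cong_mat d N B C \<Longrightarrow> cong_mat d N A C"
  unfolding cong_mat_def using quad_mult_add[of "A $ i $ j - B $ i $ j" d N "B $ i $ j - C $ i $ j" for i j] by simp

lemma cong_mat_dvd: "M dvd N \<Longrightarrow> cong_mat d N A B \<Longrightarrow> cong_mat d M A B"
  unfolding cong_mat_def using quad_mult_dvd by blast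

lemma cong_mat_int_mat: "cong_mat d N A B \<Longrightarrow> int_mat d B \<Longrightarrow> int_mat d A"
  unfolding cong_mat_def int_mat_def
proof (intro allI)
  fix i j assume "\<forall>i j. A $ i $ j - B $ i $ j \<in> quad_mult d N" "\<forall>i j. B $ i $ j \<in> quad_ints d"
  then have "(A $ i $ j - B $ i $ j) + B $ i $ j \<in> quad_ints d" by (blast intro: quad_ints_add quad_mult_quad_ints)
  then show "A $ i $ j \<in> quad_ints d" by simp
qed

lemma int_mat_mat_1 [simp]: "int_mat d (mat 1)"
  by (simp add: int_mat_def mat_def)

text \<open>The difference splits as \<open>A (B - B') + (A - A') B'\<close>, which explains why
  integrality is asked of \<open>A\<close> and \<open>B'\<close>.\<close>

lemma cong_mat_mult:
  assumes "cong_mat d N A A'" "cong_mat d N B B'" "int_mat d A" "int_mat d B'"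
  shows "cong_mat d N (A ** B) (A' ** B')"
  unfolding cong_mat_def
proof (intro allI)
  fix i j
  have "(A ** B) $ i $ j - (A' ** B') $ i $ j =
      (\<Sum>k\<in>UNIV. A $ i $ k * (B $ k $ j - B' $ k $ j) + (A $ i $ k - A' $ i $ k) * B' $ k $ j)"
    by (simp add: matrix_matrix_mult_def sum_subtractf[symmetric] algebra_simps)
  also have "\<dots> \<in> quad_mult d N"
  proof (rule quad_mult_sum, rule quad_mult_add)
    fix k
    show "A $ i $ k * (B $ k $ j - B' $ k $ j) \<in> quad_mult d N"
      by (rule quad_mult_mult_left) (use assms in \<open>simp_all add: cong_mat_def int_mat_def\<close>)
    show "(A $ i $ k - A' $ i $ k) * B' $ k $ j \<in> quad_mult d N"
      by (rule quad_mult_mult_right) (use assms in \<open>simp_all add: cong_mat_def int_mat_def\<close>)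
  qed
  finally show "(A ** B) $ i $ j - (A' ** B') $ i $ j \<in> quad_mult d N" .
qed

section \<open>Minkowski's lemma\<close>

lemma matrix_add_distribs:
  "A ** (B + C) = A ** B + A ** C" "(B + C) ** A = B ** A + C ** A"
  for A B C :: "complex^3^3"
  by (simp_all add: matrix_matrix_mult_def vec_eq_iff algebra_simps sum.distrib)

primrec mat_pow :: "complex^3^3 \<Rightarrow> nat \<Rightarrow> complex^3^3" where
  "mat_pow A 0 = mat 1"
| "mat_pow A (Suc n) = A ** mat_pow A n"

lemma mat_pow_add: "mat_pow A (m + n) = mat_pow A m ** mat_pow A n"
  by (induction m) (simp_all add: matrix_mul_assoc)

lemma mat_pow_mult: "mat_pow A (m * n) = mat_pow (mat_pow A m) n"
  by (induction n) (simp_all add: mat_pow_add)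

lemma cong_mat_mat_pow:
  assumes "cong_mat d N A (mat 1)"
  shows "cong_mat d N (mat_pow A n) (mat 1)"
proof (induction n)
  case (Suc n)
  have "cong_mat d N (A ** mat_pow A n) (mat 1 ** mat 1)"
    using assms Suc cong_mat_int_mat[OF assms] by (intro cong_mat_mult) auto
  then show ?case by simp
qed simp

text \<open>With \<open>A = 1 + B\<close> the powers are \<open>1 + m B\<close> up to products of
  two entries divisible by \<open>q\<close>.\<close>

lemma mat_pow_first_order:
  assumes "cong_mat d q A (mat 1)"
  shows "(mat_pow A m) $ i $ j - mat 1 $ i $ j - of_nat m * (A $ i $ j - mat 1 $ i $ j) \<in> quad_mult d (q * q)"
proof (induction m arbitrary: i j)
  case (Suc m)
  define B where "B = A - mat 1"
  have AB: "A = mat 1 + B" by (simp add: B_def)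
  have B: "B $ i $ j \<in> quad_mult d q" for i j
    using assms by (simp add: cong_mat_def B_def)
  define C where "C = mat_pow A m - mat 1"
  have mC: "mat_pow A m = mat 1 + C" by (simp add: C_def)
  have C: "C $ i $ j \<in> quad_mult d q" for i j
    using cong_mat_mat_pow[OF assms] by (simp add: cong_mat_def C_def)
  have "(mat_pow A (Suc m)) $ i $ j - mat 1 $ i $ j - of_nat (Suc m) * (A $ i $ j - mat 1 $ i $ j)
      = (mat_pow A m $ i $ j - mat 1 $ i $ j - of_nat m * (A $ i $ j - mat 1 $ i $ j)) + (B ** C) $ i $ j"
    by (simp add: mC) (simp add: AB matrix_add_distribs algebra_simps)
  moreover have "(B ** C) $ i $ j \<in> quad_mult d (q * q)"
    by (auto simp: matrix_matrix_mult_def intro!: quad_mult_sum quad_mult_mult B C)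
  ultimately show ?case using Suc[of i j] by (simp only: quad_mult_add)
qed simp

text \<open>\<open>(1 + B)^3 = 1 + 3 B + 3 B^2 + B^3\<close>. For the exponent 3 the linear term
  carries a factor 3 that must be cancelled later, so the error is needed modulo
  \<open>3 q^2\<close>; \<open>3 dvd q\<close> puts the cubic term there.\<close>

lemma mat_pow_cube:
  assumes "cong_mat d q A (mat 1)" "3 dvd q"
  shows "(mat_pow A 3) $ i $ j - mat 1 $ i $ j - 3 * (A $ i $ j - mat 1 $ i $ j) \<in> quad_mult d (3 * (q * q))"
proof -
  define B where "B = A - mat 1"
  have AB: "A = mat 1 + B" by (simp add: B_def)
  have B: "B $ i $ j \<in> quad_mult d q" for i j
    using assms by (simp add: cong_mat_def B_def)
  have B2: "(B ** B) $ i $ j \<in> quad_mult d (q * q)" for i j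
    by (auto simp: matrix_matrix_mult_def intro!: quad_mult_sum quad_mult_mult B)
  have "(B ** (B ** B)) $ i $ j \<in> quad_mult d (q * (q * q))"
    by (auto simp: matrix_matrix_mult_def[of B "B ** B"] intro!: quad_mult_sum quad_mult_mult B B2)
  then have B3: "(B ** (B ** B)) $ i $ j \<in> quad_mult d (3 * (q * q))"
    by (rule quad_mult_dvd[rotated]) (use assms(2) in auto)
  have "of_int 3 * (B ** B) $ i $ j \<in> quad_mult d (3 * (q * q))"
    by (intro quad_mult_mult B2 quad_mult_of_int) auto
  moreover have "(mat_pow A 3) $ i $ j - mat 1 $ i $ j - 3 * (A $ i $ j - mat 1 $ i $ j)
      = of_int 3 * (B ** B) $ i $ j + (B ** (B ** B)) $ i $ j"
  proof -
    have "mat_pow A 3 = A ** (A ** (A ** mat 1))" by (simp add: numeral_3_eq_3)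
    also have "\<dots> $ i $ j = mat 1 $ i $ j + B $ i $ j + (B $ i $ j + (B ** B) $ i $ j) +
        (B $ i $ j + (B ** B) $ i $ j + ((B ** B) $ i $ j + (B ** (B ** B)) $ i $ j))"
      by (simp only: AB matrix_add_distribs matrix_mul_lid matrix_mul_rid vector_add_component)
    finally show ?thesis by (simp add: AB algebra_simps)
  qed
  ultimately show ?thesis using B3 by (simp only: quad_mult_add)
qed

text \<open>Divisibility by \<open>q\<close> improves to divisibility by \<open>q * q\<close>, so
  every power of 3 divides the entries; a nonzero entry would have arbitrarily large
  modulus.\<close>

lemma quad_mult_bootstrap:
  assumes d: "d \<ge> 1"
    and step: "\<And>n q i j. q = 3 ^ Suc n \<Longrightarrow> (\<And>i j. B $ i $ j \<in> quad_mult d q) \<Longrightarrow> B $ i $ j \<in> quad_mult d (q * q)"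
    and B: "\<And>i j. B $ i $ j \<in> quad_mult d 3"
  shows "B = (0 :: complex^3^3)"
proof -
  have *: "\<forall>i j. B $ i $ j \<in> quad_mult d (3 ^ Suc n)" for n
  proof (induction n)
    case (Suc n)
    then have "B $ i $ j \<in> quad_mult d (3 ^ Suc n * 3 ^ Suc n)" for i j
      by (intro step[OF HOL.refl]) auto
    moreover have "(3::int) ^ Suc (Suc n) dvd 3 ^ Suc n * 3 ^ Suc n"
      by (simp add: dvd_def)
    ultimately show ?case using quad_mult_dvd by blast
  qed (use B in simp)
  have "B $ i $ j = 0" for i j
  proof (rule ccontr)
    assume "B $ i $ j \<noteq> 0"
    then have "cmod (B $ i $ j) \<ge> 3 ^ Suc n" for n
      using quad_mult_norm_ge[OF d, of "B $ i $ j" "3 ^ Suc n"] * by simp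
    moreover obtain n where "cmod (B $ i $ j) < 3 ^ n"
      using real_arch_pow[of 3] by auto
    moreover have "(3::real) ^ n \<le> 3 ^ Suc n" by simp
    ultimately show False by (meson not_less order_trans)
  qed
  then show ?thesis by (simp add: vec_eq_iff)
qed

text \<open>If 3 divides \<open>m\<close>, the cubic estimate shows that the power with exponent
  \<open>m / 3\<close> is already trivial and the exponent drops; otherwise \<open>m\<close> is
  invertible modulo every power of 3 and the first order term forces
  \<open>A = mat 1\<close>.\<close>

lemma minkowski:
  assumes d: "d \<ge> 1" and "cong_mat d 3 A (mat 1)" "mat_pow A m = mat 1" "m > 0"
  shows "A = mat 1"
  using assms(2-)
proof (induction m arbitrary: A rule: less_induct)
  case (less m)
  have ends: "X = mat 1" if "X - mat 1 = 0" for X :: "complex^3^3" using that by simp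
  show ?case
  proof (cases "3 dvd m")
    case True
    then obtain n where n: "m = n * 3" by (auto simp: dvd_def mult.commute)
    define E where "E = mat_pow A n"
    have E: "cong_mat d 3 E (mat 1)" "mat_pow E 3 = mat 1"
      using less.prems by (auto simp: E_def n mat_pow_mult cong_mat_mat_pow)
    have "E - mat 1 = 0"
    proof (rule quad_mult_bootstrap[OF d])
      fix k q i j assume q: "q = 3 ^ Suc k" "\<And>i j. (E - mat 1) $ i $ j \<in> quad_mult d q"
      then have "cong_mat d q E (mat 1)" "3 dvd q" by (simp_all add: cong_mat_def)
      \<comment> \<open>As the cube is 1, only the linear term remains; cancelling the 3 improves
        the divisibility from \<open>q\<close> to \<open>q * q\<close>.\<close>
      then have "- (3 * (E - mat 1) $ i $ j) \<in> quad_mult d (3 * (q * q))"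
        using mat_pow_cube[of d q E i j] E(2) by simp
      then have "3 * (E - mat 1) $ i $ j \<in> quad_mult d (3 * (q * q))"
        using quad_mult_minus by fastforce
      then obtain z where z: "3 * (E - mat 1) $ i $ j = of_int (3 * (q * q)) * z" "z \<in> quad_ints d"
        unfolding quad_mult_def by blast
      moreover have "3 * x = of_int (3 * n) * z \<Longrightarrow> x = of_int n * z" for x and n :: int by simp
      ultimately have "(E - mat 1) $ i $ j = of_int (q * q) * z" by blast
      with z(2) show "(E - mat 1) $ i $ j \<in> quad_mult d (q * q)"
        unfolding quad_mult_def by blast
    qed (use E in \<open>simp add: cong_mat_def\<close>)
    then have "mat_pow A n = mat 1" using ends E_def by blast
    with less.IH[of n A] less.prems n show ?thesis by auto
  next
    case False
    have "A - mat 1 = 0"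
    proof (rule quad_mult_bootstrap[OF d])
      fix k q i j assume q: "q = 3 ^ Suc k" "\<And>i j. (A - mat 1) $ i $ j \<in> quad_mult d q"
      then have "cong_mat d q A (mat 1)" by (simp add: cong_mat_def)
      then have "- (of_nat m * (A - mat 1) $ i $ j) \<in> quad_mult d (q * q)"
        using mat_pow_first_order[of d q A m i j] less.prems by simp
      then have m: "of_nat m * (A - mat 1) $ i $ j \<in> quad_mult d (q * q)"
        using quad_mult_minus by fastforce
      let ?x = "(A - mat 1) $ i $ j"
      have x: "?x \<in> quad_ints d" using q(2) quad_mult_quad_ints by blast
      have "coprime (3::int) (int m)"
        using False by (simp add: prime_imp_coprime int_dvd_int_iff[of 3 m, simplified])
      then have "coprime (int m) 3" by (simp add: coprime_commute)
      then have "coprime (int m) q" unfolding q(1) by (simp only: coprime_power_right_iff simp_thms)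
      then have "coprime (int m) (q * q)" by (simp only: coprime_mult_right_iff simp_thms)
      then obtain a b where ab: "a * int m + b * (q * q) = 1"
        by (metis bezout_int coprime_iff_gcd_eq_1)
      have "of_int (a * int m + b * (q * q)) * ?x = of_int a * (of_nat m * ?x) + of_int (b * (q * q)) * ?x"
        by (simp add: algebra_simps)
      moreover have "of_int a * (of_nat m * ?x) \<in> quad_mult d (q * q)"
        using m by (rule quad_mult_mult_left[OF quad_ints_of_int])
      moreover have "of_int (b * (q * q)) * ?x \<in> quad_mult d (q * q)"
        by (rule quad_mult_mult_right[OF quad_mult_of_int x]) simp
      ultimately show "?x \<in> quad_mult d (q * q)"
        by (metis ab quad_mult_add mult_1 of_int_1)
    qed (use less.prems in \<open>simp add: cong_mat_def\<close>)
    then show ?thesis by (rule ends)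
  qed
qed

section \<open>Presented groups\<close>

text \<open>Evaluation of a word by maps. The values on a letter and on its formal inverse are given
  separately, so no inverse function has to be formed.\<close>

definition act :: "('g \<Rightarrow> bool \<Rightarrow> 'p \<Rightarrow> 'p) \<Rightarrow> 'g word \<Rightarrow> 'p \<Rightarrow> 'p" where
  "act g w = foldr (\<lambda>(x, e) h. g x e \<circ> h) w id"

lemma act_simps [simp]: "act g [] = id" "act g ((x, e) # w) = g x e \<circ> act g w"
  by (simp_all add: act_def)

lemma act_append: "act g (u @ v) = act g u \<circ> act g v"
  by (induction u) (auto simp: comp_assoc)

lemma act_wpow: "act g (wpow w n) = act g w ^^ n"
  by (induction n) (auto simp: wpow_def act_append)

text \<open>Soundness in a concrete model: two words with different values are different in the
  presented group, without solving the word problem.\<close>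

lemma word_eq_act:
  assumes "word_eq X R u v" "\<And>x e. x \<in> X \<Longrightarrow> g x e \<circ> g x (\<not> e) = id"
    "\<And>u v. (u, v) \<in> R \<Longrightarrow> act g u = act g v"
  shows "act g u = act g v"
  using assms(1) by induction (use assms(2,3) in \<open>auto simp: act_append\<close>)

text \<open>The homomorphism from the free group to the integers with prescribed values on the
  generators; modulo \<open>n\<close> it detects elements in a finite cyclic quotient.\<close>

definition weight :: "('g \<Rightarrow> int) \<Rightarrow> 'g word \<Rightarrow> int" where
  "weight g w = (\<Sum>(x, e)\<leftarrow>w. if e then - g x else g x)"

lemma weight_simps [simp]: "weight g [] = 0"
  "weight g ((x, e) # w) = (if e then - g x else g x) + weight g w"
  by (simp_all add: weight_def)

lemma weight_append: "weight g (u @ v) = weight g u + weight g v"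
  by (simp add: weight_def)

lemma weight_wpow: "weight g (wpow w n) = int n * weight g w"
  by (induction n) (auto simp: wpow_def weight_append algebra_simps)

lemma word_eq_weight:
  assumes "word_eq X R u v" "\<And>u v. (u, v) \<in> R \<Longrightarrow> n dvd weight g u - weight g v"
  shows "n dvd weight g u - weight g v"
  using assms(1)
proof induction
  case (sym u v)
  then show ?case by (simp add: dvd_diff_commute)
next
  case (trans u v w)
  have "weight g u - weight g w = (weight g u - weight g v) + (weight g v - weight g w)" by simp
  with trans.IH show ?case by (simp only: dvd_add)
next
  case (append u u' v v')
  have "weight g (u @ v) - weight g (u' @ v') = (weight g u - weight g u') + (weight g v - weight g v')"
    by (simp add: weight_append)
  with append.IH show ?case by (simp only: dvd_add)
qed (use assms(2) in auto)

lemma winv_lists: "w \<in> lists (X \<times> UNIV) \<Longrightarrow> winv w \<in> lists (X \<times> UNIV)"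
  by (fastforce simp: winv_def in_lists_conv_set)

lemma wpow_lists: "w \<in> lists (X \<times> UNIV) \<Longrightarrow> wpow w n \<in> lists (X \<times> UNIV)"
  by (auto simp: wpow_def in_lists_conv_set)

lemma UN_UN_const:
  assumes "\<And>u v. u \<in> U \<Longrightarrow> v \<in> V \<Longrightarrow> f u v = K" "u \<in> U" "v \<in> V"
  shows "(\<Union>u\<in>U. \<Union>v\<in>V. f u v) = K"
  using assms by auto

section \<open>The group structure of a presented group\<close>

locale presentation =
  fixes X :: "'g set" and R :: "('g word \<times> 'g word) set"
  assumes R_lists: "(u, v) \<in> R \<Longrightarrow> u \<in> lists (X \<times> UNIV) \<and> v \<in> lists (X \<times> UNIV)"
begin

abbreviation "W \<equiv> lists (X \<times> (UNIV :: bool set))"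
abbreviation "P \<equiv> presented_group X R"

lemma word_eq_lists: "word_eq X R u v \<Longrightarrow> u \<in> W \<and> v \<in> W"
  by (induction rule: word_eq.induct) (use R_lists in auto)

lemma class_eq_iff: "u \<in> W \<Longrightarrow> v \<in> W \<Longrightarrow> word_class X R u = word_class X R v \<longleftrightarrow> word_eq X R u v"
proof
  assume "u \<in> W" "v \<in> W" "word_class X R u = word_class X R v"
  then have "v \<in> word_class X R u" by (simp add: word_class_def word_eq.refl)
  then show "word_eq X R u v" by (simp add: word_class_def)
next
  assume "word_eq X R u v"
  then show "word_class X R u = word_class X R v"
    unfolding word_class_def using word_eq.trans word_eq.sym by blast
qed

text \<open>The product is defined as a union over all pairs of representatives; it collapses
  because all of these pairs give the same class.\<close>

lemma mult_class:
  assumes "u \<in> W" "v \<in> W"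
  shows "word_class X R u \<otimes>\<^bsub>P\<^esub> word_class X R v = word_class X R (u @ v)"
proof -
  have "word_class X R (u' @ v') = word_class X R (u @ v)"
    if "u' \<in> word_class X R u" "v' \<in> word_class X R v" for u' v'
  proof -
    have "word_eq X R (u @ v) (u' @ v')"
      using that by (auto simp: word_class_def intro: word_eq.append)
    then show ?thesis using class_eq_iff word_eq_lists by metis
  qed
  moreover have "u \<in> word_class X R u" "v \<in> word_class X R v"
    using assms by (simp_all add: word_class_def word_eq.refl)
  ultimately have "(\<Union>u'\<in>word_class X R u. \<Union>v'\<in>word_class X R v. word_class X R (u' @ v')) = word_class X R (u @ v)"
    by (rule UN_UN_const)
  then show ?thesis by (simp add: presented_group_def)
qed

lemma winv_left: "w \<in> W \<Longrightarrow> word_eq X R (winv w @ w) []"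
proof (induction w)
  case Nil
  show ?case using word_eq.refl[of "[]" X R] by (simp add: winv_def)
next
  case (Cons a w)
  obtain x e where a: "a = (x, e)" "x \<in> X" using Cons.prems by auto
  have w: "w \<in> W" using Cons.prems by simp
  have "word_eq X R [(x, \<not> e), (x, \<not> \<not> e)] []" using a(2) by (rule word_eq.cancel)
  then have "word_eq X R [(x, \<not> e), (x, e)] []" by simp
  then have "word_eq X R ([(x, \<not> e), (x, e)] @ w) ([] @ w)"
    by (rule word_eq.append[OF _ word_eq.refl[OF w]])
  then have "word_eq X R (winv w @ ([(x, \<not> e), (x, e)] @ w)) (winv w @ ([] @ w))"
    by (rule word_eq.append[OF word_eq.refl[OF winv_lists[OF w]]])
  moreover have "word_eq X R (winv w @ ([] @ w)) []"
    using Cons by simp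
  ultimately have "word_eq X R (winv w @ ([(x, \<not> e), (x, e)] @ w)) []"
    by (rule word_eq.trans)
  then show ?case by (simp add: winv_def a)
qed

lemma carrier_P: "carrier P = word_class X R ` W"
  by (simp add: presented_group_def)

lemma one_P: "\<one>\<^bsub>P\<^esub> = word_class X R []"
  by (simp add: presented_group_def)

lemma group_P: "group P"
proof (rule groupI)
  fix x assume "x \<in> carrier P"
  then obtain w where w: "x = word_class X R w" "w \<in> W" by (auto simp: carrier_P)
  then have "word_class X R (winv w) \<otimes>\<^bsub>P\<^esub> x = \<one>\<^bsub>P\<^esub>"
    using class_eq_iff[THEN iffD2, OF _ _ winv_left[OF w(2)]] word_eq_lists[OF winv_left[OF w(2)]]
    by (simp add: mult_class winv_lists one_P)
  moreover have "word_class X R (winv w) \<in> carrier P" using w by (simp add: carrier_P winv_lists)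
  ultimately show "\<exists>y\<in>carrier P. y \<otimes>\<^bsub>P\<^esub> x = \<one>\<^bsub>P\<^esub>" by blast
next
  fix x y assume "x \<in> carrier P" "y \<in> carrier P"
  then obtain u v where *: "x = word_class X R u" "y = word_class X R v" "u \<in> W" "v \<in> W"
    by (auto simp: carrier_P)
  then have "u @ v \<in> W" by simp
  with * show "x \<otimes>\<^bsub>P\<^esub> y \<in> carrier P" using mult_class carrier_P by simp
next
  fix x y z assume "x \<in> carrier P" "y \<in> carrier P" "z \<in> carrier P"
  then obtain u v w where "x = word_class X R u" "y = word_class X R v" "z = word_class X R w" "u \<in> W" "v \<in> W" "w \<in> W"
    by (auto simp: carrier_P)
  moreover from this have "u @ v \<in> W" "v @ w \<in> W" by simp_all
  ultimately show "x \<otimes>\<^bsub>P\<^esub> y \<otimes>\<^bsub>P\<^esub> z = x \<otimes>\<^bsub>P\<^esub> (y \<otimes>\<^bsub>P\<^esub> z)" by (simp add: mult_class)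
next
  fix x assume "x \<in> carrier P"
  then obtain u where "x = word_class X R u" "u \<in> W" by (auto simp: carrier_P)
  then show "\<one>\<^bsub>P\<^esub> \<otimes>\<^bsub>P\<^esub> x = x" using mult_class[of "[]" u] by (simp add: one_P)
qed (auto simp: carrier_P one_P)

text \<open>Replaces an abstract isomorphism by maps attached to the letters. The last clause,
  faithfulness of the evaluation, transports nontriviality from the presented group to
  \<open>G\<close>.\<close>

lemma generators_of_iso:
  assumes G: "group G" and iso: "G \<cong> P"
    and mult: "\<And>x y. x \<in> carrier G \<Longrightarrow> y \<in> carrier G \<Longrightarrow> x \<otimes>\<^bsub>G\<^esub> y = x \<circ> y"
    and one: "\<one>\<^bsub>G\<^esub> = id"
  obtains g where "\<And>x e. x \<in> X \<Longrightarrow> g x e \<in> carrier G"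
    "\<And>x e. x \<in> X \<Longrightarrow> g x e \<circ> g x (\<not> e) = id"
    "\<And>u v. (u, v) \<in> R \<Longrightarrow> act g u = act g v"
    "carrier G = act g ` W"
    "\<And>u v. u \<in> W \<Longrightarrow> v \<in> W \<Longrightarrow> act g u = act g v \<Longrightarrow> word_eq X R u v"
proof -
  interpret G: group G by (rule G)
  interpret P: group P by (rule group_P)
  from G.iso_sym[OF iso] obtain f where f: "f \<in> iso P G" by (auto simp: is_iso_def)
  then have hom: "f \<in> hom P G" and bij: "bij_betw f (carrier P) (carrier G)"
    by (auto simp: iso_def)
  define F where "F w = f (word_class X R w)" for w
  define g where "g x e = F [(x, e)]" for x e
  have car: "word_class X R w \<in> carrier P" if "w \<in> W" for w using that by (simp add: carrier_P)
  have F_car: "F w \<in> carrier G" if "w \<in> W" for w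
    using hom_in_carrier[OF hom car[OF that]] by (simp add: F_def)
  have F_app: "F (u @ v) = F u \<circ> F v" if "u \<in> W" "v \<in> W" for u v
    using hom_mult[OF hom car[OF that(1)] car[OF that(2)]] mult_class[OF that] F_car that mult
    by (simp add: F_def)
  have F_Nil: "F [] = id"
    using hom_one[OF hom P.group_axioms G] one by (simp add: F_def one_P)
  have F_act: "F w = act g w" if "w \<in> W" for w
    using that
  proof (induction w)
    case (Cons a w)
    then have "F ([a] @ w) = F [a] \<circ> F w" by (intro F_app) auto
    with Cons show ?case by (cases a) (simp add: g_def)
  qed (simp add: F_Nil)
  have F_eq: "F u = F v \<longleftrightarrow> word_eq X R u v" if "u \<in> W" "v \<in> W" for u v
    using bij that class_eq_iff[OF that] car unfolding F_def bij_betw_def inj_on_def by metis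
  show thesis
  proof (rule that)
    show "g x e \<in> carrier G" if "x \<in> X" for x e
      using that by (simp add: g_def F_car)
    show "g x e \<circ> g x (\<not> e) = id" if "x \<in> X" for x e
    proof -
      have "F ([(x, e)] @ [(x, \<not> e)]) = F []"
        using word_eq.cancel[OF that, of R e] that by (subst F_eq) auto
      then show ?thesis using that by (subst (asm) F_app) (auto simp: g_def F_Nil)
    qed
    show "act g u = act g v" if "(u, v) \<in> R" for u v
      using R_lists[OF that] F_eq word_eq.relation[OF that] F_act by metis
    show "carrier G = act g ` W"
    proof -
      have "carrier G = f ` carrier P" using bij by (simp add: bij_betw_def)
      also have "\<dots> = F ` W" by (auto simp: carrier_P F_def)
      also have "\<dots> = act g ` W" using F_act by auto
      finally show ?thesis .
    qed
    show "word_eq X R u v" if "u \<in> W" "v \<in> W" "act g u = act g v" for u v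
      using that F_eq F_act by metis
  qed
qed

end

section \<open>Isometries of Nil\<close>

definition neg_if :: "bool \<Rightarrow> real \<Rightarrow> real" where
  "neg_if e t = (if e then - t else t)"

lemma nil_isometry_apply:
  "nil_isometry v u e (z, t) = (fst v + u * cnj_if e z, snd v + neg_if e t + 2 * Im (fst v * cnj (u * cnj_if e z)))"
  by (simp add: nil_isometry_def nil_mult_def cnj_if_def neg_if_def algebra_simps)

lemma Im_mult_unit:
  assumes "cmod u = 1"
  shows "Im (u * a * cnj (u * b)) = Im (a * cnj b)"
proof -
  have "u * a * cnj (u * b) = (u * cnj u) * (a * cnj b)" by (simp add: ac_simps)
  also have "u * cnj u = 1" using assms complex_norm_square[of u] by simp
  finally show ?thesis by (simp only: mult_1)
qed

lemma Im_cnj_if: "Im (cnj_if e a * cnj (cnj_if e b)) = neg_if e (Im (a * cnj b))"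
  by (simp add: cnj_if_def neg_if_def)

text \<open>Each isometry is a left translation after an automorphism, and the automorphism keeps or
  negates the cocycle \<open>Im (a * cnj b)\<close> according to the flag; hence the composite has
  the same shape.\<close>

lemma nil_isometry_comp:
  assumes "cmod u = 1"
  shows "nil_isometry v u e \<circ> nil_isometry w u' e' =
    nil_isometry (nil_isometry v u e w) (u * cnj_if e u') (e \<noteq> e')"
proof
  fix p :: nil_point
  obtain a s where v: "v = (a, s)" by (cases v)
  obtain b r where w: "w = (b, r)" by (cases w)
  obtain z t where p: "p = (z, t)" by (cases p)
  let ?y = "u' * cnj_if e' z"
  have 1: "cnj_if e (b + ?y) = cnj_if e b + cnj_if e ?y" "cnj_if e ?y = cnj_if e u' * cnj_if (e \<noteq> e') z"
    by (auto simp: cnj_if_def)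
  have 2: "Im (u * cnj_if e b * cnj (u * cnj_if e ?y)) = neg_if e (Im (b * cnj ?y))"
    using Im_mult_unit[OF assms] Im_cnj_if by metis
  have 3: "neg_if e (r + neg_if e' t + 2 * Im (b * cnj ?y)) = neg_if e r + neg_if (e \<noteq> e') t + 2 * neg_if e (Im (b * cnj ?y))"
    by (auto simp: neg_if_def)
  have "(nil_isometry v u e \<circ> nil_isometry w u' e') p =
     (a + u * (cnj_if e b + cnj_if e ?y), s + neg_if e (r + neg_if e' t + 2 * Im (b * cnj ?y)) + 2 * Im (a * cnj (u * (cnj_if e b + cnj_if e ?y))))"
    by (simp add: v w p nil_isometry_apply 1(1))
  also have "\<dots> = (a + u * cnj_if e b + u * cnj_if e ?y, s + neg_if e r + 2 * Im (a * cnj (u * cnj_if e b)) + neg_if (e \<noteq> e') t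
      + 2 * Im ((a + u * cnj_if e b) * cnj (u * cnj_if e ?y)))"
    unfolding 3 2[symmetric] by (simp add: algebra_simps)
  also have "\<dots> = nil_isometry (nil_isometry v u e w) (u * cnj_if e u') (e \<noteq> e') p"
    unfolding 1(2) by (simp add: v w p nil_isometry_apply mult.assoc)
  finally show "(nil_isometry v u e \<circ> nil_isometry w u' e') p = \<dots>" .
qed

lemma nil_isometry_id: "nil_isometry 0 1 False = id"
  by (auto simp: nil_isometry_apply cnj_if_def neg_if_def fun_eq_iff)

lemma nil_isometry_inj:
  assumes "nil_isometry v u e = nil_isometry v' u' e'"
  shows "v = v'" "u = u'" "e = e'"
proof -
  have *: "nil_isometry v u e (z, t) = nil_isometry v' u' e' (z, t)" for z t using assms by simp
  show v: "v = v'" using *[of 0 0] by (cases e; cases e') (simp_all add: nil_isometry_apply neg_if_def prod_eq_iff)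
  show e: "e = e'" using *[of 0 1] v by (cases e; cases e') (simp_all add: nil_isometry_apply neg_if_def)
  show "u = u'" using *[of 1 0] v e by (simp add: nil_isometry_apply)
qed

text \<open>The translation part of the inverse is the inverse automorphism applied to the group
  inverse of \<open>v\<close>, which in these coordinates is plain negation.\<close>

lemma nil_isometry_inverse:
  fixes v :: nil_point and u :: complex and e :: bool
  assumes u: "cmod u = 1"
  defines "u' \<equiv> cnj_if e (cnj u)"
  defines "w \<equiv> nil_isometry 0 u' e (- fst v, - snd v)"
  shows "nil_isometry v u e \<circ> nil_isometry w u' e = id" "cmod u' = 1"
    "nil_isometry w u' e \<circ> nil_isometry v u e = id"
proof -
  have uu: "u * cnj u = 1" "cnj u * u = 1" "cmod (cnj u) = 1"
    using u complex_norm_square[of u] by (simp_all add: mult.commute)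
  have u'1: "u * cnj_if e u' = 1" "cmod u' = 1" using uu by (auto simp: cnj_if_def u'_def)
  have uy: "u * (cnj u * y) = y" for y using uu by (simp flip: mult.assoc)
  have uy': "cnj u * (u * y) = y" for y using uu by (simp flip: mult.assoc)
  have "nil_isometry v u e w = 0"
    using uy uy' by (cases v; cases e) (simp_all add: w_def u'_def nil_isometry_apply cnj_if_def neg_if_def zero_prod_def algebra_simps)
  then show "nil_isometry v u e \<circ> nil_isometry w u' e = id"
    by (simp add: nil_isometry_comp u u'1 nil_isometry_id)
  have "nil_isometry w u' e v = 0" "u' * cnj_if e u = 1"
    using uy uy' uu by (cases v; cases e; simp add: w_def u'_def nil_isometry_apply cnj_if_def neg_if_def zero_prod_def algebra_simps)+
  then show "nil_isometry w u' e \<circ> nil_isometry v u e = id"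
    by (simp add: nil_isometry_comp u u'1 nil_isometry_id)
  show "cmod u' = 1" by (rule u'1)
qed

definition nil_isoms :: "(nil_point \<Rightarrow> nil_point) set" where
  "nil_isoms = {nil_isometry v u e | v u e. cmod u = 1}"

lemma nil_isomE:
  assumes "g \<in> nil_isoms"
  obtains h where "h \<in> nil_isoms" "g \<circ> h = id" "h \<circ> g = id"
  using assms nil_isometry_inverse unfolding nil_isoms_def by blast

lemma nil_isom_bij: "g \<in> nil_isoms \<Longrightarrow> bij g"
  by (metis nil_isomE o_bij)

lemma nil_isoms_comp: "g \<in> nil_isoms \<Longrightarrow> h \<in> nil_isoms \<Longrightarrow> g \<circ> h \<in> nil_isoms"
proof -
  assume "g \<in> nil_isoms" "h \<in> nil_isoms"
  then obtain v u e v' u' e' where *: "g = nil_isometry v u e" "h = nil_isometry v' u' e'" "cmod u = 1" "cmod u' = 1"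
    by (auto simp: nil_isoms_def)
  then have "g \<circ> h = nil_isometry (nil_isometry v u e v') (u * cnj_if e u') (e \<noteq> e')"
    by (simp add: nil_isometry_comp)
  moreover have "cmod (u * cnj_if e u') = 1" using * by (simp add: norm_mult cnj_if_def)
  ultimately show ?thesis unfolding nil_isoms_def by blast
qed

lemma carrier_isom_nil: "carrier isom_nil = nil_isoms"
  by (simp add: isom_nil_def nil_isoms_def)

lemma mult_isom_nil: "g \<in> nil_isoms \<Longrightarrow> h \<in> nil_isoms \<Longrightarrow> g \<otimes>\<^bsub>isom_nil\<^esub> h = g \<circ> h"
  by (auto simp: isom_nil_def BijGroup_def Bij_def nil_isom_bij compose_def)

lemma one_isom_nil: "\<one>\<^bsub>isom_nil\<^esub> = id"
  by (auto simp: isom_nil_def BijGroup_def)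

lemma group_isom_nil: "group isom_nil"
proof (rule groupI)
  fix x assume "x \<in> carrier isom_nil"
  then obtain h where "h \<in> nil_isoms" "h \<circ> x = id" "x \<in> nil_isoms"
    using nil_isomE carrier_isom_nil by metis
  then show "\<exists>y\<in>carrier isom_nil. y \<otimes>\<^bsub>isom_nil\<^esub> x = \<one>\<^bsub>isom_nil\<^esub>"
    by (intro bexI[of _ h]) (simp_all add: mult_isom_nil one_isom_nil carrier_isom_nil)
next
  have "nil_isometry 0 1 False \<in> nil_isoms" unfolding nil_isoms_def using norm_one by blast
  then have id: "id \<in> nil_isoms" by (simp add: nil_isometry_id)
  then show "\<one>\<^bsub>isom_nil\<^esub> \<in> carrier isom_nil" by (simp add: carrier_isom_nil one_isom_nil)
  show "\<one>\<^bsub>isom_nil\<^esub> \<otimes>\<^bsub>isom_nil\<^esub> x = x" if "x \<in> carrier isom_nil" for x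
    using that id by (simp add: one_isom_nil mult_isom_nil carrier_isom_nil)
qed (simp_all add: carrier_isom_nil mult_isom_nil nil_isoms_comp comp_assoc)

lemma subgroup_isom_nil:
  assumes "subgroup \<Delta> isom_nil"
  shows "\<Delta> \<subseteq> nil_isoms" "id \<in> \<Delta>" "g \<in> \<Delta> \<Longrightarrow> h \<in> \<Delta> \<Longrightarrow> g \<circ> h \<in> \<Delta>"
    "g \<in> \<Delta> \<Longrightarrow> \<exists>h\<in>\<Delta>. g \<circ> h = id \<and> h \<circ> g = id"
proof -
  interpret group isom_nil by (rule group_isom_nil)
  interpret D: subgroup \<Delta> isom_nil by (rule assms)
  show s: "\<Delta> \<subseteq> nil_isoms" using D.subset by (simp add: carrier_isom_nil)
  show "id \<in> \<Delta>" using D.one_closed by (simp add: one_isom_nil)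
  show c: "g \<circ> h \<in> \<Delta>" if "g \<in> \<Delta>" "h \<in> \<Delta>" for g h
    using D.m_closed[OF that] mult_isom_nil[OF subsetD[OF s that(1)] subsetD[OF s that(2)]] by simp
  show "\<exists>h\<in>\<Delta>. g \<circ> h = id \<and> h \<circ> g = id" if "g \<in> \<Delta>"
  proof -
    have h: "inv\<^bsub>isom_nil\<^esub> g \<in> \<Delta>" using that by (rule D.m_inv_closed)
    have gc: "g \<in> carrier isom_nil" using s that by (auto simp: carrier_isom_nil)
    have n: "g \<in> nil_isoms" "inv\<^bsub>isom_nil\<^esub> g \<in> nil_isoms" using h s that by auto
    have "g \<circ> inv\<^bsub>isom_nil\<^esub> g = id" "inv\<^bsub>isom_nil\<^esub> g \<circ> g = id"
      using r_inv[OF gc] l_inv[OF gc] mult_isom_nil[OF n] mult_isom_nil[OF n(2,1)] by (simp_all add: one_isom_nil)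
    with h show ?thesis by blast
  qed
qed

lemma continuous_nil_isometry: "continuous_on UNIV (nil_isometry v u e)"
proof -
  have "nil_isometry v u e = (\<lambda>p. (fst v + u * (if e then cnj (fst p) else fst p),
      snd v + (if e then - snd p else snd p) + 2 * Im (fst v * cnj (u * (if e then cnj (fst p) else fst p)))))"
    by (auto simp: nil_isometry_apply cnj_if_def neg_if_def)
  then show ?thesis
    by (cases e) (auto intro!: continuous_intros)
qed

text \<open>A continuous invariant function factors through the compact orbit space.\<close>

lemma invariant_bounded:
  assumes D: "nil_manifold_group \<Delta>" and f: "continuous_on UNIV f"
    and inv: "\<And>g p. g \<in> \<Delta> \<Longrightarrow> f (g p) = (f p :: real)"
  obtains M where "\<And>p. \<bar>f p\<bar> \<le> M"
proof -
  let ?G = "isom_nil\<lparr>carrier := \<Delta>\<rparr>"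
  obtain T where T: "quotient_map euclidean T (orbit_of ?G)" "compact_space T"
    using D by (auto simp: nil_manifold_group_def)
  have sub: "subgroup \<Delta> isom_nil" using D by (simp add: nil_manifold_group_def)
  \<comment> \<open>An arbitrary point of the orbit is chosen; invariance of \<open>f\<close> makes
    the value independent of it.\<close>
  define F where "F Q = f (SOME p. p \<in> Q)" for Q
  have F: "F (orbit_of ?G p) = f p" for p
  proof -
    have "id p \<in> orbit_of ?G p" using subgroup_isom_nil(2)[OF sub] by (auto simp: orbit_def intro!: exI[of _ id])
    then have "(SOME q. q \<in> orbit_of ?G p) \<in> orbit_of ?G p" by (rule someI)
    then show ?thesis by (auto simp: F_def orbit_def inv)
  qed
  have "continuous_map euclidean euclidean (F \<circ> orbit_of ?G)"
    using f by (simp add: F comp_def)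
  then have "continuous_map T euclidean F"
    using continuous_compose_quotient_map_eq[OF T(1)] by blast
  then have "compactin euclidean (F ` topspace T)"
    using T(2) image_compactin unfolding compact_space_def by blast
  then have "bounded (F ` topspace T)" by (simp add: compact_imp_bounded)
  then obtain M where M: "\<And>y. y \<in> F ` topspace T \<Longrightarrow> \<bar>y\<bar> \<le> M" by (auto simp: bounded_iff)
  have "orbit_of ?G p \<in> topspace T" for p
    using quotient_imp_surjective_map[OF T(1)] by auto
  then show thesis using that M F by (metis imageI)
qed

section \<open>The stabilizer of the point at infinity\<close>

text \<open>The matrix of the Heisenberg translation by \<open>v\<close> times the rotation diag(1,
  u, 1). Its last column is a null vector over the point \<open>v\<close>; the form then dictates
  the first row.\<close>

definition cusp_mat :: "nil_point \<Rightarrow> complex \<Rightarrow> complex^3^3" where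
  "cusp_mat v u = vector [vector [1, - cnj (fst v) * u, (- of_real ((cmod (fst v))\<^sup>2) + \<i> * of_real (snd v)) / 2],
     vector [0, u, fst v], vector [0, 0, 1]]"

lemma cusp_mat_entries [simp]:
  "cusp_mat v u $ 1 $ 1 = 1" "cusp_mat v u $ 1 $ 2 = - cnj (fst v) * u"
  "cusp_mat v u $ 1 $ 3 = (- of_real ((cmod (fst v))\<^sup>2) + \<i> * of_real (snd v)) / 2"
  "cusp_mat v u $ 2 $ 1 = 0" "cusp_mat v u $ 2 $ 2 = u" "cusp_mat v u $ 2 $ 3 = fst v"
  "cusp_mat v u $ 3 $ 1 = 0" "cusp_mat v u $ 3 $ 2 = 0" "cusp_mat v u $ 3 $ 3 = 1"
  by (simp_all add: cusp_mat_def vector_3)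

lemma matrix_mult_3: "(A ** B) $ i $ j = A $ i $ 1 * B $ 1 $ j + A $ i $ 2 * B $ 2 $ j + A $ i $ 3 * B $ 3 $ j"
  for A B :: "complex^3^3"
  by (simp add: matrix_matrix_mult_def sum_3)

lemma matrix_eq_3: "A = B \<longleftrightarrow> (\<forall>i j. A $ i $ j = B $ i $ j)" for A B :: "complex^3^3"
  by (simp add: vec_eq_iff)

lemma cnj_mat_entry [simp]: "cnj_mat e A $ i $ j = cnj_if e (A $ i $ j)"
  by (simp add: cnj_mat_def)

lemma herm_adj_entry [simp]: "herm_adj A $ i $ j = cnj (A $ swap13 j $ swap13 i)"
  by (simp add: herm_adj_def)

text \<open>Matrices multiply as Nil isometries compose. The decisive entry is (1, 3): its real part
  is the expansion of |a + u b|^2, its imaginary part the Heisenberg cocycle.\<close>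

lemma cusp_mat_mult:
  assumes "cmod u = 1"
  shows "cusp_mat v u ** cnj_mat e (cusp_mat w u') = cusp_mat (nil_isometry v u e w) (u * cnj_if e u')"
proof -
  obtain a s where v: "v = (a, s)" by (cases v)
  obtain b r where w: "w = (b, r)" by (cases w)
  have uu: "u * cnj u = 1" using assms complex_norm_square[of u] by simp
  have uy: "u * (cnj u * y) = y" "cnj u * (u * y) = y" for y using uu by (simp_all flip: mult.assoc add: mult.commute)
  have nrm: "(cmod (a + u * b'))\<^sup>2 = (cmod a)\<^sup>2 + (cmod b')\<^sup>2 + 2 * Re (a * cnj (u * b'))" for b'
  proof -
    have "(cmod (a + u * b'))\<^sup>2 = (cmod a)\<^sup>2 + (cmod (u * b'))\<^sup>2 + 2 * Re (a * cnj (u * b'))"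
      unfolding cmod_power2 by (simp add: power2_eq_square algebra_simps)
    then show ?thesis by (simp add: norm_mult assms)
  qed
  have 12: "(cusp_mat v u ** cnj_mat e (cusp_mat w u')) $ 1 $ 2 = cusp_mat (nil_isometry v u e w) (u * cnj_if e u') $ 1 $ 2"
    by (simp add: matrix_mult_3 v w nil_isometry_apply algebra_simps uy)
  \<comment> \<open>\<open>p\<close> and \<open>q\<close> are the two parts of one product: the
    squared norm sees \<open>p\<close>, the height sees \<open>q\<close>.\<close>
  define p where "p = Re (a * cnj (u * cnj_if e b))"
  define q where "q = Im (a * cnj (u * cnj_if e b))"
  have pq: "- cnj a * u * cnj_if e b = - of_real p + \<i> * of_real q"
    by (simp add: p_def q_def complex_eq_iff algebra_simps)
  have "(cusp_mat v u ** cnj_mat e (cusp_mat w u')) $ 1 $ 3 = (- of_real ((cmod b)\<^sup>2) + \<i> * of_real (neg_if e r)) / 2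
      + (- cnj a * u * cnj_if e b) + (- of_real ((cmod a)\<^sup>2) + \<i> * of_real s) / 2"
    by (cases e) (simp_all add: matrix_mult_3 v w neg_if_def)
  moreover have "cusp_mat (nil_isometry v u e w) (u * cnj_if e u') $ 1 $ 3 =
      (- of_real ((cmod a)\<^sup>2 + (cmod b)\<^sup>2 + 2 * p) + \<i> * of_real (s + neg_if e r + 2 * q)) / 2"
    using nrm[of "cnj_if e b"]
    by (simp only: v w nil_isometry_apply cusp_mat_entries fst_conv snd_conv p_def q_def cnj_if_simps)
  ultimately have 13: "(cusp_mat v u ** cnj_mat e (cusp_mat w u')) $ 1 $ 3 = cusp_mat (nil_isometry v u e w) (u * cnj_if e u') $ 1 $ 3"
    unfolding pq by (simp add: complex_eq_iff field_simps)
  show ?thesis unfolding matrix_eq_3 forall_3 using 12 13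
    by (simp add: matrix_mult_3 v w nil_isometry_apply)
qed

lemma cusp_mat_id: "cusp_mat 0 1 = mat 1"
  unfolding matrix_eq_3 forall_3 by (simp add: mat_def)

lemma cusp_mat_right_inverse:
  assumes "cmod u = 1"
  shows "cusp_mat v u ** cnj_mat e (cusp_mat (nil_isometry 0 (cnj_if e (cnj u)) e (- fst v, - snd v)) (cnj_if e (cnj u))) = mat 1"
proof -
  let ?u = "cnj_if e (cnj u)" and ?w = "nil_isometry 0 (cnj_if e (cnj u)) e (- fst v, - snd v)"
  have "nil_isometry v u e \<circ> nil_isometry ?w ?u e = nil_isometry 0 1 False"
    using nil_isometry_inverse(1)[OF assms] by (simp add: nil_isometry_id)
  then have "nil_isometry v u e ?w = 0" "u * cnj_if e ?u = 1"
    unfolding nil_isometry_comp[OF assms] using nil_isometry_inj by blast+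
  then show ?thesis by (simp only: cusp_mat_mult[OF assms] cusp_mat_id)
qed

lemma cusp_mat_U21:
  assumes "cmod u = 1"
  shows "cusp_mat v u \<in> U21"
proof -
  have "u * cnj u = 1" using assms complex_norm_square[of u] by simp
  moreover have "(complex_of_real (cmod (fst v)))\<^sup>2 = fst v * cnj (fst v)" using complex_norm_square[of "fst v"] by simp
  ultimately show ?thesis
    unfolding U21_iff matrix_eq_3 forall_3
    by (simp add: matrix_mult_3 mat_def mult.commute add_divide_distrib[symmetric])
       (simp add: field_simps)
qed

lemma matrix_inverse_unique: "herm_adj A ** A = mat 1 \<Longrightarrow> A ** B = mat 1 \<Longrightarrow> B = herm_adj A"
  by (metis matrix_mul_assoc matrix_mul_lid matrix_mul_rid)

lemma cusp_mat_herm_adj: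
  assumes "cmod u = 1"
  shows "cnj_mat e (herm_adj (cusp_mat v u)) = cusp_mat (nil_isometry 0 (cnj_if e (cnj u)) e (- fst v, - snd v)) (cnj_if e (cnj u))"
proof -
  have "cnj_mat e (cusp_mat (nil_isometry 0 (cnj_if e (cnj u)) e (- fst v, - snd v)) (cnj_if e (cnj u))) = herm_adj (cusp_mat v u)"
    using matrix_inverse_unique[OF _ cusp_mat_right_inverse[OF assms]] cusp_mat_U21[OF assms] U21_iff by blast
  then have "cnj_mat e (cnj_mat e (cusp_mat (nil_isometry 0 (cnj_if e (cnj u)) e (- fst v, - snd v)) (cnj_if e (cnj u)))) = cnj_mat e (herm_adj (cusp_mat v u))"
    by (rule arg_cong)
  then show ?thesis by (simp only: cnj_mat_cnj_mat) simp
qed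

lemma cong_mat_cnj_mat: "cong_mat d N A B \<Longrightarrow> cong_mat d N (cnj_mat e A) (cnj_mat e B)"
proof -
  assume *: "cong_mat d N A B"
  have "cnj_if e (A $ i $ j - B $ i $ j) \<in> quad_mult d N" for i j
    using * quad_mult_cnj by (simp add: cong_mat_def cnj_if_def del: complex_cnj_diff)
  then show ?thesis by (simp add: cong_mat_def)
qed

lemma cong_mat_herm_adj: "cong_mat d N A B \<Longrightarrow> cong_mat d N (herm_adj A) (herm_adj B)"
  unfolding cong_mat_def herm_adj_entry complex_cnj_diff[symmetric] using quad_mult_cnj by blast

lemma int_mat_cnj_mat: "int_mat d A \<Longrightarrow> int_mat d (cnj_mat e A)"
  by (auto simp: int_mat_def cnj_if_def)

lemma int_mat_herm_adj: "int_mat d A \<Longrightarrow> int_mat d (herm_adj A)"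
  by (auto simp: int_mat_def)

lemma mat_pow_in_U21: "A \<in> U21 \<Longrightarrow> mat_pow A n \<in> U21"
  by (induction n) (simp_all add: U21_mult)

lemma pow_proj_map:
  assumes "A \<in> U21"
  shows "proj_map A False [^]\<^bsub>isom_H2C\<^esub> n = proj_map (mat_pow A n) False"
proof (induction n)
  case (Suc n)
  interpret group isom_H2C by (rule group_isom_H2C)
  have "proj_map A False \<in> carrier isom_H2C" using assms unfolding carrier_isom_H2C by blast
  then show ?case using Suc assms
    by (simp only: nat_pow_Suc2 mult_isom_H2C mat_pow_in_U21) simp
qed (simp add: one_isom_H2C)

lemma U21_left_entry:
  assumes "A \<in> U21"
  shows "cnj (A $ 3 $ swap13 i) * A $ 1 $ j + cnj (A $ 2 $ swap13 i) * A $ 2 $ j + cnj (A $ 1 $ swap13 i) * A $ 3 $ j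
    = (if i = j then 1 else 0)"
proof -
  have "(herm_adj A ** A) $ i $ j = mat 1 $ i $ j" using assms by (simp add: U21_iff)
  then show ?thesis by (simp only: matrix_mult_3 herm_adj_entry swap13_simps) (simp add: mat_def)
qed

section \<open>The point at infinity and its stabilizer\<close>

definition pt_inf :: "(complex^3) set" where
  "pt_inf = cline (axis 1 1)"

lemma pt_inf_ideal: "pt_inf \<in> ideal_boundary"
proof -
  have "axis 1 1 \<noteq> (0 :: complex^3)" by (simp add: axis_eq_0_iff)
  moreover have "herm (axis 1 1) (axis 1 1) = 0" by (simp add: herm_eq axis_def)
  ultimately show ?thesis unfolding ideal_boundary_def pt_inf_def by blast
qed

lemma matrix_axis_1: "A *v axis 1 1 = (\<chi> i. A $ i $ 1)" for A :: "complex^3^3"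
  by (simp add: matrix_vector_mult_def axis_def vec_eq_iff sum_3)

lemma proj_map_pt_inf:
  assumes "A \<in> U21"
  shows "proj_map A e pt_inf = pt_inf \<longleftrightarrow> A $ 2 $ 1 = 0 \<and> A $ 3 $ 1 = 0"
proof -
  have ax: "axis 1 1 \<noteq> (0 :: complex^3)" "cnj_vec e (axis 1 1) = axis 1 1"
    by (auto simp: axis_def vec_eq_iff cnj_vec_def)
  then have 1: "proj_map A e pt_inf = cline (\<chi> i. A $ i $ 1)"
    unfolding pt_inf_def by (simp add: proj_map_cline matrix_axis_1)
  have nz: "(\<chi> i. A $ i $ 1) \<noteq> 0" using U21_mult_eq_0[OF assms, of "axis 1 1"] ax by (simp add: matrix_axis_1)
  show ?thesis
  proof
    assume "proj_map A e pt_inf = pt_inf"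
    then have "cline (axis 1 1) = cline (\<chi> i. A $ i $ 1)" using 1 unfolding pt_inf_def by simp
    then obtain c where "(\<chi> i. A $ i $ 1) = c *s axis 1 1" using nz by (rule cline_eqE)
    then show "A $ 2 $ 1 = 0 \<and> A $ 3 $ 1 = 0" by (simp add: vec_eq_iff axis_def forall_3)
  next
    assume *: "A $ 2 $ 1 = 0 \<and> A $ 3 $ 1 = 0"
    then have eq: "(\<chi> i. A $ i $ 1) = A $ 1 $ 1 *s axis 1 1"
      by (simp add: vec_eq_iff axis_def forall_3)
    with nz have "A $ 1 $ 1 \<noteq> 0" by auto
    then show "proj_map A e pt_inf = pt_inf" unfolding 1 eq by (simp add: cline_scale pt_inf_def)
  qed
qed

text \<open>Unitarity gives the diagonal entries modulus 1, and the congruence leaves only the value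
  1. The remaining relations express the first row through the last column, which is the shape of a
  Heisenberg translation.\<close>

lemma upper_triangular_congruent_1:
  assumes d: "d \<ge> 1" and N: "N \<ge> 3" and B: "B \<in> U21" "cong_mat d N B (mat 1)" "B $ 2 $ 1 = 0" "B $ 3 $ 1 = 0"
  obtains v where "B = cusp_mat v 1"
proof -
  note L = U21_left_entry[OF B(1)]
  have int: "B $ i $ j \<in> quad_ints d" for i j
    using cong_mat_int_mat[OF B(2) int_mat_mat_1] by (simp add: int_mat_def)
  have c: "B $ i $ i - 1 \<in> quad_mult d N" for i
  proof -
    have "B $ i $ i - mat 1 $ i $ i \<in> quad_mult d N" using B(2) by (simp only: cong_mat_def)
    then show ?thesis by (simp add: mat_def)
  qed
  have 11: "cnj (B $ 3 $ 3) * B $ 1 $ 1 = 1" using L[of 1 1] B(3,4) by simp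
  then have nz: "B $ 1 $ 1 \<noteq> 0" "B $ 3 $ 3 \<noteq> 0" by auto
  have "cmod (B $ 3 $ 3) * cmod (B $ 1 $ 1) = 1" using 11 by (metis norm_mult norm_one complex_mod_cnj)
  moreover have ge: "cmod (B $ 3 $ 3) \<ge> 1" "cmod (B $ 1 $ 1) \<ge> 1"
    using quad_ints_norm_ge_1[OF d int] nz by auto
  ultimately have "cmod (B $ 1 $ 1) = 1"
    \<comment> \<open>Two moduli that are at least 1 and have product 1 are both 1.\<close>
    using mult_right_mono[of 1 "cmod (B $ 3 $ 3)" "cmod (B $ 1 $ 1)"] by linarith
  then have b11: "B $ 1 $ 1 = 1" using unit_cong_1[OF d _ c N] by blast
  with 11 have b33: "B $ 3 $ 3 = 1" by simp
  have b32: "B $ 3 $ 2 = 0" using L[of 2 1] B(3,4) b11 by simp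
  have "cnj (B $ 2 $ 2) * B $ 2 $ 2 = 1" using L[of 2 2] b32 by simp
  then have "(cmod (B $ 2 $ 2))\<^sup>2 = 1"
    by (metis complex_mod_cnj norm_mult norm_one power2_eq_square)
  then have "cmod (B $ 2 $ 2) = 1" using norm_ge_zero[of "B $ 2 $ 2"] by (auto simp: power2_eq_1_iff)
  then have b22: "B $ 2 $ 2 = 1" using unit_cong_1[OF d _ c N] by blast
  have b12: "B $ 1 $ 2 = - cnj (B $ 2 $ 3)" using L[of 1 2] b33 b22 b32 by (simp add: eq_neg_iff_add_eq_0)
  have "B $ 1 $ 3 + cnj (B $ 2 $ 3) * B $ 2 $ 3 + cnj (B $ 1 $ 3) = 0" using L[of 1 3] b33 by simp
  then have "Re (B $ 1 $ 3 + cnj (B $ 2 $ 3) * B $ 2 $ 3 + cnj (B $ 1 $ 3)) = 0" by simp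
  then have "Re (B $ 1 $ 3) = - (cmod (B $ 2 $ 3))\<^sup>2 / 2"
    unfolding cmod_power2 by (simp add: power2_eq_square)
  then have b13: "B $ 1 $ 3 = (- of_real ((cmod (B $ 2 $ 3))\<^sup>2) + \<i> * of_real (2 * Im (B $ 1 $ 3))) / 2"
    by (simp add: complex_eq_iff Re_divide_numeral Im_divide_numeral)
  have "B = cusp_mat (B $ 2 $ 3, 2 * Im (B $ 1 $ 3)) 1"
    unfolding matrix_eq_3 forall_3 cusp_mat_entries fst_conv snd_conv b13[symmetric]
    using b11 b12 b22 b33 b32 B(3,4) by simp
  then show thesis by (rule that)
qed

section \<open>Congruence groups with prescribed cusp stabilizer\<close>

text \<open>\<open>D\<close> consists of the parameters of the isometries in the prescribed stabilizer. The last assumption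
  excludes torsion: an element of the congruence group whose square is trivial agrees modulo \<open>N\<close>
  with an element of \<open>D\<close> whose square is trivial modulo \<open>N\<close>.\<close>

locale cusp_data =
  fixes d :: nat and N :: int and D :: "(nil_point \<times> complex \<times> bool) set"
  assumes d: "d \<ge> 1" and N: "N > 0" "3 dvd N"
    and D_unit: "(v, u, e) \<in> D \<Longrightarrow> u = 1 \<or> u = - 1"
    and D_id: "(0, 1, False) \<in> D"
    and D_mult: "(v, u, e) \<in> D \<Longrightarrow> (v', u', e') \<in> D \<Longrightarrow> (nil_isometry v u e v', u * u', e \<noteq> e') \<in> D"
    and D_inv: "(v, u, e) \<in> D \<Longrightarrow> (nil_isometry 0 u e (- fst v, - snd v), u, e) \<in> D"
    and D_int: "(v, u, e) \<in> D \<Longrightarrow> int_mat d (cusp_mat v u)"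
    and D_cong: "(v, u, e) \<in> D \<Longrightarrow> cong_mat d 3 (cusp_mat v u) (cusp_mat 0 u)"
    and D_translation: "cong_mat d N (cusp_mat v 1) (mat 1) \<Longrightarrow> (v, 1, False) \<in> D"
    and D_square: "(v, u, e) \<in> D \<Longrightarrow> cong_mat d N (cusp_mat (nil_isometry v u e v) 1) (mat 1) \<Longrightarrow> u = 1 \<and> \<not> e"
begin

lemma N3: "N \<ge> 3"
  using N by (auto dest: zdvd_imp_le)

lemma D_unit': "(v, u, e) \<in> D \<Longrightarrow> cmod u = 1 \<and> u * u = 1 \<and> cnj u = u \<and> cnj_if f u = u \<and> cnj_if f (cnj u) = u"
  using D_unit[of v u e] by (auto simp: cnj_if_def)

text \<open>Equivalently, the product of the prescribed stabilizer with the principal congruence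
  subgroup of level \<open>N\<close> over Z[sqrt(-d)].\<close>

definition cong_group :: "((complex^3) set \<Rightarrow> (complex^3) set) set" where
  "cong_group = {proj_map A e | A e v u. A \<in> U21 \<and> (v, u, e) \<in> D \<and> cong_mat d N A (cusp_mat v u)}"

lemma GamI: "A \<in> U21 \<Longrightarrow> (v, u, e) \<in> D \<Longrightarrow> cong_mat d N A (cusp_mat v u) \<Longrightarrow> proj_map A e \<in> cong_group"
  unfolding cong_group_def by blast

lemma GamE:
  assumes "g \<in> cong_group"
  obtains A e v u where "g = proj_map A e" "A \<in> U21" "(v, u, e) \<in> D" "cong_mat d N A (cusp_mat v u)" "int_mat d A"
  using assms cong_mat_int_mat D_int unfolding cong_group_def by blast

lemma twisted_product:
  assumes "(v, u, e) \<in> D" "cong_mat d N A (cusp_mat v u)"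
    and "(v', u', e') \<in> D" "cong_mat d N A' (cusp_mat v' u')"
  shows "cong_mat d N (A ** cnj_mat e A') (cusp_mat (nil_isometry v u e v') (u * u'))"
proof -
  have "cong_mat d N (A ** cnj_mat e A') (cusp_mat v u ** cnj_mat e (cusp_mat v' u'))"
    using assms D_int cong_mat_int_mat by (intro cong_mat_mult cong_mat_cnj_mat int_mat_cnj_mat) blast+
  then show ?thesis using D_unit'[OF assms(1)] D_unit'[OF assms(3)] by (simp add: cusp_mat_mult)
qed

lemma cong_group_subset: "cong_group \<subseteq> carrier isom_H2C"
  unfolding cong_group_def carrier_isom_H2C by blast

lemma subgroup_cong_group: "subgroup cong_group isom_H2C"
proof (rule group.subgroupI[OF group_isom_H2C cong_group_subset])
  have "proj_map (mat 1) False \<in> cong_group"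
    by (rule GamI[OF _ D_id]) (simp_all add: cusp_mat_id)
  then show "cong_group \<noteq> {}" by auto
next
  fix g assume "g \<in> cong_group"
  then obtain A e v u where g: "g = proj_map A e" "A \<in> U21" "(v, u, e) \<in> D" "cong_mat d N A (cusp_mat v u)"
    by (rule GamE)
  have "cong_mat d N (cnj_mat e (herm_adj A)) (cnj_mat e (herm_adj (cusp_mat v u)))"
    using g by (intro cong_mat_cnj_mat cong_mat_herm_adj)
  then have "cong_mat d N (cnj_mat e (herm_adj A)) (cusp_mat (nil_isometry 0 u e (- fst v, - snd v)) u)"
    using D_unit'[OF g(3)] cusp_mat_herm_adj[of u e v] by simp
  then have "proj_map (cnj_mat e (herm_adj A)) e \<in> cong_group"
    using g D_inv[OF g(3)] by (intro GamI U21_cnj_mat U21_herm_adj)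
  then show "inv\<^bsub>isom_H2C\<^esub> g \<in> cong_group" by (simp only: g inv_isom_H2C)
next
  fix g h assume "g \<in> cong_group" "h \<in> cong_group"
  obtain A e v u where g: "g = proj_map A e" "A \<in> U21" "(v, u, e) \<in> D" "cong_mat d N A (cusp_mat v u)"
    using \<open>g \<in> cong_group\<close> by (rule GamE)
  obtain B f w x where h: "h = proj_map B f" "B \<in> U21" "(w, x, f) \<in> D" "cong_mat d N B (cusp_mat w x)"
    using \<open>h \<in> cong_group\<close> by (rule GamE)
  have "proj_map (A ** cnj_mat e B) (e \<noteq> f) \<in> cong_group"
    using g h by (intro GamI[OF _ D_mult[OF g(3) h(3)]] twisted_product U21_mult U21_cnj_mat)
  then show "g \<otimes>\<^bsub>isom_H2C\<^esub> h \<in> cong_group" by (simp only: g h mult_isom_H2C)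
qed

lemma torsion_free_cong_group: "torsion_free (isom_H2C\<lparr>carrier := cong_group\<rparr>)"
  unfolding torsion_free_def
proof (intro ballI allI impI)
  interpret group isom_H2C by (rule group_isom_H2C)
  fix g and n :: nat
  assume "g \<in> carrier (isom_H2C\<lparr>carrier := cong_group\<rparr>)" "n > 0"
    and pow: "g [^]\<^bsub>isom_H2C\<lparr>carrier := cong_group\<rparr>\<^esub> n = \<one>\<^bsub>isom_H2C\<lparr>carrier := cong_group\<rparr>\<^esub>"
  then have "g \<in> cong_group" by simp
  then obtain A e v u where g: "g = proj_map A e" "A \<in> U21" "(v, u, e) \<in> D" "cong_mat d N A (cusp_mat v u)" "int_mat d A"
    by (rule GamE)
  have gc: "g \<in> carrier isom_H2C" using \<open>g \<in> cong_group\<close> cong_group_subset by blast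
  have gn: "g [^]\<^bsub>isom_H2C\<^esub> n = \<one>\<^bsub>isom_H2C\<^esub>" using pow by (simp flip: nat_pow_consistent)
  \<comment> \<open>The square of \<open>g\<close> is holomorphic whatever the flag, and this is its
    matrix.\<close>
  define B where "B = A ** cnj_mat e A"
  have BU: "B \<in> U21" using g by (simp add: B_def U21_mult U21_cnj_mat)
  have gg: "g \<otimes>\<^bsub>isom_H2C\<^esub> g = proj_map B False" using g by (simp add: mult_isom_H2C B_def)
  have uu: "u * u = 1" using D_unit'[OF g(3)] by simp
  \<comment> \<open>Modulo 3 the matrix is diag(1, u, 1) with \<open>u\<close> equal to 1 or -1, so
    its twisted square is trivial there.\<close>
  have A3: "cong_mat d 3 A (cusp_mat 0 u)"
    using cong_mat_trans[OF cong_mat_dvd[OF N(2) g(4)] D_cong[OF g(3)]] .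
  have i0: "int_mat d (cusp_mat 0 u)" using D_unit[OF g(3)] by (auto simp: int_mat_def forall_3 cusp_mat_def vector_3 intro: quad_ints_minus)
  have B3: "cong_mat d 3 B (mat 1)"
  proof -
    have "cong_mat d 3 B (cusp_mat 0 u ** cnj_mat e (cusp_mat 0 u))"
      unfolding B_def using A3 g i0 by (intro cong_mat_mult cong_mat_cnj_mat int_mat_cnj_mat)
    moreover have "cusp_mat 0 u ** cnj_mat e (cusp_mat 0 u) = mat 1"
      unfolding matrix_eq_3 forall_3 matrix_mult_3 using D_unit[OF g(3)] by (auto simp: mat_def)
    ultimately show ?thesis by simp
  qed
  have "proj_map (mat_pow B n) False = \<one>\<^bsub>isom_H2C\<^esub>"
    unfolding pow_proj_map[OF BU, symmetric] gg[symmetric]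
    using nat_pow_mult[OF gc, of n n] nat_pow_pow[OF gc, of 2 n] nat_pow_pow[OF gc, of n 2] gn gc
    by (simp add: numeral_2_eq_2 pow_mult_distrib)
  then have "proj_map (mat_pow B n) False = proj_map (mat 1) False" by (simp add: one_isom_H2C)
  \<comment> \<open>Triviality in the projective group only gives a scalar matrix; the scalar has
    modulus 1 and is congruent to 1 modulo 3, so it is 1.\<close>
  then obtain c where c: "cmod c = 1" "\<And>i j. mat_pow B n $ i $ j = c * mat 1 $ i $ j" "False = False"
    using proj_map_eq_imp[OF mat_pow_in_U21[OF BU] U21_mat_1] by metis
  have "mat_pow B n $ 1 $ 1 - (mat 1 :: complex^3^3) $ 1 $ 1 \<in> quad_mult d 3"
    using cong_mat_mat_pow[OF B3, of n] by (simp add: cong_mat_def)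
  then have "c - 1 \<in> quad_mult d 3" by (simp add: c(2)) (simp add: mat_def)
  then have "c = 1" using unit_cong_1[OF d c(1)] by simp
  then have "mat_pow B n = mat 1" using c(2) by (simp add: vec_eq_iff)
  then have B1: "B = mat 1" using minkowski[OF d B3] \<open>n > 0\<close> by blast
  \<comment> \<open>The trivial square agrees modulo \<open>N\<close> with the square of an element
    of \<open>D\<close>, so \<open>D_square\<close> leaves only the case of a translation.\<close>
  have "cong_mat d N B (cusp_mat (nil_isometry v u e v) (u * u))"
    unfolding B_def by (rule twisted_product[OF g(3,4,3,4)])
  then have "cong_mat d N (cusp_mat (nil_isometry v u e v) 1) (mat 1)"
    unfolding B1 uu by (rule cong_mat_sym)
  then have ue: "u = 1" "\<not> e" using D_square[OF g(3)] by auto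
  \<comment> \<open>Now \<open>A\<close> itself is congruent to 1 modulo 3, and Minkowski's lemma
    applies to it with exponent 2.\<close>
  have "cong_mat d 3 A (mat 1)" using A3 by (simp add: ue cusp_mat_id)
  moreover have "mat_pow A 2 = mat 1" using B1 ue by (simp add: B_def numeral_2_eq_2)
  ultimately have "A = mat 1" using minkowski[OF d] by fastforce
  then show "g = \<one>\<^bsub>isom_H2C\<lparr>carrier := cong_group\<rparr>\<^esub>"
    using g(1) ue by (simp add: one_isom_H2C)
qed

text \<open>The integral representative differs from \<open>A\<close> by a scalar of modulus 1. With
  radius 1/4 its off-diagonal entries have modulus below 1/4 and its diagonal entries differ by less
  than 1/2; both lie below the least nonzero modulus 1, so the matrix is scalar.\<close>

lemma discrete_cong_group: "discrete_in_isom_H2C cong_group"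
  unfolding discrete_in_isom_H2C_def
proof (intro exI[of _ "1/4"] conjI ballI impI)
  fix A assume A: "A \<in> U21" "dist A (mat 1) < 1 / 4 \<and> proj A \<in> cong_group"
  then obtain B e v u where B: "proj A = proj_map B e" "B \<in> U21" "int_mat d B" by (blast elim: GamE)
  then obtain c where c: "cmod c = 1" "\<And>i j. A $ i $ j = c * B $ i $ j" "False = e"
    using proj_map_eq_imp[OF A(1) B(2)] by (metis proj_eq_proj_map)
  have close: "cmod (A $ i $ j - mat 1 $ i $ j) < 1 / 4" for i j
  proof -
    have "dist (A $ i $ j) (mat 1 $ i $ j) \<le> dist A (mat 1)"
      by (rule order_trans[OF dist_vec_nth_le dist_vec_nth_le])
    then show ?thesis using A(2) by (simp add: dist_norm)
  qed
  have off: "B $ i $ j = 0" if "i \<noteq> j" for i j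
  proof (rule ccontr)
    assume "B $ i $ j \<noteq> 0"
    then have "cmod (B $ i $ j) \<ge> 1" using quad_ints_norm_ge_1[OF d] B(3) by (simp add: int_mat_def)
    moreover have "cmod (B $ i $ j) < 1 / 4" using close[of i j] that c by (simp add: mat_def norm_mult)
    ultimately show False by simp
  qed
  have diag: "B $ i $ i = B $ j $ j" for i j
  proof (rule ccontr)
    assume "B $ i $ i \<noteq> B $ j $ j"
    moreover have "B $ i $ i - B $ j $ j \<in> quad_ints d" using B(3) by (simp add: int_mat_def quad_ints_diff)
    ultimately have "cmod (B $ i $ i - B $ j $ j) \<ge> 1" using quad_ints_norm_ge_1[OF d] by simp
    moreover have "cmod (B $ i $ i - B $ j $ j) = cmod (c * B $ i $ i - c * B $ j $ j)"
      using c(1) by (simp add: norm_mult flip: right_diff_distrib)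
    moreover have "cmod (c * B $ i $ i - 1) < 1/4" "cmod (c * B $ j $ j - 1) < 1/4"
      using close[of i i] close[of j j] c(2) by (simp_all add: mat_def)
    moreover have "cmod (c * B $ i $ i - c * B $ j $ j) \<le> cmod (c * B $ i $ i - 1) + cmod (c * B $ j $ j - 1)"
      using norm_triangle_ineq4[of "c * B $ i $ i - 1" "c * B $ j $ j - 1"] by simp
    ultimately show False by linarith
  qed
  have A_eq: "A $ i $ j = A $ 1 $ 1 * mat 1 $ i $ j" for i j
    using off[of i j] diag[of j 1] c(2) by (auto simp: mat_def)
  have "A $ 1 $ 1 \<noteq> 0" using close[of 1 1] by (auto simp: mat_def)
  then have "proj_map A False = proj_map (mat 1) False" by (rule proj_map_scale[OF _ A_eq U21_mat_1])
  then show "proj A = \<one>\<^bsub>isom_H2C\<^esub>" by (simp add: proj_eq_proj_map one_isom_H2C)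
qed simp

text \<open>Dividing an element that fixes infinity by the element of \<open>D\<close> congruent to
  it leaves a triangular matrix congruent to 1, which is a translation already contained in
  \<open>D\<close>.\<close>

lemma stabilizer_cong_group:
  "{g \<in> cong_group. g pt_inf = pt_inf} = {proj_map (cusp_mat v u) e | v u e. (v, u, e) \<in> D}"
proof (rule equalityI; rule subsetI)
  fix g assume "g \<in> {g \<in> cong_group. g pt_inf = pt_inf}"
  then have "g \<in> cong_group" and qfix: "g pt_inf = pt_inf" by auto
  obtain A e v u where g: "g = proj_map A e" "A \<in> U21" "(v, u, e) \<in> D" "cong_mat d N A (cusp_mat v u)" "int_mat d A"
    using \<open>g \<in> cong_group\<close> by (rule GamE)
  have u: "cmod u = 1" "cnj u = u" using D_unit'[OF g(3)] by auto
  let ?M = "cusp_mat v u"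
  have MU: "?M \<in> U21" by (rule cusp_mat_U21[OF u(1)])
  have aM: "herm_adj ?M = cusp_mat (nil_isometry 0 u False (- fst v, - snd v)) u"
    using cusp_mat_herm_adj[OF u(1), of False v] u by simp
  define B where "B = A ** herm_adj ?M"
  have BU: "B \<in> U21" using g MU by (simp add: B_def U21_mult U21_herm_adj)
  have "cong_mat d N B (?M ** herm_adj ?M)"
    unfolding B_def using g D_int by (intro cong_mat_mult int_mat_herm_adj) auto
  then have B1: "cong_mat d N B (mat 1)" by (simp add: U21_right_inv MU)
  have z: "A $ 2 $ 1 = 0" "A $ 3 $ 1 = 0" using qfix g by (auto simp: proj_map_pt_inf)
  have B0: "B $ 2 $ 1 = 0" "B $ 3 $ 1 = 0" unfolding B_def aM matrix_mult_3 using z by simp_all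
  obtain w where w: "B = cusp_mat w 1" using upper_triangular_congruent_1[OF d N3 BU B1 B0] .
  then have "(w, 1, False) \<in> D" using D_translation B1 by blast
  then have "(nil_isometry w 1 False v, 1 * u, False \<noteq> e) \<in> D" by (rule D_mult[OF _ g(3)])
  then have D: "(nil_isometry w 1 False v, u, e) \<in> D" by simp
  have "A = B ** ?M" using MU by (simp add: B_def U21_iff flip: matrix_mul_assoc)
  then have "A = cusp_mat (nil_isometry w 1 False v) u" using cusp_mat_mult[of 1 w False v u] w by simp
  then show "g \<in> {proj_map (cusp_mat v u) e | v u e. (v, u, e) \<in> D}" unfolding g(1) using D by blast
next
  fix g assume "g \<in> {proj_map (cusp_mat v u) e | v u e. (v, u, e) \<in> D}"
  then obtain v u e where g: "g = proj_map (cusp_mat v u) e" "(v, u, e) \<in> D" by auto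
  then have U: "cusp_mat v u \<in> U21" using D_unit' cusp_mat_U21 by blast
  then have "g \<in> cong_group" unfolding g(1) by (rule GamI[OF _ g(2) cong_mat_refl])
  moreover have "g pt_inf = pt_inf" unfolding g(1) proj_map_pt_inf[OF U] by simp
  ultimately show "g \<in> {g \<in> cong_group. g pt_inf = pt_inf}" by simp
qed

text \<open>The vertical translation by \<open>2 N sqrt d\<close> belongs to \<open>D\<close>,
  because its only nonzero off-diagonal entry is \<open>N i sqrt d\<close>. It fixes exactly the
  lines with vanishing last coordinate; these are never negative, and null only at infinity.\<close>

lemma cusp_point_cong_group: "cusp_point cong_group pt_inf"
proof -
  define s where "s = 2 * of_int N * sqrt (real d)"
  have s: "s \<noteq> 0" using d N by (simp add: s_def)
  let ?M = "cusp_mat (0, s) 1"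
  have MU: "?M \<in> U21" by (simp add: cusp_mat_U21)
  have "\<i> * complex_of_real s / 2 \<in> quad_mult d N"
    unfolding quad_mult_iff by (rule exI[of _ 0], rule exI[of _ 1]) (simp add: s_def)
  then have "cong_mat d N ?M (mat 1)"
    by (simp add: cong_mat_def forall_3 mat_def)
  then have "((0, s), 1, False) \<in> D" by (rule D_translation)
  then have G: "proj_map ?M False \<in> cong_group" by (intro GamI[OF MU]) auto
  have act: "proj_map ?M False (cline X) = cline X \<longleftrightarrow> X $ 3 = 0" if X: "X \<noteq> 0" for X
  proof -
    have M: "?M *v X = (\<chi> i. if i = 1 then X $ 1 + \<i> * of_real s / 2 * X $ 3 else X $ i)"
      by (simp add: vec_eq_iff forall_3 matrix_vector_mult_def sum_3)
    show ?thesis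
    proof
      assume "proj_map ?M False (cline X) = cline X"
      then have "cline X = cline (?M *v X)" using X by (simp add: proj_map_cline)
      then obtain c where "?M *v X = c *s X" using U21_mult_eq_0[OF MU] X by (metis cline_eqE)
      then have "\<forall>i. (?M *v X) $ i = c * X $ i" by simp
      then have "X $ 1 + \<i> * of_real s / 2 * X $ 3 = c * X $ 1" "X $ 3 = c * X $ 3" "X $ 2 = c * X $ 2"
        unfolding M forall_3 by simp_all
      then show "X $ 3 = 0" using s by auto
    next
      assume "X $ 3 = 0"
      then have "?M *v X = X" unfolding M by (simp add: vec_eq_iff)
      then show "proj_map ?M False (cline X) = cline X" using X by (simp add: proj_map_cline)
    qed
  qed
  have qfix: "proj_map ?M False pt_inf = pt_inf" by (simp add: proj_map_pt_inf[OF MU])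
  have "q = pt_inf" if q: "q \<in> ideal_boundary" "proj_map ?M False q = q" for q
  proof -
    obtain X where X: "q = cline X" "X \<noteq> 0" "herm X X = 0"
      using q(1) by (auto simp: ideal_boundary_def)
    then have 3: "X $ 3 = 0" using act q(2) by simp
    then have 2: "X $ 2 = 0" using X(3) by (simp add: herm_eq)
    have eq: "X = X $ 1 *s axis 1 1" using 2 3 by (simp add: vec_eq_iff forall_3 axis_def)
    then have "X $ 1 \<noteq> 0" using X(2) by auto
    then show ?thesis using cline_scale[of "X $ 1" "axis 1 1"] eq X(1) by (simp add: pt_inf_def)
  qed
  moreover have "proj_map ?M False L \<noteq> L" if h: "L \<in> H2C" for L
  proof
    assume L: "proj_map ?M False L = L"
    obtain X where X: "L = cline X" "Re (herm X X) < 0" using h by (auto simp: H2C_def)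
    then have "X \<noteq> 0" by (auto simp: herm_eq)
    then have "X $ 3 = 0" using act L X by simp
    then have "Re (herm X X) = (Re (X $ 2))\<^sup>2 + (Im (X $ 2))\<^sup>2" by (simp add: herm_eq power2_eq_square)
    then show False using X(2) by (simp add: not_sum_power2_lt_zero)
  qed
  ultimately have "parabolic (proj_map ?M False)"
    unfolding parabolic_def using pt_inf_ideal qfix G cong_group_subset by blast
  then show ?thesis unfolding cusp_point_def using pt_inf_ideal qfix G by blast
qed

end

section \<open>Horospheres at infinity\<close>

text \<open>Horospherical coordinates: \<open>p\<close> is the Nil coordinate and \<open>u\<close>
  the height, normalised so that the form takes the value \<open>- u\<close>.\<close>

definition horo_vec :: "real \<Rightarrow> nil_point \<Rightarrow> complex^3" where
  "horo_vec u p = vector [(- of_real ((cmod (fst p))\<^sup>2 + u) + \<i> * of_real (snd p)) / 2, fst p, 1]"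

definition horo_pt :: "real \<Rightarrow> nil_point \<Rightarrow> (complex^3) set" where
  "horo_pt u p = cline (horo_vec u p)"

lemma horo_vec_entries [simp]:
  "horo_vec u p $ 1 = (- of_real ((cmod (fst p))\<^sup>2 + u) + \<i> * of_real (snd p)) / 2"
  "horo_vec u p $ 2 = fst p" "horo_vec u p $ 3 = 1"
  by (simp_all add: horo_vec_def vector_3)

lemma horo_vec_nz [simp]: "horo_vec u p \<noteq> 0"
  by (metis horo_vec_entries(3) zero_index zero_neq_one)

lemma herm_horo_vec: "herm (horo_vec u p) (horo_vec u p) = - of_real u"
proof -
  have "fst p * cnj (fst p) = of_real ((cmod (fst p))\<^sup>2)" by (rule complex_norm_square[symmetric])
  then show ?thesis by (simp add: herm_eq field_simps)
qed

text \<open>A negative vector has nonzero last coordinate. After scaling this to 1, the real part of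
  the first coordinate is determined by the second and by the value of the form.\<close>

lemma H2C_eq_horo_pt: "H2C = {horo_pt u p | u p. u > 0}"
proof (rule equalityI; rule subsetI)
  fix L assume "L \<in> H2C"
  then obtain X where X: "L = cline X" "Re (herm X X) < 0" by (auto simp: H2C_def)
  have 3: "X $ 3 \<noteq> 0"
  proof
    assume "X $ 3 = 0"
    then have "Re (herm X X) = (Re (X $ 2))\<^sup>2 + (Im (X $ 2))\<^sup>2" by (simp add: herm_eq power2_eq_square)
    then show False using X(2) by (simp add: not_sum_power2_lt_zero)
  qed
  define Y where "Y = inverse (X $ 3) *s X"
  have Y: "L = cline Y" unfolding Y_def X(1) using 3 by (simp add: cline_scale)
  have Y3: "Y $ 3 = 1" using 3 by (simp add: Y_def)
  have XY: "X = X $ 3 *s Y" using 3 by (simp add: Y_def vector_smult_assoc)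
  have "herm (c *s Y) (c *s Y) = of_real ((cmod c)\<^sup>2) * herm Y Y" for c
    using complex_norm_square[of c] by (simp add: herm_eq algebra_simps)
  then have "herm (X $ 3 *s Y) (X $ 3 *s Y) = of_real ((cmod (X $ 3))\<^sup>2) * herm Y Y" .
  then have "herm X X = of_real ((cmod (X $ 3))\<^sup>2) * herm Y Y"
    unfolding XY[symmetric] .
  then have "(cmod (X $ 3))\<^sup>2 * Re (herm Y Y) < 0" using X(2) by simp
  then have neg: "Re (herm Y Y) < 0" by (simp add: mult_less_0_iff)
  define u where "u = - Re (herm Y Y)"
  have "Re (herm Y Y) = 2 * Re (Y $ 1) + (cmod (Y $ 2))\<^sup>2"
    unfolding cmod_power2 by (simp add: herm_eq Y3 power2_eq_square)
  then have "Re (Y $ 1) = - ((cmod (Y $ 2))\<^sup>2 + u) / 2" by (simp add: u_def)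
  then have Y_eq: "Y = horo_vec u (Y $ 2, 2 * Im (Y $ 1))"
    by (simp add: vec_eq_iff forall_3 Y3 complex_eq_iff Re_divide_numeral Im_divide_numeral)
  have "L = horo_pt u (Y $ 2, 2 * Im (Y $ 1))" unfolding horo_pt_def Y_eq[symmetric] by (rule Y)
  moreover have "u > 0" using neg by (simp add: u_def)
  ultimately show "L \<in> {horo_pt u p | u p. u > 0}" by blast
next
  fix L assume "L \<in> {horo_pt u p | u p. u > 0}"
  then obtain u p where "L = cline (horo_vec u p)" "u > 0" by (auto simp: horo_pt_def)
  moreover from this have "Re (herm (horo_vec u p) (horo_vec u p)) < 0" by (simp add: herm_horo_vec)
  ultimately show "L \<in> H2C" unfolding H2C_def by blast
qed

lemma horo_pt_inj: "horo_pt u p = horo_pt v q \<longleftrightarrow> u = v \<and> p = q"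
proof
  assume "horo_pt u p = horo_pt v q"
  then obtain c where c: "horo_vec v q = c *s horo_vec u p" unfolding horo_pt_def using horo_vec_nz by (rule cline_eqE)
  then have "horo_vec v q $ 3 = (c *s horo_vec u p) $ 3" by simp
  then have "c = 1" by simp
  then have *: "horo_vec v q = horo_vec u p" using c by simp
  then have "horo_vec v q $ 2 = horo_vec u p $ 2" "horo_vec v q $ 1 = horo_vec u p $ 1" by simp_all
  then have "fst q = fst p" "horo_vec v q $ 1 = horo_vec u p $ 1" by simp_all
  then show "u = v \<and> p = q" by (simp add: prod_eq_iff complex_eq_iff[of "_ / _"] Re_divide_numeral Im_divide_numeral)
qed simp

lemma affine_chart_horo_pt: "affine_chart (horo_pt u p) = (horo_vec u p $ 1, fst p)"
  unfolding affine_chart_def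
proof (rule the_equality)
  have "vector [horo_vec u p $ 1, fst p, 1] = horo_vec u p" by (simp add: vec_eq_iff forall_3 vector_3)
  then show "vector [fst (horo_vec u p $ 1, fst p), snd (horo_vec u p $ 1, fst p), 1] \<in> horo_pt u p"
    unfolding horo_pt_def by (simp add: vec.span_base)
next
  fix r assume "vector [fst r, snd r, 1] \<in> horo_pt u p"
  then obtain c where c: "vector [fst r, snd r, 1] = c *s horo_vec u p" by (auto simp: horo_pt_def cline_eq)
  have *: "(vector [fst r, snd r, 1] :: complex^3) $ i = (c *s horo_vec u p) $ i" for i by (simp only: c)
  have "c = 1" using *[of 3] by (simp add: vector_3)
  then show "r = (horo_vec u p $ 1, fst p)" using *[of 1] *[of 2] by (simp add: vector_3 prod_eq_iff)
qed

text \<open>The standard vector of height \<open>r\<close> over any point is the Heisenberg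
  translate of the one over the origin, which is real and so fixed by conjugation; the action is
  thus the multiplication law of \<open>cusp_mat\<close>.\<close>

lemma proj_map_horo_pt:
  assumes "cmod u = 1"
  shows "proj_map (cusp_mat v u) e (horo_pt r p) = horo_pt r (nil_isometry v u e p)"
proof -
  let ?o = "vector [- of_real r / 2, 0, 1] :: complex^3"
  have o: "horo_vec r q = cusp_mat q w *v ?o" for q w
    by (simp add: vec_eq_iff forall_3 matrix_vector_mult_def sum_3 vector_3 add_divide_distrib diff_divide_distrib)
  have co: "cnj_vec e ?o = ?o" by (simp add: vec_eq_iff forall_3 cnj_vec_def vector_3 cnj_if_def)
  have "cusp_mat v u *v cnj_vec e (horo_vec r p) = (cusp_mat v u ** cnj_mat e (cusp_mat p 1)) *v ?o"
    unfolding o[of p 1] cnj_vec_mult co by (simp add: matrix_vector_mul_assoc)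
  also have "\<dots> = horo_vec r (nil_isometry v u e p)"
    unfolding cusp_mat_mult[OF assms] o[symmetric] ..
  finally show ?thesis unfolding horo_pt_def by (simp add: proj_map_cline)
qed

text \<open>The quotient does not depend on the representatives and \<open>cosh\<close> is injective
  on nonnegative reals, so a single pair of vectors determines the distance.\<close>

lemma hdist_eqI:
  assumes "r \<ge> 0" "X \<noteq> 0" "Y \<noteq> 0"
    and r: "(cosh (r / 2))\<^sup>2 = (cmod (herm X Y))\<^sup>2 / (Re (herm X X) * Re (herm Y Y))"
  shows "hdist (cline X) (cline Y) = r"
  unfolding hdist_def
proof (rule the_equality)
  have scale: "(cmod (herm (a *s X) (b *s Y)))\<^sup>2 / (Re (herm (a *s X) (a *s X)) * Re (herm (b *s Y) (b *s Y)))
      = (cmod (herm X Y))\<^sup>2 / (Re (herm X X) * Re (herm Y Y))" if "a \<noteq> 0" "b \<noteq> 0" for a b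
  proof -
    have 1: "herm (c *s Z) (d *s W) = c * cnj d * herm Z W" for c d Z W
      by (simp add: herm_eq algebra_simps)
    have 2: "Re (herm (c *s Z) (c *s Z)) = (cmod c)\<^sup>2 * Re (herm Z Z)" for c Z
      unfolding 1 complex_norm_square[symmetric] by simp
    show ?thesis unfolding 2 1[of a X b Y] using that by (simp add: norm_mult power_mult_distrib)
  qed
  show "r \<ge> 0 \<and> (\<forall>X\<in>cline X - {0}. \<forall>Y\<in>cline Y - {0}.
      (cosh (r / 2))\<^sup>2 = (cmod (herm X Y))\<^sup>2 / (Re (herm X X) * Re (herm Y Y)))"
  proof (intro conjI ballI)
    fix V W assume "V \<in> cline X - {0}" "W \<in> cline Y - {0}"
    then obtain a b where "V = a *s X" "W = b *s Y" "a \<noteq> 0" "b \<noteq> 0" by (auto simp: cline_eq)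
    then show "(cosh (r / 2))\<^sup>2 = (cmod (herm V W))\<^sup>2 / (Re (herm V V) * Re (herm W W))"
      using scale r by simp
  qed (rule assms)
next
  fix s assume s: "s \<ge> 0 \<and> (\<forall>X\<in>cline X - {0}. \<forall>Y\<in>cline Y - {0}.
      (cosh (s / 2))\<^sup>2 = (cmod (herm X Y))\<^sup>2 / (Re (herm X X) * Re (herm Y Y)))"
  have "X \<in> cline X - {0}" "Y \<in> cline Y - {0}" using assms by (auto intro: vec.span_base)
  then have "(cosh (s / 2))\<^sup>2 = (cosh (r / 2))\<^sup>2" using s r by simp
  then have "cosh (s / 2) = cosh (r / 2)" by (simp add: power2_eq_iff_nonneg)
  then show "s = r" using cosh_real_strict_mono[of "s/2" "r/2"] cosh_real_strict_mono[of "r/2" "s/2"] s assms(1)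
    by (cases "s = r") (force simp: neq_iff)+
qed

lemma herm_horo_vec_ray:
  "(cmod (herm (horo_vec u p) (horo_vec v 0)))\<^sup>2 = (((cmod (fst p))\<^sup>2 + u + v)\<^sup>2 + (snd p)\<^sup>2) / 4"
proof -
  have "herm (horo_vec u p) (horo_vec v 0) = (- of_real ((cmod (fst p))\<^sup>2 + u + v) + \<i> * of_real (snd p)) / 2"
    by (simp add: herm_eq add_divide_distrib diff_divide_distrib)
  then have "(cmod (herm (horo_vec u p) (horo_vec v 0)))\<^sup>2 =
      (cmod ((- of_real ((cmod (fst p))\<^sup>2 + u + v) + \<i> * of_real (snd p)) / 2))\<^sup>2"
    by (rule arg_cong)
  also have "\<dots> = (cmod (- of_real ((cmod (fst p))\<^sup>2 + u + v) + \<i> * of_real (snd p)))\<^sup>2 / 4"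
    by (simp only: norm_divide power_divide) simp
  also have "(cmod (- of_real r + \<i> * of_real s))\<^sup>2 = r\<^sup>2 + s\<^sup>2" for r s
    unfolding cmod_power2 by simp
  finally show ?thesis .
qed

text \<open>\<open>y\<close> is the \<open>cosh\<close> of the distance, obtained from
  \<open>cosh\<close> of its half by the doubling formula; \<open>y \<ge> 1\<close> comes from
  \<open>(u + v)^2 \<ge> 4 u v\<close>.\<close>

lemma hdist_horo_pt_ray:
  fixes p :: nil_point
  assumes "u > 0" "v > 0"
  defines "y \<equiv> (((cmod (fst p))\<^sup>2 + u + v)\<^sup>2 + (snd p)\<^sup>2) / (2 * u * v) - 1"
  shows "y \<ge> 1" "hdist (horo_pt u p) (horo_pt v 0) = arcosh y"
proof -
  have "(u + v)\<^sup>2 \<le> ((cmod (fst p))\<^sup>2 + u + v)\<^sup>2" using assms by (intro power_mono) auto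
  moreover have "4 * u * v \<le> (u + v)\<^sup>2" using sum_squares_bound[of u v] by (simp add: power2_eq_square algebra_simps)
  ultimately have "4 * u * v \<le> ((cmod (fst p))\<^sup>2 + u + v)\<^sup>2 + (snd p)\<^sup>2"
    using zero_le_power2[of "snd p"] by linarith
  then show y: "y \<ge> 1" unfolding y_def using assms(1,2) by (simp add: field_simps)
  show "hdist (horo_pt u p) (horo_pt v 0) = arcosh y"
    unfolding horo_pt_def
  proof (rule hdist_eqI)
    show "arcosh y \<ge> 0" using y by (auto simp: arcosh_real_def intro!: ln_ge_zero add_increasing2)
    have "cosh (arcosh y) = 2 * (cosh (arcosh y / 2))\<^sup>2 - 1"
      using cosh_double_cosh[of "arcosh y / 2"] by simp
    then have "(cosh (arcosh y / 2))\<^sup>2 = (y + 1) / 2" using y by (simp add: cosh_arcosh_real)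
    also have "\<dots> = (cmod (herm (horo_vec u p) (horo_vec v 0)))\<^sup>2 / (Re (herm (horo_vec u p) (horo_vec u p)) * Re (herm (horo_vec v 0) (horo_vec v 0)))"
      unfolding herm_horo_vec_ray herm_horo_vec y_def by simp
    finally show "(cosh (arcosh y / 2))\<^sup>2 = \<dots>" .
  qed auto
qed

text \<open>\<open>arcosh y - t\<close> is the logarithm of
  \<open>(y + sqrt (y^2 - 1)) / exp t\<close>. Since \<open>y / exp t\<close> tends to
  \<open>1 / (2 u)\<close>, the two summands add up to \<open>1 / u\<close>.\<close>

lemma busemann_limit:
  assumes "u > 0"
  shows "((\<lambda>t. hdist (horo_pt u p) (horo_pt (exp t) 0) - t) \<longlongrightarrow> - ln u) at_top"
proof -
  define a where "a = (cmod (fst p))\<^sup>2 + u"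
  define b where "b = (snd p)\<^sup>2"
  define y where "y t = ((a + exp t)\<^sup>2 + b) / (2 * u * exp t) - 1" for t
  have eq: "hdist (horo_pt u p) (horo_pt (exp t) 0) - t = ln (y t / exp t + sqrt ((y t / exp t)\<^sup>2 - 1 / (exp t)\<^sup>2))" for t
  proof -
    have y: "y t \<ge> 1" "hdist (horo_pt u p) (horo_pt (exp t) 0) = arcosh (y t)"
      using hdist_horo_pt_ray[OF assms, of "exp t" p] by (simp_all add: y_def a_def b_def)
    have "sqrt ((y t / exp t)\<^sup>2 - 1 / (exp t)\<^sup>2) = sqrt (((y t)\<^sup>2 - 1) / (exp t)\<^sup>2)"
      by (simp add: power_divide diff_divide_distrib)
    then have "sqrt ((y t / exp t)\<^sup>2 - 1 / (exp t)\<^sup>2) = sqrt ((y t)\<^sup>2 - 1) / exp t"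
      by (simp add: real_sqrt_divide)
    then have "ln (y t / exp t + sqrt ((y t / exp t)\<^sup>2 - 1 / (exp t)\<^sup>2)) = ln ((y t + sqrt ((y t)\<^sup>2 - 1)) / exp t)"
      by (simp add: add_divide_distrib)
    also have "\<dots> = ln (y t + sqrt ((y t)\<^sup>2 - 1)) - t"
    proof -
      have "y t + sqrt ((y t)\<^sup>2 - 1) > 0" using y(1) by (intro add_pos_nonneg) auto
      then show ?thesis by (simp add: ln_div)
    qed
    finally show ?thesis using y by (simp add: arcosh_real_def)
  qed
  have "((\<lambda>t. y t / exp t) \<longlongrightarrow> inverse u / 2) at_top"
    unfolding y_def using assms by real_asymp
  moreover have "inverse u / 2 = 1 / (2 * u)" by (simp add: inverse_eq_divide)
  ultimately have 1: "((\<lambda>t. y t / exp t) \<longlongrightarrow> 1 / (2 * u)) at_top" by simp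
  have "((\<lambda>t. 1 / (exp t)\<^sup>2 :: real) \<longlongrightarrow> 0) at_top" by real_asymp
  then have "((\<lambda>t. ln (y t / exp t + sqrt ((y t / exp t)\<^sup>2 - 1 / (exp t)\<^sup>2))) \<longlongrightarrow>
      ln (1 / (2 * u) + sqrt ((1 / (2 * u))\<^sup>2 - 0))) at_top"
  proof (intro tendsto_ln tendsto_add tendsto_real_sqrt tendsto_diff tendsto_power 1)
    have "1 / (2 * u) > 0" using assms by simp
    then have "1 / (2 * u) + sqrt ((1 / (2 * u))\<^sup>2 - 0) > 0" by (intro add_pos_nonneg) auto
    then show "1 / (2 * u) + sqrt ((1 / (2 * u))\<^sup>2 - 0) \<noteq> 0" using assms by simp
  qed
  moreover have "sqrt ((1 / (2 * u))\<^sup>2) = 1 / (2 * u)" by (rule real_sqrt_unique) (use assms in auto)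
  then have "ln (1 / (2 * u) + sqrt ((1 / (2 * u))\<^sup>2 - 0)) = - ln u"
    using assms by (simp add: ln_div)
  ultimately show ?thesis unfolding eq by simp
qed

text \<open>The vertical line over the origin, parametrised by the logarithm of the height; its
  vectors scaled by \<open>exp (- t)\<close> converge to a multiple of the first basis
  vector.\<close>

lemma ray: "geodesic_ray_to (\<lambda>t. horo_pt (exp t) 0) pt_inf"
  unfolding geodesic_ray_to_def
proof (intro conjI allI impI)
  show "horo_pt (exp t) 0 \<in> H2C" for t unfolding H2C_eq_horo_pt
    by (rule CollectI, rule exI[of _ "exp t"], rule exI[of _ 0]) simp
  show "hdist (horo_pt (exp s) 0) (horo_pt (exp t) 0) = \<bar>s - t\<bar>" for s t
    unfolding horo_pt_def
  proof (rule hdist_eqI)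
    have "cosh (\<bar>x\<bar> / 2) = cosh (x / 2)" for x :: real
      using cosh_minus[of "x / 2"] by (cases "x \<ge> 0") simp_all
    then have "(cosh (\<bar>s - t\<bar> / 2))\<^sup>2 = (cosh ((s - t) / 2))\<^sup>2" by (simp only:)
    also have "\<dots> = (exp s + exp t)\<^sup>2 / (4 * exp s * exp t)"
    proof -
      have e: "exp s = exp (s / 2) * exp (s / 2)" "exp t = exp (t / 2) * exp (t / 2)" by (simp_all flip: exp_add)
      have "cosh ((s - t) / 2) = (exp (s / 2) / exp (t / 2) + exp (t / 2) / exp (s / 2)) / 2"
        by (simp add: cosh_def diff_divide_distrib exp_diff exp_minus)
      moreover have "((a / b + b / a) / 2)\<^sup>2 = (a * a + b * b)\<^sup>2 / (4 * (a * a) * (b * b))"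
        if "a > 0" "b > 0" for a b :: real
        using that by (simp add: power2_eq_square field_simps)
      ultimately show ?thesis unfolding e by (simp only: exp_gt_zero)
    qed
    finally show "(cosh (\<bar>s - t\<bar> / 2))\<^sup>2 = (cmod (herm (horo_vec (exp s) 0) (horo_vec (exp t) 0)))\<^sup>2 /
      (Re (herm (horo_vec (exp s) 0) (horo_vec (exp s) 0)) * Re (herm (horo_vec (exp t) 0) (horo_vec (exp t) 0)))"
      unfolding herm_horo_vec_ray herm_horo_vec by simp
  qed auto
  show "\<exists>X Q. (\<forall>t\<ge>0. horo_pt (exp t) 0 = cline (X t)) \<and> Q \<noteq> 0 \<and> pt_inf = cline Q \<and> (X \<longlongrightarrow> Q) at_top"
  proof (intro exI conjI allI impI)
    let ?X = "\<lambda>t. of_real (exp (- t)) *s horo_vec (exp t) 0"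
    let ?Q = "(- 1 / 2) *s axis 1 1 :: complex^3"
    show "horo_pt (exp t) 0 = cline (?X t)" for t by (simp add: horo_pt_def cline_scale)
    show "?Q \<noteq> 0" by (simp add: axis_eq_0_iff)
    show "pt_inf = cline ?Q" unfolding pt_inf_def by (rule cline_scale[symmetric]) simp
    have "((\<lambda>t. complex_of_real (exp (- t))) \<longlongrightarrow> of_real 0) at_top"
      by (intro tendsto_of_real) real_asymp
    moreover have "?X t $ 1 = - 1 / 2" "?X t $ 2 = 0" "?X t $ 3 = of_real (exp (- t))" for t
    proof -
      have "complex_of_real (exp (- t)) * of_real (exp t) = 1"
        by (simp flip: of_real_mult exp_add)
      then show "?X t $ 1 = - 1 / 2" by simp
    qed simp_all
    moreover have "?Q $ 1 = - 1 / 2" "?Q $ 2 = 0" "?Q $ 3 = 0" by (simp_all add: axis_def)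
    ultimately have "\<forall>i. ((\<lambda>t. ?X t $ i) \<longlongrightarrow> ?Q $ i) at_top"
      unfolding forall_3 by simp
    then show "(?X \<longlongrightarrow> ?Q) at_top" by (simp add: vec_tendstoI)
  qed
qed

text \<open>The Busemann function of the vertical ray is \<open>- ln u\<close>, so its level 0 is
  the height 1.\<close>

lemma horosphere_horo_pt: "horosphere pt_inf (range (horo_pt 1))"
  unfolding horosphere_def
proof (intro conjI exI)
  show "pt_inf \<in> ideal_boundary" by (rule pt_inf_ideal)
  show "geodesic_ray_to (\<lambda>t. horo_pt (exp t) 0) pt_inf" by (rule ray)
  have *: "((\<lambda>t. hdist (horo_pt u p) (horo_pt (exp t) 0) - t) \<longlongrightarrow> 0) at_top \<longleftrightarrow> u = 1" if "u > 0" for u p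
    using busemann_limit[OF that, of p] tendsto_unique[OF trivial_limit_at_top_linorder busemann_limit[OF that, of p], of 0]
      that by (auto simp: ln_eq_zero_iff)
  show "range (horo_pt 1) = {L \<in> H2C. ((\<lambda>t. hdist L (horo_pt (exp t) 0) - t) \<longlongrightarrow> 0) at_top}"
    unfolding H2C_eq_horo_pt
  proof (rule equalityI; rule subsetI)
    fix L assume "L \<in> range (horo_pt 1)"
    then obtain p where p: "L = horo_pt 1 p" by blast
    have "L \<in> {horo_pt u p | u p. u > 0}" unfolding p using zero_less_one by blast
    moreover have "((\<lambda>t. hdist L (horo_pt (exp t) 0) - t) \<longlongrightarrow> 0) at_top" unfolding p by (simp only: *[OF zero_less_one])
    ultimately show "L \<in> {L \<in> {horo_pt u p | u p. u > 0}. ((\<lambda>t. hdist L (horo_pt (exp t) 0) - t) \<longlongrightarrow> 0) at_top}"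
      by blast
  next
    fix L assume "L \<in> {L \<in> {horo_pt u p | u p. u > 0}. ((\<lambda>t. hdist L (horo_pt (exp t) 0) - t) \<longlongrightarrow> 0) at_top}"
    then obtain u p where L: "L = horo_pt u p" "u > 0" "((\<lambda>t. hdist L (horo_pt (exp t) 0) - t) \<longlongrightarrow> 0) at_top" by blast
    then have "u = 1" using * by blast
    then show "L \<in> range (horo_pt 1)" using L(1) by simp
  qed
qed

section \<open>Integers of imaginary quadratic fields\<close>

text \<open>All powers of the denominator \<open>q\<close> would divide \<open>M\<close>, which is
  impossible already for \<open>q ^ M\<close> if \<open>q\<close> is at least 2.\<close>

lemma bounded_denominators_imp_Ints:
  fixes r :: real
  assumes "r \<in> \<rat>" "M > 0" "\<And>n. of_nat M * r ^ n \<in> \<int>"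
  shows "r \<in> \<int>"
proof -
  obtain p q where pq: "r = of_int p / of_int q" "q > 0" "coprime p q"
    using Rats_cases'[OF assms(1)] by metis
  have dvd: "q ^ n dvd int M" for n
  proof -
    obtain k where k: "of_nat M * r ^ n = of_int k" using assms(3)[of n] by (auto elim: Ints_cases)
    have "of_int (int M * p ^ n) = (of_int (k * q ^ n) :: real)"
      using k pq(1,2) by (simp add: power_divide field_simps)
    then have "int M * p ^ n = k * q ^ n" by linarith
    then have "q ^ n dvd int M * p ^ n" by simp
    moreover have "coprime (q ^ n) (p ^ n)" using pq(3) by (simp add: coprime_commute)
    ultimately show ?thesis by (simp add: coprime_dvd_mult_left_iff)
  qed
  have "q = 1"
  proof (rule ccontr)
    assume "q \<noteq> 1"
    then have "q \<ge> 2" using pq(2) by simp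
    have "int M < 2 ^ M" by (metis of_nat_less_two_power)
    also have "\<dots> \<le> q ^ M" using \<open>q \<ge> 2\<close> by (intro power_mono) auto
    also have "\<dots> \<le> int M" using dvd[of M] assms(2) by (intro zdvd_imp_le) auto
    finally show False by simp
  qed
  then show ?thesis by (simp add: pq(1))
qed

lemma quad_ints_norm_Ints: "z \<in> quad_ints d \<Longrightarrow> (cmod z)\<^sup>2 \<in> \<int>"
proof -
  assume "z \<in> quad_ints d"
  then obtain x y where "Re z = of_int x" "Im z = of_int y * sqrt (real d)" by (auto simp: quad_ints_iff)
  then have "(cmod z)\<^sup>2 = of_int (x\<^sup>2 + y\<^sup>2 * int d)"
    by (simp add: cmod_power2 power_mult_distrib)
  then show ?thesis by (metis Ints_of_int)
qed

text \<open>Norms of algebraic integers are integers, because the powers of an algebraic integer have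
  a common denominator. Together with the norm of \<open>z + 1\<close> this also yields the trace.\<close>

lemma algebraic_int_powers_bounded:
  assumes "algebraic_int z" "q > 0" "of_nat q * z \<in> quad_ints d"
  obtains M :: nat where "M > 0" "\<And>n. of_nat M * z ^ n \<in> quad_ints d"
proof -
  obtain p where p: "poly p z = 0" "lead_coeff p = 1" "\<forall>i. coeff p i \<in> \<int>"
    using assms(1) by (auto elim: algebraic_int.cases)
  define m where "m = degree p"
  \<comment> \<open>This clears the denominators of all powers up to the degree of \<open>p\<close>;
    the monic equation expresses each higher power by lower ones with integer coefficients.\<close>
  define M where "M = q ^ m"
  have small: "of_nat M * z ^ n \<in> quad_ints d" if "n \<le> m" for n
  proof -
    have pw: "(of_nat q * z) ^ n \<in> quad_ints d" for n
      using assms(3) by (induction n) auto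
    have "q ^ m = q ^ (m - n) * q ^ n" using that by (simp flip: power_add)
    then have "of_nat M * z ^ n = of_nat (q ^ (m - n)) * (of_nat q * z) ^ n"
      by (simp add: M_def power_mult_distrib)
    then show ?thesis using pw by (metis quad_ints_mult quad_ints_of_nat)
  qed
  have "of_nat M * z ^ n \<in> quad_ints d" for n
  proof (induction n rule: less_induct)
    case (less n)
    show ?case
    proof (cases "n \<le> m")
      case False
      have "(\<Sum>i\<le>m. coeff p i * z ^ i) = 0" using p(1) by (simp add: poly_altdef m_def)
      then have "z ^ m = - (\<Sum>i<m. coeff p i * z ^ i)"
        using p(2) by (simp add: lessThan_Suc_atMost[symmetric] m_def eq_neg_iff_add_eq_0 add.commute)
      then have "of_nat M * (z ^ (n - m) * z ^ m) = - (\<Sum>i<m. coeff p i * (of_nat M * z ^ (n - m + i)))"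
        by (simp add: sum_distrib_left power_add mult_ac)
      moreover have "z ^ (n - m) * z ^ m = z ^ n" using False by (simp flip: power_add)
      moreover have "coeff p i * (of_nat M * z ^ (n - m + i)) \<in> quad_ints d" if "i < m" for i
      proof (rule quad_ints_mult)
        show "coeff p i \<in> quad_ints d" using p(3) by (metis Ints_cases quad_ints_of_int)
        show "of_nat M * z ^ (n - m + i) \<in> quad_ints d" using less[of "n - m + i"] that False by simp
      qed
      ultimately show ?thesis using quad_ints_minus quad_ints_sum[of "{..<m}"] by (metis (no_types, lifting) lessThan_iff)
    qed (use small in auto)
  qed
  moreover have "M > 0" using assms(2) by (simp add: M_def)
  ultimately show thesis using that by blast
qed

text \<open>A common denominator \<open>M\<close> for the powers of \<open>w\<close> makes
  \<open>M^2 |w|^(2 n)\<close> an integer for all \<open>n\<close>, while |w|^2 is rational. The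
  binomial formula passes the same denominator on to \<open>z + 1\<close>.\<close>

lemma algebraic_int_norm:
  assumes "algebraic_int z" "Re z = x" "Im z = y * sqrt (real d)" "x \<in> \<rat>" "y \<in> \<rat>"
  shows "(cmod z)\<^sup>2 \<in> \<int>" "(cmod (z + 1))\<^sup>2 \<in> \<int>"
proof -
  obtain a b where ab: "x = of_int a / of_int b" "b > 0" using Rats_cases'[OF assms(4)] by metis
  obtain a' b' where ab': "y = of_int a' / of_int b'" "b' > 0" using Rats_cases'[OF assms(5)] by metis
  have q: "nat (b * b') > 0" using ab(2) ab'(2) by simp
  have "of_nat (nat (b * b')) * z \<in> quad_ints d"
    unfolding quad_ints_iff using ab ab' assms(2,3)
    by (intro exI[of _ "a * b'"] exI[of _ "a' * b"]) (simp add: field_simps)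
  then obtain M :: nat where M: "M > 0" "\<And>n. of_nat M * z ^ n \<in> quad_ints d"
    using algebraic_int_powers_bounded[OF assms(1) q] by metis
  have *: "(cmod w)\<^sup>2 \<in> \<int>" if w: "\<And>n. of_nat M * w ^ n \<in> quad_ints d" "(cmod w)\<^sup>2 \<in> \<rat>" for w
  proof (rule bounded_denominators_imp_Ints[of _ "M * M"])
    fix n
    have "of_nat (M * M) * ((cmod w)\<^sup>2) ^ n = (cmod (of_nat M * w ^ n))\<^sup>2"
      by (simp add: norm_mult norm_power power2_eq_square power_mult_distrib)
    then show "of_nat (M * M) * ((cmod w)\<^sup>2) ^ n \<in> \<int>" using quad_ints_norm_Ints[OF w(1)] by metis
  qed (use M w in auto)
  have n: "(cmod z)\<^sup>2 = x\<^sup>2 + y\<^sup>2 * real d" "(cmod (z + 1))\<^sup>2 = (x + 1)\<^sup>2 + y\<^sup>2 * real d"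
    unfolding cmod_power2 by (simp_all add: assms(2,3) power_mult_distrib)
  show "(cmod z)\<^sup>2 \<in> \<int>"
    by (rule *[OF M(2)]) (use assms(4,5) in \<open>auto simp: n\<close>)
  show "(cmod (z + 1))\<^sup>2 \<in> \<int>"
  proof (rule *)
    fix n
    have "of_nat M * (z + 1) ^ n = (\<Sum>k\<le>n. of_nat (n choose k) * (of_nat M * z ^ k))"
      by (simp add: binomial_ring sum_distrib_left mult_ac)
    also have "\<dots> \<in> quad_ints d" by (intro quad_ints_sum quad_ints_mult quad_ints_of_nat M(2))
    finally show "of_nat M * (z + 1) ^ n \<in> quad_ints d" .
  qed (use assms(4,5) in \<open>auto simp: n\<close>)
qed

text \<open>The trace \<open>2 x\<close> is the norm of \<open>z + 1\<close> minus the norm of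
  \<open>z\<close> minus 1, hence an integer. Then \<open>(2 y)^2 d\<close> is an integer as well,
  and squarefreeness of \<open>d\<close> removes the denominator of \<open>2 y\<close>.\<close>

lemma ring_of_ints_half:
  assumes "squarefree d" "z \<in> ring_of_ints d"
  shows "2 * z \<in> quad_ints d"
proof -
  obtain x' y' where z: "algebraic_int z" "x' \<in> \<rat>" "y' \<in> \<rat>" "z = x' + y' * (\<i> * of_real (sqrt (real d)))"
    using assms(2) by (auto simp: ring_of_ints_def)
  have real: "\<exists>r\<in>\<rat>. w = complex_of_real r" if w: "w \<in> \<rat>" for w
  proof -
    obtain a b where "w = of_int a / of_int b" using Rats_cases'[OF w] by metis
    then show ?thesis by (intro bexI[of _ "of_int a / of_int b"]) simp_all
  qed
  obtain x y where xy: "x' = of_real x" "y' = of_real y" "x \<in> \<rat>" "y \<in> \<rat>"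
    using real[OF z(2)] real[OF z(3)] by blast
  have ReIm: "Re z = x" "Im z = y * sqrt (real d)" by (simp_all add: z(4) xy)
  note I = algebraic_int_norm[OF z(1) ReIm xy(3,4)]
  have "(cmod (z + 1))\<^sup>2 - (cmod z)\<^sup>2 - 1 = 2 * x"
    unfolding cmod_power2 by (simp add: ReIm power2_eq_square algebra_simps)
  then have x2: "2 * x \<in> \<int>" using I by (metis Ints_diff Ints_1)
  have "4 * (cmod z)\<^sup>2 - (2 * x)\<^sup>2 = (2 * y)\<^sup>2 * real d"
    unfolding cmod_power2 by (simp add: ReIm power_mult_distrib)
  moreover have "4 * (cmod z)\<^sup>2 - (2 * x)\<^sup>2 \<in> \<int>" by (rule Ints_diff[OF Ints_mult[OF _ I(1)] Ints_power[OF x2]]) simp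
  ultimately obtain k where k: "(2 * y)\<^sup>2 * real d = of_int k" by (metis Ints_cases)
  obtain a b where ab: "2 * y = of_int a / of_int b" "b > 0" "coprime a b"
    using Rats_cases'[of "2 * y"] xy(4) by (metis Rats_mult Rats_number_of)
  have "of_int (a\<^sup>2 * int d) = (of_int (k * b\<^sup>2) :: real)"
    using k ab(2) unfolding ab(1) by (simp add: power_divide field_simps)
  then have "a\<^sup>2 * int d = k * b\<^sup>2" by linarith
  then have "b\<^sup>2 dvd a\<^sup>2 * int d" by simp
  moreover have "coprime (b\<^sup>2) (a\<^sup>2)" using ab(3) by (simp add: coprime_commute)
  ultimately have "b\<^sup>2 dvd int d" by (simp add: coprime_dvd_mult_right_iff)
  then have "(nat b)\<^sup>2 dvd d" using ab(2) by (metis int_dvd_int_iff nat_0_le of_nat_power order_less_imp_le)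
  then have "nat b = 1" using assms(1) by (auto simp: squarefree_def)
  then have "b = 1" by simp
  then have "2 * y = of_int a" using ab(1) by simp
  moreover obtain c where "2 * x = of_int c" using x2 by (metis Ints_cases)
  ultimately show ?thesis unfolding quad_ints_iff
    by (intro exI[of _ c] exI[of _ a]) (simp add: ReIm)
qed

lemma quad_ints_subset_ring_of_ints: "z \<in> quad_ints d \<Longrightarrow> z \<in> ring_of_ints d"
proof -
  assume "z \<in> quad_ints d"
  then obtain x y where z: "z = of_int x + of_int y * (\<i> * of_real (sqrt (real d)))" by (auto simp: quad_ints_def)
  let ?p = "[:of_int (x\<^sup>2 + int d * y\<^sup>2), of_int (- 2 * x), 1:] :: complex poly"
  have "of_real (sqrt (real d)) * of_real (sqrt (real d)) = (of_nat d :: complex)"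
    by (simp flip: of_real_mult)
  then have "poly ?p z = 0"
    by (simp add: z power2_eq_square algebra_simps)
  moreover have "coeff ?p i \<in> \<int>" for i
    by (auto simp: coeff_pCons split: nat.splits)
  ultimately have "algebraic_int z" by (intro algebraic_int.intros[of ?p]) auto
  moreover have "(of_int x :: complex) \<in> \<rat>" "(of_int y :: complex) \<in> \<rat>" by simp_all
  ultimately show ?thesis unfolding ring_of_ints_def using z by blast
qed

section \<open>Commensurability\<close>

text \<open>\<open>f\<close> labels the elements so that equal labels lie in one coset of
  \<open>K\<close>; finitely many labels then leave finitely many cosets.\<close>

lemma finite_indexI:
  assumes G: "group G" and K: "subgroup K G" and H: "H \<subseteq> carrier G"
    and fin: "finite (f ` H)" and eq: "\<And>x y. x \<in> H \<Longrightarrow> y \<in> H \<Longrightarrow> f x = f y \<Longrightarrow> x \<otimes>\<^bsub>G\<^esub> inv\<^bsub>G\<^esub> y \<in> K"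
  shows "finite_index_in G K H"
proof -
  interpret group G by (rule G)
  define c where "c x = K #>\<^bsub>G\<^esub> x" for x
  have ceq: "c x = c y" if "x \<in> H" "y \<in> H" "f x = f y" for x y
  proof -
    have xy: "x \<in> carrier G" "y \<in> carrier G" using that H by auto
    then have "x = x \<otimes>\<^bsub>G\<^esub> inv\<^bsub>G\<^esub> y \<otimes>\<^bsub>G\<^esub> y" by (simp add: m_assoc)
    then have "x \<in> K #>\<^bsub>G\<^esub> y" using eq[OF that] unfolding r_coset_def by blast
    then show ?thesis unfolding c_def using repr_independence[OF _ xy(2) K] by simp
  qed
  have "c ` H \<subseteq> (\<lambda>v. c (inv_into H f v)) ` (f ` H)"
  proof
    fix y assume "y \<in> c ` H"
    then obtain x where x: "x \<in> H" "y = c x" by auto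
    have "inv_into H f (f x) \<in> H" "f (inv_into H f (f x)) = f x"
      using x(1) by (auto intro: inv_into_into f_inv_into_f)
    then have "y = c (inv_into H f (f x))" using x ceq by metis
    then show "y \<in> (\<lambda>v. c (inv_into H f v)) ` (f ` H)" using x(1) by blast
  qed
  then have "finite (c ` H)" using fin finite_subset by blast
  moreover have "rcosets\<^bsub>G\<lparr>carrier := H\<rparr>\<^esub> K = c ` H"
    by (auto simp: RCOSETS_def r_coset_def c_def)
  ultimately show ?thesis by (simp add: finite_index_in_def)
qed

text \<open>PU(2,1) in the notation of \<open>proj_map\<close>. All elements of the Picard group are
  holomorphic, so only this part of the congruence group can meet it.\<close>

definition holomorphic_isoms :: "((complex^3) set \<Rightarrow> (complex^3) set) set" where
  "holomorphic_isoms = {proj_map A False | A. A \<in> U21}"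

lemma subgroup_holomorphic_isoms: "subgroup holomorphic_isoms isom_H2C"
proof (rule group.subgroupI[OF group_isom_H2C])
  show "holomorphic_isoms \<subseteq> carrier isom_H2C" unfolding holomorphic_isoms_def carrier_isom_H2C by blast
  show "holomorphic_isoms \<noteq> {}" unfolding holomorphic_isoms_def using U21_mat_1 by blast
  show "inv\<^bsub>isom_H2C\<^esub> g \<in> holomorphic_isoms" if "g \<in> holomorphic_isoms" for g
    using that unfolding holomorphic_isoms_def by (auto simp: inv_isom_H2C intro!: U21_herm_adj)
  show "g \<otimes>\<^bsub>isom_H2C\<^esub> h \<in> holomorphic_isoms" if gh: "g \<in> holomorphic_isoms" "h \<in> holomorphic_isoms" for g h
  proof -
    obtain A B where "g = proj_map A False" "h = proj_map B False" "A \<in> U21" "B \<in> U21"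
      using gh unfolding holomorphic_isoms_def by blast
    then have "g \<otimes>\<^bsub>isom_H2C\<^esub> h = proj_map (A ** B) False" "A ** B \<in> U21"
      by (simp_all add: mult_isom_H2C U21_mult)
    then show ?thesis unfolding holomorphic_isoms_def by blast
  qed
qed

context cusp_data
begin

lemma cong_group_picard: "cong_group \<inter> picard_group d = cong_group \<inter> holomorphic_isoms"
proof (rule equalityI; rule subsetI)
  fix g assume "g \<in> cong_group \<inter> picard_group d"
  then show "g \<in> cong_group \<inter> holomorphic_isoms" unfolding picard_group_def holomorphic_isoms_def proj_eq_proj_map by blast
next
  fix g assume g: "g \<in> cong_group \<inter> holomorphic_isoms"
  then obtain A e v u where A: "g = proj_map A e" "A \<in> U21" "int_mat d A" by (blast elim: GamE)
  obtain B where "g = proj_map B False" "B \<in> U21" using g unfolding holomorphic_isoms_def by blast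
  then have "proj_map A e = proj_map B False" "B \<in> U21" using A by auto
  then have "e = False" using proj_map_eq_imp[OF A(2)] by metis
  then have "g \<in> picard_group d"
    using A quad_ints_subset_ring_of_ints unfolding picard_group_def proj_eq_proj_map int_mat_def by blast
  then show "g \<in> cong_group \<inter> picard_group d" using g by blast
qed

text \<open>The quotient of two antiholomorphic elements is holomorphic, so the index is at most
  2.\<close>

lemma finite_index_cong_group: "finite_index_in isom_H2C (cong_group \<inter> picard_group d) cong_group"
  unfolding cong_group_picard
proof (rule finite_indexI[where f = "\<lambda>g. g \<in> holomorphic_isoms"])
  interpret group isom_H2C by (rule group_isom_H2C)
  show "subgroup (cong_group \<inter> holomorphic_isoms) isom_H2C" by (rule subgroups_Inter_pair[OF subgroup_cong_group subgroup_holomorphic_isoms])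
  fix x y assume xy: "x \<in> cong_group" "y \<in> cong_group" "(x \<in> holomorphic_isoms) = (y \<in> holomorphic_isoms)"
  interpret H: subgroup holomorphic_isoms isom_H2C by (rule subgroup_holomorphic_isoms)
  interpret Ga: subgroup cong_group isom_H2C by (rule subgroup_cong_group)
  obtain A e where x: "x = proj_map A e" "A \<in> U21" using xy(1) by (blast elim: GamE)
  obtain B f where y: "y = proj_map B f" "B \<in> U21" using xy(2) by (blast elim: GamE)
  have "x \<otimes>\<^bsub>isom_H2C\<^esub> inv\<^bsub>isom_H2C\<^esub> y \<in> holomorphic_isoms"
  proof (cases "x \<in> holomorphic_isoms")
    case True
    then show ?thesis using xy(3) by simp
  next
    case False
    then have "y \<notin> holomorphic_isoms" using xy(3) by simp
    then have "f" using y unfolding holomorphic_isoms_def by (cases f) auto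
    moreover have "e" using x False unfolding holomorphic_isoms_def by (cases e) auto
    ultimately
    have "x \<otimes>\<^bsub>isom_H2C\<^esub> inv\<^bsub>isom_H2C\<^esub> y = proj_map (A ** herm_adj B) False"
      using x y by (simp add: inv_isom_H2C mult_isom_H2C U21_cnj_mat U21_herm_adj)
    then show ?thesis using x y U21_mult U21_herm_adj unfolding holomorphic_isoms_def by blast
  qed
  then show "x \<otimes>\<^bsub>isom_H2C\<^esub> inv\<^bsub>isom_H2C\<^esub> y \<in> cong_group \<inter> holomorphic_isoms" using xy by blast
qed (use group_isom_H2C cong_group_subset in auto)

text \<open>Finitely many residue classes of entries suffice, although the Picard group has entries
  in the full ring of integers and the congruence group only in the order.\<close>

lemma finite_index_picard:
  assumes "squarefree d"
  shows "finite_index_in isom_H2C (cong_group \<inter> picard_group d) (picard_group d)"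
proof -
  interpret group isom_H2C by (rule group_isom_H2C)
  have "\<forall>g\<in>picard_group d. \<exists>A. A \<in> U21 \<and> (\<forall>i j. A $ i $ j \<in> ring_of_ints d) \<and> g = proj_map A False"
    unfolding picard_group_def proj_eq_proj_map by blast
  then obtain M where M: "\<And>g. g \<in> picard_group d \<Longrightarrow> M g \<in> U21"
    "\<And>g i j. g \<in> picard_group d \<Longrightarrow> M g $ i $ j \<in> ring_of_ints d" "\<And>g. g \<in> picard_group d \<Longrightarrow> g = proj_map (M g) False"
    by metis
  \<comment> \<open>Entries may be half-integral, so they are doubled first; agreement of the
    doubled entries modulo \<open>4 N\<close> means agreement of the entries modulo
    \<open>2 N\<close>.\<close>
  define r where "r z = (\<lfloor>Re (2 * z)\<rfloor> mod (4 * N), \<lfloor>Im (2 * z) / sqrt (real d)\<rfloor> mod (4 * N))" for z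
  define f where "f g = (\<lambda>(i, j). r (M g $ i $ j))" for g
  have r_diff: "a - b \<in> quad_mult d (2 * N)"
    if ab: "2 * a \<in> quad_ints d" "2 * b \<in> quad_ints d" "r a = r b" for a b
  proof -
    have sd: "sqrt (real d) \<noteq> 0" using d by simp
    obtain x y where a: "Re (2 * a) = of_int x" "Im (2 * a) = of_int y * sqrt (real d)" using ab(1) unfolding quad_ints_iff by blast
    obtain x' y' where b: "Re (2 * b) = of_int x'" "Im (2 * b) = of_int y' * sqrt (real d)" using ab(2) unfolding quad_ints_iff by blast
    have "x mod (4 * N) = x' mod (4 * N)" "y mod (4 * N) = y' mod (4 * N)"
      using ab(3) unfolding r_def a b using sd by simp_all
    then obtain k l where "x - x' = 4 * N * k" "y - y' = 4 * N * l"
      by (metis mod_eq_dvd_iff dvd_def)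
    then have kl: "x = x' + 4 * N * k" "y = y' + 4 * N * l" by linarith+
    have "Re (a - b) = of_int (2 * N * k)" using a b by (simp add: kl)
    moreover have "Im (a - b) = of_int (2 * N * l) * sqrt (real d)" using a b by (simp add: kl algebra_simps)
    ultimately show ?thesis unfolding quad_mult_iff by blast
  qed
  show ?thesis
  proof (rule finite_indexI[where f = f])
    show "subgroup (cong_group \<inter> picard_group d) isom_H2C"
      unfolding cong_group_picard by (rule subgroups_Inter_pair[OF subgroup_cong_group subgroup_holomorphic_isoms])
    show "picard_group d \<subseteq> carrier isom_H2C" using M(1,3) unfolding carrier_isom_H2C by blast
    have "f ` picard_group d \<subseteq> (\<Pi>\<^sub>E x\<in>UNIV. {0..<4 * N} \<times> {0..<4 * N})"
      using N by (auto simp: f_def r_def)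
    moreover have "finite (\<Pi>\<^sub>E x\<in>(UNIV :: (3 \<times> 3) set). {0..<4 * N} \<times> {0..<4 * N})"
      by (intro finite_PiE) auto
    ultimately show "finite (f ` picard_group d)" by (rule finite_subset)
    fix x y assume x: "x \<in> picard_group d" and y: "y \<in> picard_group d" and "f x = f y"
    then have req: "r (M x $ i $ j) = r (M y $ i $ j)" for i j
      unfolding f_def by (metis (mono_tags, lifting) case_prod_conv)
    define A where "A = M x ** herm_adj (M y)"
    have AU: "A \<in> U21" using M(1) x y by (simp add: A_def U21_mult U21_herm_adj)
    have prod: "x \<otimes>\<^bsub>isom_H2C\<^esub> inv\<^bsub>isom_H2C\<^esub> y = proj_map A False"
      unfolding A_def by (subst M(3)[OF x], subst M(3)[OF y])
        (simp add: inv_isom_H2C mult_isom_H2C U21_herm_adj M(1) x y)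
    have "cong_mat d N A (mat 1)"
      unfolding cong_mat_def
    proof (intro allI)
      fix i j
      have "A $ i $ j - mat 1 $ i $ j = (M x ** herm_adj (M y)) $ i $ j - (M y ** herm_adj (M y)) $ i $ j"
        using M(1)[OF y] by (simp add: A_def U21_right_inv)
      also have "\<dots> = (\<Sum>k\<in>UNIV. (M x $ i $ k - M y $ i $ k) * herm_adj (M y) $ k $ j)"
        by (simp add: matrix_matrix_mult_def sum_subtractf left_diff_distrib)
      also have "\<dots> \<in> quad_mult d N"
      proof (rule quad_mult_sum)
        fix k
        \<comment> \<open>The factor 2 in \<open>2 N\<close> is spent on the other factor, which
          becomes integral only after doubling; a multiple of \<open>N\<close> remains.\<close>
        have "M x $ i $ k - M y $ i $ k \<in> quad_mult d (2 * N)"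
          using r_diff req ring_of_ints_half[OF assms] M(2) x y by blast
        then obtain w where w: "M x $ i $ k - M y $ i $ k = of_int (2 * N) * w" "w \<in> quad_ints d"
          unfolding quad_mult_def by blast
        have "2 * (M y $ swap13 j $ swap13 k) \<in> quad_ints d"
          using ring_of_ints_half[OF assms] M(2) y by blast
        then have "cnj (2 * (M y $ swap13 j $ swap13 k)) \<in> quad_ints d" by (rule quad_ints_cnj)
        then have "2 * herm_adj (M y) $ k $ j \<in> quad_ints d" by simp
        then have "w * (2 * herm_adj (M y) $ k $ j) \<in> quad_ints d" by (rule quad_ints_mult[OF w(2)])
        moreover have "(M x $ i $ k - M y $ i $ k) * herm_adj (M y) $ k $ j = of_int N * (w * (2 * herm_adj (M y) $ k $ j))"
          unfolding w(1) by simp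
        ultimately show "(M x $ i $ k - M y $ i $ k) * herm_adj (M y) $ k $ j \<in> quad_mult d N"
          unfolding quad_mult_def by blast
      qed
      finally show "A $ i $ j - mat 1 $ i $ j \<in> quad_mult d N" .
    qed
    then have "proj_map A False \<in> cong_group" using GamI[OF AU D_id] by (simp add: cusp_mat_id)
    moreover have "proj_map A False \<in> holomorphic_isoms" unfolding holomorphic_isoms_def using AU by blast
    ultimately show "x \<otimes>\<^bsub>isom_H2C\<^esub> inv\<^bsub>isom_H2C\<^esub> y \<in> cong_group \<inter> picard_group d"
      unfolding prod cong_group_picard by blast
  qed (rule group_isom_H2C)
qed

lemma commensurable_cong_group:
  assumes "squarefree d"
  shows "commensurable isom_H2C cong_group (picard_group d)"
proof -
  interpret group isom_H2C by (rule group_isom_H2C)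
  have "\<one>\<^bsub>isom_H2C\<^esub> \<otimes>\<^bsub>isom_H2C\<^esub> h \<otimes>\<^bsub>isom_H2C\<^esub> inv\<^bsub>isom_H2C\<^esub> \<one>\<^bsub>isom_H2C\<^esub> = h" if "h \<in> cong_group" for h
    using that cong_group_subset by auto
  then have "conjugate_by isom_H2C \<one>\<^bsub>isom_H2C\<^esub> cong_group = cong_group"
    unfolding conjugate_by_def by force
  then show ?thesis
    unfolding commensurable_def
    using finite_index_cong_group finite_index_picard[OF assms] one_closed by (intro bexI[of _ "\<one>\<^bsub>isom_H2C\<^esub>"]) simp_all
qed

end

section \<open>Smooth maps\<close>

lemma ck_on_affine:
  assumes "bounded_linear l"
  shows "ck_on n UNIV (\<lambda>x. c + l x)"
proof -
  have const: "ck_on n UNIV (\<lambda>x :: 'a. c :: 'b)" for n c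
    by (induction n arbitrary: c) (simp_all add: frechet_derivative_const)
  have D: "((\<lambda>x. c + l x) has_derivative l) (at x)" for x
    using has_derivative_add[OF has_derivative_const bounded_linear_imp_has_derivative[OF assms], of c "at x"] by simp
  then have F: "frechet_derivative (\<lambda>x. c + l x) (at x) = l" for x
    by (rule frechet_derivative_at[symmetric])
  show ?thesis
  proof (cases n)
    case 0
    have "continuous_on UNIV (\<lambda>x. c + l x)"
      using linear_continuous_on[OF assms] by (intro continuous_intros)
    then show ?thesis by (simp add: 0)
  next
    case (Suc m)
    then show ?thesis using D const by (auto simp: F differentiable_def)
  qed
qed

text \<open>Covers quadratic maps: each directional derivative is affine in the point, so one
  differentiation leads to \<open>ck_on_affine\<close>.\<close>

lemma smooth_on_affine_derivative:
  assumes D: "\<And>x. (f has_derivative (\<lambda>v. a v + m v x)) (at x)" and m: "\<And>v. bounded_linear (m v)"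
  shows "smooth_on UNIV f"
  unfolding smooth_on_def
proof
  fix n
  have F: "frechet_derivative f (at x) = (\<lambda>v. a v + m v x)" for x
    using frechet_derivative_at[OF D] by simp
  show "ck_on n UNIV f"
  proof (cases n)
    case 0
    have "continuous_on UNIV f"
      using D by (intro continuous_at_imp_continuous_on ballI has_derivative_continuous)
    then show ?thesis by (simp add: 0)
  next
    case (Suc k)
    have "ck_on k UNIV (\<lambda>x. a v + m v x)" for v by (rule ck_on_affine[OF m])
    then show ?thesis using D by (auto simp: Suc F differentiable_def)
  qed
qed

lemma smooth_on_affine:
  assumes "bounded_linear l"
  shows "smooth_on UNIV (\<lambda>x. c + l x)"
  unfolding smooth_on_def using ck_on_affine[OF assms] by blast

text \<open>The affine chart of the horosphere of height 1, as a function of the Nil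
  coordinate.\<close>

definition horo_chart :: "nil_point \<Rightarrow> complex \<times> complex" where
  "horo_chart p = ((- of_real ((cmod (fst p))\<^sup>2 + 1) + \<i> * of_real (snd p)) / 2, fst p)"

lemma has_derivative_horo_chart:
  fixes z :: "'a::real_normed_vector \<Rightarrow> complex"
  assumes [derivative_intros]: "(z has_derivative z') (at x)" "(t has_derivative t') (at x)"
  shows "((\<lambda>x. ((- of_real (z x \<bullet> z x + 1) + \<i> * of_real (t x)) / 2, z x)) has_derivative
    (\<lambda>v. ((- of_real (z x \<bullet> z' v + z' v \<bullet> z x) + \<i> * of_real (t' v)) / 2, z' v))) (at x)"
  by (auto intro!: derivative_eq_intros assms)

lemma smooth_horo_chart_affine:
  fixes l :: "nil_point \<Rightarrow> nil_point"
  assumes l: "bounded_linear l"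
  shows "smooth_on UNIV (\<lambda>x. horo_chart (b + l x))"
proof -
  note [bounded_linear] = l
  have Dl: "((\<lambda>x. b + l x) has_derivative l) (at x)" for x
    using has_derivative_add[OF has_derivative_const bounded_linear_imp_has_derivative[OF l], of b "at x"] by simp
  have eq: "horo_chart p = ((- of_real (fst p \<bullet> fst p + 1) + \<i> * of_real (snd p)) / 2, fst p)" for p
    by (simp add: horo_chart_def power2_norm_eq_inner)
  \<comment> \<open>The derivative in direction \<open>v\<close> splits into \<open>a v\<close>,
    independent of the point, and \<open>m v x\<close>, linear in it; the latter comes from the
    squared norm.\<close>
  define a :: "nil_point \<Rightarrow> complex \<times> complex" where
    "a v = ((- of_real (2 * (fst b \<bullet> fst (l v))) + \<i> * of_real (snd (l v))) / 2, fst (l v))" for v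
  define m :: "nil_point \<Rightarrow> nil_point \<Rightarrow> complex \<times> complex" where
    "m v x = (- of_real (fst (l x) \<bullet> fst (l v)), 0)" for v x
  show ?thesis
  proof (rule smooth_on_affine_derivative)
    show "((\<lambda>x. horo_chart (b + l x)) has_derivative (\<lambda>v. a v + m v x)) (at x)" for x
      unfolding eq a_def m_def
      by (rule has_derivative_eq_rhs, rule has_derivative_horo_chart[OF has_derivative_fst[OF Dl] has_derivative_snd[OF Dl]])
         (auto simp: fun_eq_iff inner_add_left inner_add_right inner_commute complex_eq_iff Re_divide_numeral Im_divide_numeral)
    show "bounded_linear (m v)" for v
      unfolding m_def
      by (intro bounded_linear_Pair bounded_linear_zero bounded_linear_minus bounded_linear_compose[OF bounded_linear_of_real]
          bounded_linear_compose[OF bounded_linear_inner_left] bounded_linear_compose[OF bounded_linear_fst l])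
  qed
qed

section \<open>The cusp cross-section\<close>

lemma horo_chart_chart: "affine_chart (horo_pt 1 p) = horo_chart p"
  by (simp add: affine_chart_horo_pt horo_chart_def)

context cusp_data
begin

definition cusp_group where
  "cusp_group = isom_H2C\<lparr>carrier := stabilizer (isom_H2C\<lparr>carrier := cong_group\<rparr>) (\<lambda>g. g) pt_inf\<rparr>"

lemma carrier_cusp_group: "carrier cusp_group = {proj_map (cusp_mat v u) e | v u e. (v, u, e) \<in> D}"
  using stabilizer_cong_group by (simp add: cusp_group_def stabilizer_def)

lemma orbit_cusp_group: "orbit_of cusp_group (horo_pt 1 p) = {horo_pt 1 (nil_isometry v u e p) | v u e. (v, u, e) \<in> D}"
proof -
  have eq: "proj_map (cusp_mat v u) e (horo_pt 1 p) = horo_pt 1 (nil_isometry v u e p)" if "(v, u, e) \<in> D" for v u e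
    using D_unit'[OF that] by (simp add: proj_map_horo_pt)
  have "orbit_of cusp_group (horo_pt 1 p) = {proj_map (cusp_mat v u) e (horo_pt 1 p) | v u e. (v, u, e) \<in> D}"
    unfolding orbit_def carrier_cusp_group by blast
  also have "\<dots> = {horo_pt 1 (nil_isometry v u e p) | v u e. (v, u, e) \<in> D}"
    by (intro Collect_cong iff_exI rev_conj_cong) (simp_all add: eq)
  finally show ?thesis .
qed

text \<open>The affine map \<open>b + l\<close> matches the orbits of \<open>\<Delta>\<close> with
  those of \<open>D\<close>, and \<open>horo_pt 1\<close> carries these to the horosphere. A
  hypothesis about orbits suffices, as a diffeomorphism of quotients sees only these.\<close>

lemma diffeomorphic_cusp_cross_section:
  fixes \<Delta> :: "(nil_point \<Rightarrow> nil_point) set" and l l' :: "nil_point \<Rightarrow> nil_point"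
  assumes l: "bounded_linear l" "bounded_linear l'" "\<And>p. l (l' p) = p" "\<And>p. l' (l p) = p"
    and \<Delta>: "\<And>p q. (\<exists>g\<in>\<Delta>. q = g p) \<longleftrightarrow> (\<exists>(v, u, e)\<in>D. b + l q = nil_isometry v u e (b + l p))"
  shows "diffeomorphic_quotients (\<lambda>x. x) UNIV (isom_nil\<lparr>carrier := \<Delta>\<rparr>) affine_chart (range (horo_pt 1)) cusp_group"
proof -
  define \<Phi> where "\<Phi> p = b + l p" for p
  define \<Psi> where "\<Psi> p = l' (p - b)" for p
  interpret l': bounded_linear l' by (rule l(2))
  have inv: "\<Phi> (\<Psi> p) = p" "\<Psi> (\<Phi> p) = p" for p
    by (simp_all add: \<Phi>_def \<Psi>_def l(3,4))
  let ?G = "isom_nil\<lparr>carrier := \<Delta>\<rparr>"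
  let ?S = "range (horo_pt 1)"
  define F where "F Q = (\<lambda>p. horo_pt 1 (\<Phi> p)) ` Q" for Q
  have F_orbit: "F (orbit_of ?G p) = orbit_of cusp_group (horo_pt 1 (\<Phi> p))" for p
  proof (rule equalityI; rule subsetI)
    fix L assume "L \<in> F (orbit_of ?G p)"
    then obtain g where g: "g \<in> \<Delta>" "L = horo_pt 1 (\<Phi> (g p))" by (auto simp: F_def orbit_def)
    then obtain v u e where v: "(v, u, e) \<in> D" "\<Phi> (g p) = nil_isometry v u e (\<Phi> p)"
      using \<Delta>[of "g p" p] unfolding \<Phi>_def by blast
    then show "L \<in> orbit_of cusp_group (horo_pt 1 (\<Phi> p))" unfolding orbit_cusp_group g(2) v(2) by blast
  next
    fix L assume "L \<in> orbit_of cusp_group (horo_pt 1 (\<Phi> p))"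
    then obtain v u e where v: "(v, u, e) \<in> D" "L = horo_pt 1 (nil_isometry v u e (\<Phi> p))"
      unfolding orbit_cusp_group by blast
    define q where "q = \<Psi> (nil_isometry v u e (\<Phi> p))"
    have "\<Phi> q = nil_isometry v u e (\<Phi> p)" by (simp add: q_def inv)
    then obtain g where "g \<in> \<Delta>" "q = g p" using \<Delta>[of q p] v(1) unfolding \<Phi>_def by blast
    moreover have "L = horo_pt 1 (\<Phi> q)" by (simp add: q_def inv v(2))
    ultimately show "L \<in> F (orbit_of ?G p)" by (auto simp: F_def orbit_def)
  qed
  have inj: "inj (\<lambda>p. horo_pt 1 (\<Phi> p))" by (rule injI) (metis horo_pt_inj inv(2))
  have bij: "bij_betw F (orbit_space ?G UNIV) (orbit_space cusp_group ?S)"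
  proof (rule bij_betwI')
    show "F x = F y \<longleftrightarrow> x = y" for x y using inj unfolding F_def by (simp add: inj_image_eq_iff)
    show "F x \<in> orbit_space cusp_group ?S" if "x \<in> orbit_space ?G UNIV" for x
      using that F_orbit by (auto simp: orbits_def)
    show "\<exists>x\<in>orbit_space ?G UNIV. y = F x" if y: "y \<in> orbit_space cusp_group ?S" for y
    proof -
      obtain p where "y = orbit_of cusp_group (horo_pt 1 p)" using y unfolding orbits_def by blast
      then have "y = F (orbit_of ?G (\<Psi> p))" by (simp add: F_orbit inv)
      then show ?thesis unfolding orbits_def by blast
    qed
  qed
  show ?thesis
    unfolding diffeomorphic_quotients_def
  proof (intro exI conjI)
    show "bij_betw F (orbit_space ?G UNIV) (orbit_space cusp_group ?S)" by (rule bij)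
    show "smooth_between_quotients (\<lambda>x. x) UNIV ?G affine_chart ?S cusp_group F"
      unfolding smooth_between_quotients_def
    proof (intro ballI exI conjI impI)
      show "smooth_on UNIV (\<lambda>x. horo_chart (b + l x))" by (rule smooth_horo_chart_affine[OF l(1)])
      show "affine_chart (horo_pt 1 (\<Phi> y)) = horo_chart (b + l y)" for y by (simp add: horo_chart_chart \<Phi>_def)
      show "F (orbit_of ?G y) = orbit_of cusp_group (horo_pt 1 (\<Phi> y))" for y by (rule F_orbit)
    qed auto
    \<comment> \<open>The chart determines the Nil coordinate linearly: the base point is its second
      coordinate, the height twice the imaginary part of the first. The inverse thus extends to an
      affine map of the ambient space.\<close>
    define h where "h w = - l' b + l' (snd w, 2 * Im (fst w))" for w :: "complex \<times> complex"
    have h: "h (affine_chart (horo_pt 1 p)) = \<Psi> p" for p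
      by (cases p) (simp add: h_def horo_chart_chart horo_chart_def \<Psi>_def l'.diff Im_divide_numeral)
    show "smooth_between_quotients affine_chart ?S cusp_group (\<lambda>x. x) UNIV ?G (inv_into (orbit_space ?G UNIV) F)"
      unfolding smooth_between_quotients_def
    proof (intro ballI exI conjI impI)
      have "bounded_linear (\<lambda>w :: complex \<times> complex. (snd w, 2 * Im (fst w)))"
        by (intro bounded_linear_Pair bounded_linear_snd bounded_linear_compose[OF bounded_linear_mult_right]
            bounded_linear_compose[OF bounded_linear_Im] bounded_linear_fst)
      then show "smooth_on UNIV h"
        unfolding h_def by (intro smooth_on_affine bounded_linear_compose[OF l(2)])
      fix y assume "y \<in> ?S"
      then obtain p where p: "y = horo_pt 1 p" by blast
      show "inv_into (orbit_space ?G UNIV) F (orbit_of cusp_group y) = orbit_of ?G (h (affine_chart y))"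
      proof -
        have "orbit_of cusp_group y = F (orbit_of ?G (\<Psi> p))" by (simp add: F_orbit inv p)
        moreover have "orbit_of ?G (\<Psi> p) \<in> orbit_space ?G UNIV" unfolding orbits_def by blast
        ultimately show ?thesis unfolding p h using bij_betw_imp_inj_on[OF bij] by (simp add: inv_into_f_f)
      qed
    qed auto
  qed
qed

theorem occurs_if_conjugate:
  fixes \<Delta> :: "(nil_point \<Rightarrow> nil_point) set" and l l' :: "nil_point \<Rightarrow> nil_point"
  assumes "squarefree d" "bounded_linear l" "bounded_linear l'" "\<And>p. l (l' p) = p" "\<And>p. l' (l p) = p"
    and "\<And>p q. (\<exists>g\<in>\<Delta>. q = g p) \<longleftrightarrow> (\<exists>(v, u, e)\<in>D. b + l q = nil_isometry v u e (b + l p))"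
  shows "occurs_as_cusp_cross_section \<Delta> d"
  unfolding occurs_as_cusp_cross_section_def
  using subgroup_cong_group torsion_free_cong_group discrete_cong_group commensurable_cong_group[OF assms(1)] cusp_point_cong_group
    horosphere_horo_pt diffeomorphic_cusp_cross_section[OF assms(2-6)] unfolding cusp_group_def by blast

end

section \<open>Translation parts of Nil manifold groups\<close>

text \<open>The map induced by a Nil isometry on the base plane of the fibration \<open>(z, t) \<mapsto> z\<close>.\<close>

definition plane :: "(nil_point \<Rightarrow> nil_point) \<Rightarrow> complex \<Rightarrow> complex" where
  "plane g z = fst (g (z, 0))"

lemma plane_nil_isometry: "plane (nil_isometry v u e) z = fst v + u * cnj_if e z"
  by (simp add: plane_def nil_isometry_apply)

lemma fst_nil_isom: "g \<in> nil_isoms \<Longrightarrow> fst (g p) = plane g (fst p)"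
  by (cases p) (auto simp: nil_isoms_def plane_nil_isometry nil_isometry_apply)

lemma plane_comp: "g \<in> nil_isoms \<Longrightarrow> plane (g \<circ> h) z = plane g (plane h z)"
  using fst_nil_isom[of g "h (z, 0)"] by (simp add: plane_def)

lemma plane_dist: "g \<in> nil_isoms \<Longrightarrow> cmod (plane g z - plane g w) = cmod (z - w)"
proof -
  assume "g \<in> nil_isoms"
  then obtain v u e where g: "g = nil_isometry v u e" "cmod u = 1" by (auto simp: nil_isoms_def)
  have "plane g z - plane g w = u * cnj_if e (z - w)" by (simp add: g plane_nil_isometry algebra_simps)
  then show ?thesis by (simp only: norm_mult g(2) cnj_if_simps(12) mult_1)
qed

lemma plane_id [simp]: "plane id z = z"
  by (simp add: plane_def)

text \<open>The displacement grows linearly along the multiples of any vector that the linear part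
  moves; testing 1 and i gives \<open>u = 1\<close> and excludes conjugation.\<close>

lemma bounded_displacement:
  assumes "g \<in> nil_isoms" "\<And>z. cmod (plane g z - z) \<le> M"
  obtains v where "g = nil_isometry v 1 False"
proof -
  obtain v u e where g: "g = nil_isometry v u e" "cmod u = 1" using assms(1) by (auto simp: nil_isoms_def)
  have bnd: "cmod (u * cnj_if e z - z) \<le> M + cmod (fst v)" for z
  proof -
    have "u * cnj_if e z - z = (plane g z - z) - fst v" by (simp add: g plane_nil_isometry)
    then have "cmod (u * cnj_if e z - z) \<le> cmod (plane g z - z) + cmod (fst v)"
      using norm_triangle_ineq4 by metis
    then show ?thesis using assms(2)[of z] by linarith
  qed
  have zero: "u * cnj_if e w = w" for w
  proof (rule ccontr)
    assume "u * cnj_if e w \<noteq> w"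
    then have pos: "cmod (u * cnj_if e w - w) > 0" by simp
    obtain n :: nat where n: "M + cmod (fst v) < real n * cmod (u * cnj_if e w - w)"
      using reals_Archimedean3[OF pos] by blast
    have "u * cnj_if e (of_real (real n) * w) - of_real (real n) * w = of_real (real n) * (u * cnj_if e w - w)"
      by (simp only: cnj_if_simps) (simp add: algebra_simps)
    then have "cmod (u * cnj_if e (of_real (real n) * w) - of_real (real n) * w) = real n * cmod (u * cnj_if e w - w)"
      by (simp add: norm_mult)
    then show False using bnd[of "of_real (real n) * w"] n by simp
  qed
  have "u = 1" using zero[of 1] by simp
  moreover have "\<not> e" using zero[of \<i>] \<open>u = 1\<close> by (cases e) auto
  ultimately show thesis using that g by auto
qed

locale nil_group =
  fixes \<Delta> :: "(nil_point \<Rightarrow> nil_point) set" and X :: "nil_gen set" and g :: "nil_gen \<Rightarrow> bool \<Rightarrow> nil_point \<Rightarrow> nil_point"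
  assumes manifold: "nil_manifold_group \<Delta>"
    and gens: "\<Delta> = act g ` lists (X \<times> UNIV)"
    and gen_in: "x \<in> X \<Longrightarrow> g x e \<in> \<Delta>"
    and gen_inv: "x \<in> X \<Longrightarrow> g x e \<circ> g x (\<not> e) = id"
begin

lemma subgroup: "subgroup \<Delta> isom_nil"
  using manifold by (simp add: nil_manifold_group_def)

lemma Delta_isoms: "h \<in> \<Delta> \<Longrightarrow> h \<in> nil_isoms"
  using subgroup_isom_nil(1)[OF subgroup] by blast

lemma invariant_act:
  assumes "\<And>x p. x \<in> X \<Longrightarrow> f (g x False p) = f p" "h \<in> \<Delta>"
  shows "f (h p) = f p"
proof -
  have gen: "f (g x e p) = f p" if "x \<in> X" for x e p
  proof (cases e)
    case True
    have "g x False (g x True p) = p" using fun_cong[OF gen_inv[OF that, of False], of p] by simp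
    then show ?thesis using assms(1)[OF that, of "g x True p"] True by simp
  qed (use assms(1)[OF that] in simp)
  have "f (act g w p) = f p" if "w \<in> lists (X \<times> UNIV)" for w
    using that by (induction w arbitrary: p) (auto simp: gen)
  then show ?thesis using assms(2) gens by auto
qed

lemma invariant_gen_bounded:
  assumes "continuous_on UNIV f" "\<And>x p. x \<in> X \<Longrightarrow> f (g x False p) = (f p :: real)"
  obtains M where "\<And>p. \<bar>f p\<bar> \<le> M"
proof (rule invariant_bounded[OF manifold assms(1)])
  show "f (h p) = f p" if "h \<in> \<Delta>" for h p using invariant_act[of f, OF assms(2) that] .
qed (use that in blast)

text \<open>An element that is normalised up to inversion by all generators has an invariant displacement
  function, which is bounded by cocompactness.\<close>

lemma translation_if_normalised:
  assumes h: "h \<in> \<Delta>" "h' \<in> \<Delta>" "h \<circ> h' = id"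
    and comm: "\<And>x. x \<in> X \<Longrightarrow> (\<forall>z. plane (g x False) (plane h z) = plane h (plane (g x False) z)) \<or>
        (\<forall>z. plane (g x False) (plane h z) = plane h' (plane (g x False) z))"
  obtains v where "h = nil_isometry v 1 False"
proof -
  have hi: "h \<in> nil_isoms" "h' \<in> nil_isoms" using h Delta_isoms by auto
  have hh: "plane h (plane h' z) = z" for z
    using plane_comp[OF hi(1), of h' z] h(3) by simp
  have h'h: "plane h' (plane h z) = z" for z
  proof -
    have "cmod (plane h (plane h' (plane h z)) - plane h z) = cmod (plane h' (plane h z) - z)"
      by (rule plane_dist[OF hi(1)])
    then show ?thesis using hh by simp
  qed
  define f where "f p = cmod (fst (h p) - fst p)" for p :: nil_point
  have f: "f p = cmod (plane h (fst p) - fst p)" for p by (simp add: f_def fst_nil_isom[OF hi(1)])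
  obtain v u e where h_eq: "h = nil_isometry v u e" using hi(1) by (auto simp: nil_isoms_def)
  have "continuous_on UNIV h" unfolding h_eq by (rule continuous_nil_isometry)
  then have "continuous_on UNIV f"
    unfolding f_def by (intro continuous_intros)
  moreover have "f (g x False p) = f p" if x: "x \<in> X" for x p
  proof -
    let ?s = "plane (g x False)"
    have si: "g x False \<in> nil_isoms" using gen_in[OF x] Delta_isoms by blast
    have 1: "f (g x False p) = cmod (plane h (?s (fst p)) - ?s (fst p))"
      by (simp add: f fst_nil_isom[OF si])
    from comm[OF x] show ?thesis
    proof
      assume "\<forall>z. ?s (plane h z) = plane h (?s z)"
      then have "plane h (?s z) = ?s (plane h z)" for z by simp
      then show ?thesis using 1 f[of p] plane_dist[OF si, of "plane h (fst p)" "fst p"] by simp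
    next
      \<comment> \<open>An inverting generator turns the displacement of \<open>h\<close> into that
        of \<open>h'\<close>, which equals that of \<open>h\<close> at the same point because
        \<open>h\<close> acts isometrically.\<close>
      assume *: "\<forall>z. ?s (plane h z) = plane h' (?s z)"
      have "?s z = plane h' (?s (plane h' z))" for z
        using *[rule_format, of "plane h' z"] by (simp only: hh)
      then have "plane h (?s z) = plane h (plane h' (?s (plane h' z)))" for z by (rule arg_cong)
      then have "plane h (?s z) = ?s (plane h' z)" for z by (simp only: hh)
      then have "f (g x False p) = cmod (plane h' (fst p) - fst p)" unfolding 1 by (simp only: plane_dist[OF si])
      also have "\<dots> = cmod (plane h (plane h' (fst p)) - plane h (fst p))" by (rule plane_dist[OF hi(1), symmetric])
      also have "\<dots> = f p" unfolding hh f by (rule norm_minus_commute)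
      finally show ?thesis .
    qed
  qed
  ultimately obtain M where "\<And>p. \<bar>f p\<bar> \<le> M" using invariant_gen_bounded by metis
  then have "cmod (plane h z - z) \<le> M" for z
    using f[of "(z, 0)"] by (metis abs_norm_cancel fst_conv)
  then show thesis using bounded_displacement[OF hi(1)] that by metis
qed

lemma inv_gen: "x \<in> X \<Longrightarrow> g x True \<circ> g x False = id" "x \<in> X \<Longrightarrow> g x False \<circ> g x True = id"
  using gen_inv[of x True] gen_inv[of x False] by simp_all

lemma plane_gen_comp:
  assumes "x \<in> X" "g x e \<circ> h = f \<circ> k" "f \<in> \<Delta>"
  shows "plane (g x e) (plane h z) = plane f (plane k z)"
  using assms plane_comp[of "g x e" h z] plane_comp[of f k z] gen_in Delta_isoms by simp

text \<open>Every generator commutes with \<open>c\<close> or inverts it, so \<open>c\<close>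
  translates the plane by some \<open>w\<close>. The commutator relation forces
  \<open>w = 0\<close>; then powers of \<open>c\<close> are invisible in the plane, so
  \<open>a\<close> and \<open>b\<close> are normalised there up to inversion and are translations
  too. Comparing heights at the origin gives the area relation.\<close>

theorem lattice_generators:
  assumes X: "Ga \<in> X" "Gb \<in> X" "Gc \<in> X" and K: "K > 0"
    and C1: "g Gc False \<noteq> id"
    and CA: "g Gc False \<circ> g Ga False = g Ga False \<circ> g Gc False"
    and CB: "g Gc False \<circ> g Gb False = g Gb False \<circ> g Gc False"
    and BA: "g Gb False \<circ> g Ga False = (g Gc False ^^ K) \<circ> g Ga False \<circ> g Gb False"
    and normC: "\<And>x. x \<in> X \<Longrightarrow> \<exists>f. g x False \<circ> g Gc False = g Gc f \<circ> g x False"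
    and normA: "\<And>x. x \<in> X \<Longrightarrow> \<exists>f e j. g x False \<circ> g Ga False = g Ga f \<circ> g x False \<circ> (g Gc e ^^ j)"
    and normB: "\<And>x. x \<in> X \<Longrightarrow> \<exists>f e j. g x False \<circ> g Gb False = g Gb f \<circ> g x False \<circ> (g Gc e ^^ j)"
  obtains z1 t1 z2 t2 t3 where "g Ga False = nil_isometry (z1, t1) 1 False"
    "g Gb False = nil_isometry (z2, t2) 1 False" "g Gc False = nil_isometry (0, t3) 1 False"
    "t3 \<noteq> 0" "4 * Im (z2 * cnj z1) = real K * t3"
proof -
  let ?A = "g Ga False" and ?B = "g Gb False" and ?C = "g Gc False"
  have isom: "g x e \<in> nil_isoms" if "x \<in> X" for x e using gen_in[OF that] Delta_isoms by blast
  have id_isom: "id \<in> nil_isoms" using subgroup_isom_nil(2)[OF subgroup] Delta_isoms by blast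
  have "(\<forall>z. plane (g x False) (plane ?C z) = plane ?C (plane (g x False) z)) \<or>
        (\<forall>z. plane (g x False) (plane ?C z) = plane (g Gc True) (plane (g x False) z))" if x: "x \<in> X" for x
  proof -
    obtain f where "g x False \<circ> ?C = g Gc f \<circ> g x False" using normC[OF x] by blast
    then have "plane (g x False) (plane ?C z) = plane (g Gc f) (plane (g x False) z)" for z
      using plane_gen_comp[OF x _ gen_in[OF X(3)]] by blast
    then show ?thesis by (cases f) auto
  qed
  then obtain v where v: "?C = nil_isometry v 1 False"
    using translation_if_normalised[OF gen_in[OF X(3)] gen_in[OF X(3)] inv_gen(2)[OF X(3)]] by metis
  define w where "w = fst v"
  have pC: "plane ?C z = w + z" for z by (simp add: v plane_nil_isometry w_def)
  have Cn: "?C ^^ n \<in> nil_isoms \<and> plane (?C ^^ n) z = of_nat n * w + z" for n z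
  proof (induction n)
    case 0
    show ?case by (simp only: funpow.simps(1) id_isom plane_id simp_thms of_nat_0 mult_zero_left add_0)
  next
    case (Suc n)
    then show ?case
      unfolding funpow.simps(2) plane_comp[OF isom[OF X(3)]] pC
      using nil_isoms_comp[OF isom[OF X(3)], of "?C ^^ n" False] by (simp only: simp_thms) (simp add: algebra_simps)
  qed
  \<comment> \<open>A map commuting with \<open>c\<close> has a linear part that fixes
    \<open>w\<close>, so it shifts the coordinate along \<open>w\<close> by a constant.\<close>
  have char: "Re (cnj w * plane h z) = Re (cnj w * plane h 0) + Re (cnj w * z)"
    if h: "h \<in> nil_isoms" "?C \<circ> h = h \<circ> ?C" for h z
  proof -
    obtain a u e where hu: "h = nil_isometry a u e" "cmod u = 1" using h(1) by (auto simp: nil_isoms_def)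
    have "plane ?C (plane h 0) = plane h (plane ?C 0)"
      using h plane_comp[OF isom[OF X(3)], of False h 0] plane_comp[OF h(1), of ?C 0] by simp
    then have uw: "u * cnj_if e w = w" by (simp add: pC hu plane_nil_isometry)
    have uu: "cnj u * u = 1" using hu(2) complex_norm_square[of u] by (simp add: mult.commute)
    have "cnj w * (u * cnj_if e z) = cnj (u * cnj_if e w) * (u * cnj_if e z)" by (simp only: uw)
    also have "\<dots> = (cnj u * u) * cnj_if e (cnj w * z)" by (simp add: ac_simps)
    finally have "cnj w * (u * cnj_if e z) = cnj_if e (cnj w * z)" unfolding uu mult_1 .
    then have "Re (cnj w * (u * cnj_if e z)) = Re (cnj_if e (cnj w * z))" by (rule arg_cong)
    then have "Re (cnj w * (u * cnj_if e z)) = Re (cnj w * z)" by (simp only: cnj_if_simps(13))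
    then show ?thesis by (simp only: hu plane_nil_isometry cnj_if_simps distrib_left plus_complex.simps) simp
  qed
  have "w = 0"
  proof (rule ccontr)
    assume "w \<noteq> 0"
    have c: "Re (cnj w * plane ?A z) = Re (cnj w * plane ?A 0) + Re (cnj w * z)"
      "Re (cnj w * plane ?B z) = Re (cnj w * plane ?B 0) + Re (cnj w * z)" for z
      using char isom X CA CB by metis+
    \<comment> \<open>Along \<open>w\<close> the shifts of \<open>a\<close> and \<open>b\<close>
      cancel from the commutator relation, which leaves \<open>K |w|^2 = 0\<close>.\<close>
    have "plane (?B \<circ> ?A) 0 = plane (?C ^^ K \<circ> ?A \<circ> ?B) 0" using BA by simp
    then have "plane ?B (plane ?A 0) = of_nat K * w + plane ?A (plane ?B 0)"
      using Cn isom X by (simp add: plane_comp nil_isoms_comp)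
    then have "Re (cnj w * plane ?B (plane ?A 0)) = Re (cnj w * (of_nat K * w)) + Re (cnj w * plane ?A (plane ?B 0))"
      by (simp only: distrib_left plus_complex.simps)
    then have "Re (cnj w * (of_nat K * w)) = 0" using c(1)[of "plane ?B 0"] c(2)[of "plane ?A 0"] by linarith
    then have "real K * ((Re w)\<^sup>2 + (Im w)\<^sup>2) = 0" by (simp add: power2_eq_square algebra_simps)
    then show False using K \<open>w \<noteq> 0\<close> by (simp add: complex_eq_iff sum_power2_eq_zero_iff)
  qed
  then obtain t3 where C: "?C = nil_isometry (0, t3) 1 False" using v by (cases v) (auto simp: w_def)
  have t3: "t3 \<noteq> 0"
  proof
    assume "t3 = 0"
    then show False using C C1 nil_isometry_id by (simp add: zero_prod_def)
  qed
  have CI: "g Gc e \<in> nil_isoms \<and> plane (g Gc e) z = z" for e z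
  proof (cases e)
    case True
    have "plane (g Gc False) (plane (g Gc True) z) = z"
      using plane_comp[OF isom[OF X(3)], of False "g Gc True" z] inv_gen(2)[OF X(3)] by simp
    then show ?thesis using True isom[OF X(3)] pC \<open>w = 0\<close> by simp
  qed (use isom[OF X(3)] pC \<open>w = 0\<close> in simp)
  have CIn: "g Gc e ^^ n \<in> nil_isoms \<and> plane (g Gc e ^^ n) z = z" for e n z
  proof (induction n)
    case 0
    show ?case by (simp only: funpow.simps(1) id_isom plane_id simp_thms of_nat_0 mult_zero_left add_0)
  next
    case (Suc n)
    have ci: "g Gc e \<in> nil_isoms" "\<And>z. plane (g Gc e) z = z" using CI by blast+
    from Suc show ?case
      unfolding funpow.simps(2) plane_comp[OF ci(1)] ci(2)
      using nil_isoms_comp[OF ci(1), of "g Gc e ^^ n"] by (simp only: simp_thms)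
  qed
  have trans: "\<exists>v. g y False = nil_isometry v 1 False"
    if y: "y \<in> X" and norm: "\<And>x. x \<in> X \<Longrightarrow> \<exists>f e j. g x False \<circ> g y False = g y f \<circ> g x False \<circ> (g Gc e ^^ j)" for y
  proof -
    have "(\<forall>z. plane (g x False) (plane (g y False) z) = plane (g y False) (plane (g x False) z)) \<or>
        (\<forall>z. plane (g x False) (plane (g y False) z) = plane (g y True) (plane (g x False) z))" if x: "x \<in> X" for x
    proof -
      obtain f e j where *: "g x False \<circ> g y False = g y f \<circ> g x False \<circ> (g Gc e ^^ j)" using norm[OF x] by blast
      have "plane (g x False) (plane (g y False) z) = plane (g y f) (plane (g x False) z)" for z
      proof -
        have "plane (g x False \<circ> g y False) z = plane (g y f \<circ> g x False \<circ> (g Gc e ^^ j)) z" using * by simp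
        then show ?thesis using CIn isom[OF x] isom[OF y] by (simp add: plane_comp nil_isoms_comp)
      qed
      then show ?thesis by (cases f) auto
    qed
    then show ?thesis
      using translation_if_normalised[OF gen_in[OF y] gen_in[OF y] inv_gen(2)[OF y]] by metis
  qed
  obtain z1 t1 where A: "?A = nil_isometry (z1, t1) 1 False" using trans[OF X(1) normA] by auto
  obtain z2 t2 where B: "?B = nil_isometry (z2, t2) 1 False" using trans[OF X(2) normB] by auto
  have Cp: "(?C ^^ n) (z, t) = (z, t + real n * t3)" for n z t
    by (induction n) (simp_all add: C nil_isometry_apply neg_if_def algebra_simps)
  have "(?B \<circ> ?A) (0, 0) = (?C ^^ K \<circ> ?A \<circ> ?B) (0, 0)" using BA by simp
  then have "t2 + t1 + 2 * Im (z2 * cnj z1) = t1 + t2 + 2 * Im (z1 * cnj z2) + real K * t3"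
    by (simp add: A B Cp nil_isometry_apply neg_if_def)
  then have "4 * Im (z2 * cnj z1) = real K * t3" by simp
  then show thesis using that A B C t3 by blast
qed

end

section \<open>Integer coordinates for the cusp groups\<close>

text \<open>The coordinates \<open>(i, j, m, s, e)\<close> stand for the isometry with translation part
  \<open>(n (i + j \<surd>-d), w m)\<close>, rotation part \<open>s = \<plusminus>1\<close> and flag \<open>e\<close>; the generators \<open>a\<close>, \<open>b\<close>, \<open>c\<close> of the
  lattice become \<open>i = 2\<close>, \<open>j = 2\<close>, \<open>m = 8\<close>. The unit \<open>w\<close> of height makes the commutators integral, since
  \<open>2 n\<^sup>2 \<surd>d = K w\<close> where \<open>[b, a] = c\<^sup>K\<close>. The factor 6 in \<open>n\<close> makes all matrices diagonal modulo 3, and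
  the congruence modulus \<open>576 k\<close> has enough factors of 2 to separate the odd multiples occurring in the
  squares of the half-turns from 0.\<close>

type_synonym coords = "int \<times> int \<times> int \<times> int \<times> bool"

definition sgn_of :: "bool \<Rightarrow> int" where
  "sgn_of e = (if e then - 1 else 1)"

lemma sgn_of_simps [simp]: "sgn_of False = 1" "sgn_of True = - 1" "sgn_of e * sgn_of e = 1"
  by (simp_all add: sgn_of_def)

locale cusp_coords =
  fixes d k K :: nat
  assumes d: "d \<ge> 1" and k: "k > 0" and K: "K = k \<or> K = 2 * k"
begin

definition n :: real where "n = 6 * real k"
definition r :: real where "r = sqrt (real d)"
definition w :: real where "w = 2 * n\<^sup>2 * r / real K"

lemma pos: "n > 0" "r > 0" "w > 0" "real K > 0"
  using d k K by (auto simp: n_def r_def w_def)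

lemma nnr: "2 * n * n * r = real K * w"
  using pos by (simp add: w_def power2_eq_square)

definition vec_of :: "int \<Rightarrow> int \<Rightarrow> int \<Rightarrow> nil_point" where
  "vec_of i j m = (Complex (n * of_int i) (n * r * of_int j), w * of_int m)"

fun embed :: "coords \<Rightarrow> nil_point \<times> complex \<times> bool" where
  "embed (i, j, m, s, e) = (vec_of i j m, of_int s, e)"

text \<open>Composition of isometries in integer coordinates; the term with \<open>K\<close> is the
  Heisenberg cocycle in units of \<open>w\<close>.\<close>

fun cmult :: "coords \<Rightarrow> coords \<Rightarrow> coords" where
  "cmult (i, j, m, s, e) (i', j', m', s', e') =
    (i + s * i', j + s * sgn_of e * j', m + sgn_of e * m' + int K * (j * s * i' - i * s * sgn_of e * j'), s * s', e \<noteq> e')"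

fun cinv :: "coords \<Rightarrow> coords" where
  "cinv (i, j, m, s, e) = (- s * i, - s * sgn_of e * j, - sgn_of e * m, s, e)"

fun cisom :: "coords \<Rightarrow> nil_point \<Rightarrow> nil_point" where
  "cisom (i, j, m, s, e) = nil_isometry (vec_of i j m) (of_int s) e"

lemma vec_of_inj: "vec_of i j m = vec_of i' j' m' \<longleftrightarrow> i = i' \<and> j = j' \<and> m = m'"
  using pos by (auto simp: vec_of_def)

lemma nil_isometry_vec_of:
  assumes "s = 1 \<or> s = - 1"
  shows "nil_isometry (vec_of i j m) (of_int s) e (vec_of i' j' m') =
    vec_of (i + s * i') (j + s * sgn_of e * j') (m + sgn_of e * m' + int K * (j * s * i' - i * s * sgn_of e * j'))"
proof -
  have im: "2 * Im (Complex (n * x) (n * r * y) * cnj (Complex (n * x') (n * r * y'))) = w * (real K * (y * x' - x * y'))"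
    for x y x' y'
  proof -
    have "2 * Im (Complex (n * x) (n * r * y) * cnj (Complex (n * x') (n * r * y'))) = (2 * n * n * r) * (y * x' - x * y')"
      by (simp add: algebra_simps)
    then show ?thesis unfolding nnr by (simp only: ac_simps)
  qed
  have c: "of_int s * cnj_if e (Complex (n * of_int i') (n * r * of_int j')) =
      Complex (n * of_int (s * i')) (n * r * of_int (s * sgn_of e * j'))"
    by (cases e) (simp_all add: complex_eq_iff)
  show ?thesis
    unfolding vec_of_def nil_isometry_apply fst_conv snd_conv c im
    by (cases e) (simp_all add: complex_eq_iff neg_if_def algebra_simps)
qed

lemma cisom_cmult:
  assumes "s = 1 \<or> s = - 1"
  shows "cisom (cmult (i, j, m, s, e) y) = cisom (i, j, m, s, e) \<circ> cisom y"
proof -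
  obtain i' j' m' s' e' where y: "y = (i', j', m', s', e')" by (cases y) auto
  have "cmod (of_int s) = 1" "cnj_if e (of_int s') = of_int s'"
    using assms by (auto simp: cnj_if_def)
  then show ?thesis
    unfolding y cmult.simps cisom.simps by (simp only: nil_isometry_comp nil_isometry_vec_of[OF assms] of_int_mult)
qed

lemma cinv_vec:
  assumes "s = 1 \<or> s = - 1"
  shows "nil_isometry 0 (of_int s) e (- fst (vec_of i j m), - snd (vec_of i j m)) = vec_of (- s * i) (- s * sgn_of e * j) (- sgn_of e * m)"
  using assms by (cases e) (auto simp: vec_of_def nil_isometry_apply neg_if_def complex_eq_iff)

lemma cusp_mat_vec_of_int:
  assumes "s = 1 \<or> s = - 1"
  shows "int_mat d (cusp_mat (vec_of i j m) (of_int s))" "cong_mat d 3 (cusp_mat (vec_of i j m) (of_int s)) (cusp_mat 0 (of_int s))"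
proof -
  define z where "z = fst (vec_of i j m)"
  have z: "z \<in> quad_mult d 3"
    unfolding quad_mult_iff z_def vec_of_def n_def r_def
    by (rule exI[of _ "2 * int k * i"], rule exI[of _ "2 * int k * j"]) simp
  have w2: "w / 2 = 36 * (real k * real k) * r / real K" by (simp add: w_def n_def power2_eq_square)
  \<comment> \<open>Half the unit of height is \<open>36 k r\<close> or \<open>18 k r\<close>,
    according to the value of \<open>K\<close>; both are multiples of \<open>3 r\<close>.\<close>
  obtain q :: int where q: "w / 2 = of_int (3 * q) * r"
  proof (cases "K = k")
    case True
    then have "w / 2 = of_int (3 * (12 * int k)) * r" using w2 k by (simp add: field_simps)
    then show ?thesis by (rule that)
  next
    case False
    then have "w / 2 = of_int (3 * (6 * int k)) * r" using w2 k K by (simp add: field_simps)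
    then show ?thesis by (rule that)
  qed
  have e13: "cusp_mat (vec_of i j m) (of_int s) $ 1 $ 3 \<in> quad_mult d 3"
    unfolding quad_mult_iff
  proof (intro exI conjI)
    have "(cmod (fst (vec_of i j m)))\<^sup>2 = 36 * (real k)\<^sup>2 * ((of_int i)\<^sup>2 + real d * (of_int j)\<^sup>2)"
      unfolding cmod_power2 by (simp add: vec_of_def n_def r_def power_mult_distrib algebra_simps)
    then show "Re (cusp_mat (vec_of i j m) (of_int s) $ 1 $ 3) = of_int (3 * (- 6 * (int k)\<^sup>2 * (i\<^sup>2 + int d * j\<^sup>2)))"
      by (simp add: Re_divide_numeral)
    have "Im (cusp_mat (vec_of i j m) (of_int s) $ 1 $ 3) = w / 2 * of_int m"
      by (simp add: vec_of_def Im_divide_numeral)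
    then show "Im (cusp_mat (vec_of i j m) (of_int s) $ 1 $ 3) = of_int (3 * (q * m)) * sqrt (real d)"
      by (simp add: q r_def)
  qed
  have s: "of_int s \<in> quad_ints d" by simp
  have e12: "cusp_mat (vec_of i j m) (of_int s) $ 1 $ 2 \<in> quad_mult d 3"
    using quad_mult_mult_right[OF quad_mult_minus[OF quad_mult_cnj[OF z]] s] by (simp add: z_def)
  show c: "cong_mat d 3 (cusp_mat (vec_of i j m) (of_int s)) (cusp_mat 0 (of_int s))"
    unfolding cong_mat_def forall_3 using e12 e13 z by (simp add: z_def)
  have "int_mat d (cusp_mat 0 (of_int s))" by (simp add: int_mat_def forall_3)
  then show "int_mat d (cusp_mat (vec_of i j m) (of_int s))" by (rule cong_mat_int_mat[OF c])
qed

text \<open>Since \<open>n = 6 k\<close>, base coordinates divisible by \<open>576 k\<close> are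
  multiples of 96 units. The height is twice the imaginary part of the entry (1, 3), and
  \<open>1152 k r\<close> is 16 or 32 units \<open>w\<close>.\<close>

lemma cusp_mat_cong_1:
  assumes "cong_mat d (576 * int k) (cusp_mat v 1) (mat 1)"
  obtains x y m where "v = vec_of (96 * x) (96 * y) (16 * m)"
proof -
  have "cusp_mat v 1 $ 2 $ 3 - (mat 1 :: complex^3^3) $ 2 $ 3 \<in> quad_mult d (576 * int k)"
    "cusp_mat v 1 $ 1 $ 3 - (mat 1 :: complex^3^3) $ 1 $ 3 \<in> quad_mult d (576 * int k)"
    using assms unfolding cong_mat_def by blast+
  then have 1: "fst v \<in> quad_mult d (576 * int k)" and 2: "cusp_mat v 1 $ 1 $ 3 \<in> quad_mult d (576 * int k)"
    by (simp_all add: mat_def)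
  obtain x y where xy: "Re (fst v) = of_int (576 * int k * x)" "Im (fst v) = of_int (576 * int k * y) * sqrt (real d)"
    using 1 unfolding quad_mult_iff by blast
  obtain m where m: "Im (cusp_mat v 1 $ 1 $ 3) = of_int (576 * int k * m) * sqrt (real d)"
    using 2 unfolding quad_mult_iff by blast
  have "snd v = 2 * Im (cusp_mat v 1 $ 1 $ 3)" by (simp add: Im_divide_numeral)
  then have sv: "snd v = 1152 * real k * of_int m * r" unfolding m by (simp add: r_def)
  have kw: "\<exists>q::int. 1152 * real k * r = w * of_int (16 * q)"
  proof (cases "K = k")
    case True
    then have "1152 * real k * r = w * of_int (16 * 1)" unfolding w_def n_def using k by (simp add: power2_eq_square field_simps)
    then show ?thesis by blast
  next
    case False
    then have "1152 * real k * r = w * of_int (16 * 2)" unfolding w_def n_def using k K by (simp add: power2_eq_square field_simps)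
    then show ?thesis by blast
  qed
  then obtain q :: int where q: "1152 * real k * r = w * of_int (16 * q)" by blast
  have "snd v = (1152 * real k * r) * of_int m" using sv by simp
  then have "snd v = w * of_int (16 * (q * m))" unfolding q by simp
  then have "v = vec_of (96 * x) (96 * y) (16 * (q * m))"
    using xy by (simp add: vec_of_def prod_eq_iff complex_eq_iff n_def r_def)
  then show thesis by (rule that)
qed

end

text \<open>\<open>S_type\<close> records a residue that survives squaring: the squares of the three
  kinds of nontranslations have a coordinate \<open>2 m\<close>, \<open>2 i\<close> or
  \<open>2 j\<close> that is 8 modulo 16 or 2 modulo 4. \<open>S_deep\<close> supplies all
  translations congruent to 1 modulo \<open>576 k\<close>.\<close>

locale coord_group = cusp_coords +
  fixes S :: "coords set"
  assumes S_cmult: "x \<in> S \<Longrightarrow> y \<in> S \<Longrightarrow> cmult x y \<in> S"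
    and S_cinv: "x \<in> S \<Longrightarrow> cinv x \<in> S"
    and S_type: "(i, j, m, s, e) \<in> S \<Longrightarrow>
      s = 1 \<and> \<not> e \<or> s = - 1 \<and> \<not> e \<and> m mod 8 = 4 \<or> s = 1 \<and> e \<and> odd i \<or> s = - 1 \<and> e \<and> odd j"
    and S_deep: "(8 * i, 8 * j, 8 * m, 1, False) \<in> S"
begin

lemma S_unit: "(i, j, m, s, e) \<in> S \<Longrightarrow> s = 1 \<or> s = - 1"
  using S_type by blast

sublocale cd: cusp_data d "576 * int k" "embed ` S"
proof
  show "1 \<le> d" by (rule d)
  show "0 < 576 * int k" using k by simp
  show "3 dvd 576 * int k" by simp
next
  fix v u e assume "(v, u, e) \<in> embed ` S"
  then obtain i j m s where 1: "v = vec_of i j m" "u = of_int s" "(i, j, m, s, e) \<in> S" by auto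
  note s = S_unit[OF 1(3)]
  show "u = 1 \<or> u = - 1" using s 1 by auto
  show "int_mat d (cusp_mat v u)" "cong_mat d 3 (cusp_mat v u) (cusp_mat 0 u)"
    unfolding 1 by (rule cusp_mat_vec_of_int[OF s])+
  have "embed (cinv (i, j, m, s, e)) \<in> embed ` S" using S_cinv[OF 1(3)] by (rule imageI)
  then show "(nil_isometry 0 u e (- fst v, - snd v), u, e) \<in> embed ` S"
    unfolding 1 cinv_vec[OF s] by simp
  show "u = 1 \<and> \<not> e" if c: "cong_mat d (576 * int k) (cusp_mat (nil_isometry v u e v) 1) (mat 1)"
  proof -
    obtain x y m' where eq: "nil_isometry v u e v = vec_of (96 * x) (96 * y) (16 * m')"
      using cusp_mat_cong_1[OF c] by blast
    then have eqs: "i + s * i = 96 * x" "j + s * sgn_of e * j = 96 * y"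
      "m + sgn_of e * m + int K * (j * s * i - i * s * sgn_of e * j) = 16 * m'"
      unfolding 1 nil_isometry_vec_of[OF s] vec_of_inj by auto
    from S_type[OF 1(3)] show ?thesis
    proof (elim disjE conjE)
      assume "s = - 1" "\<not> e" "m mod 8 = 4"
      then have "2 * m = 16 * m'" using eqs(3) by simp
      then show ?thesis using \<open>m mod 8 = 4\<close> by presburger
    next
      assume "s = 1" "e" "odd i"
      then have "2 * i = 96 * x" using eqs(1) by simp
      then show ?thesis using \<open>odd i\<close> by presburger
    next
      assume "s = - 1" "e" "odd j"
      then have "2 * j = 96 * y" using eqs(2) by simp
      then show ?thesis using \<open>odd j\<close> by presburger
    qed (use 1 in simp)
  qed
  fix v' u' e' assume "(v', u', e') \<in> embed ` S"
  then obtain i' j' m' s' where 2: "v' = vec_of i' j' m'" "u' = of_int s'" "(i', j', m', s', e') \<in> S" by auto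
  have "embed (cmult (i, j, m, s, e) (i', j', m', s', e')) \<in> embed ` S" using S_cmult[OF 1(3) 2(3)] by (rule imageI)
  then show "(nil_isometry v u e v', u * u', e \<noteq> e') \<in> embed ` S"
    unfolding 1 2 nil_isometry_vec_of[OF s] by simp
next
  have "embed (8 * 0, 8 * 0, 8 * 0, 1, False) \<in> embed ` S" using S_deep by (rule imageI)
  then show "(0, 1, False) \<in> embed ` S" by (simp add: vec_of_def zero_prod_def zero_complex.code)
next
  fix v assume "cong_mat d (576 * int k) (cusp_mat v 1) (mat 1)"
  then obtain x y m where v: "v = vec_of (96 * x) (96 * y) (16 * m)" by (rule cusp_mat_cong_1)
  have "embed (8 * (12 * x), 8 * (12 * y), 8 * (2 * m), 1, False) \<in> embed ` S" using S_deep by (rule imageI)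
  then show "(v, 1, False) \<in> embed ` S" unfolding v by simp
qed

end

section \<open>Affine normalisation of the lattice\<close>

text \<open>Cramer's rule for the real basis \<open>z1\<close>, \<open>z2\<close>.\<close>

lemma plane_coordinates:
  fixes z z1 z2 :: complex
  assumes "Im (z2 * cnj z1) \<noteq> 0"
  shows "z = of_real (Im (z2 * cnj z) / Im (z2 * cnj z1)) * z1 + of_real (Im (z * cnj z1) / Im (z2 * cnj z1)) * z2"
proof -
  have "Im (z2 * cnj z1) * Re z = Im (z2 * cnj z) * Re z1 + Im (z * cnj z1) * Re z2"
    "Im (z2 * cnj z1) * Im z = Im (z2 * cnj z) * Im z1 + Im (z * cnj z1) * Im z2"
    by (simp_all add: algebra_simps)
  moreover have "x = a / c * p + b / c * q" if "c * x = a * p + b * q" "c \<noteq> 0" for a b c p q x :: real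
    using that by (simp add: field_simps)
  ultimately have *: "Re z = Im (z2 * cnj z) / Im (z2 * cnj z1) * Re z1 + Im (z * cnj z1) / Im (z2 * cnj z1) * Re z2"
    "Im z = Im (z2 * cnj z) / Im (z2 * cnj z1) * Im z1 + Im (z * cnj z1) / Im (z2 * cnj z1) * Im z2"
    using assms by blast+
  have "Re (of_real a * z1 + of_real b * z2) = a * Re z1 + b * Re z2"
    "Im (of_real a * z1 + of_real b * z2) = a * Im z1 + b * Im z2" for a b by simp_all
  then show ?thesis by (intro complex_eqI) (simp_all only: *[symmetric])
qed

locale coord_lattice = coord_group +
  fixes z1 z2 :: complex and t1 t2 t3 :: real
  assumes t3: "t3 \<noteq> 0" and area: "4 * Im (z2 * cnj z1) = real K * t3"
begin

definition \<delta> :: real where "\<delta> = Im (z2 * cnj z1)"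
text \<open>The real linear map that sends \<open>z1\<close> to \<open>2 n\<close> and
  \<open>z2\<close> to \<open>2 n r i\<close>.\<close>

definition L :: "complex \<Rightarrow> complex" where
  "L z = Complex (2 * n * (Im (z2 * cnj z) / \<delta>)) (2 * n * r * (Im (z * cnj z1) / \<delta>))"
definition Li :: "complex \<Rightarrow> complex" where
  "Li z = of_real (Re z / (2 * n)) * z1 + of_real (Im z / (2 * n * r)) * z2"
text \<open>The height factor that turns \<open>t3\<close> into 8 units \<open>w\<close>.\<close>

definition D :: real where "D = 8 * w / t3"
text \<open>Conjugation by a left translation over \<open>p\<close> adds
  \<open>4 Im (p * cnj (L z))\<close> to the height of a translation over \<open>z\<close>;
  \<open>p\<close> solves the two real equations that cancel \<open>D t1\<close> and
  \<open>D t2\<close>.\<close>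

definition p :: complex where "p = Complex (D * t2 / (8 * n * r)) (- D * t1 / (8 * n))"
definition l :: "nil_point \<Rightarrow> nil_point" where
  "l q = (L (fst q), D * snd q + 2 * Im (p * cnj (L (fst q))))"
definition li :: "nil_point \<Rightarrow> nil_point" where
  "li q = (Li (fst q), (snd q - 2 * Im (p * cnj (fst q))) / D)"

lemma delta: "\<delta> \<noteq> 0" "\<delta> * 4 = real K * t3"
  using area t3 pos by (auto simp: \<delta>_def)

lemma D0: "D \<noteq> 0"
  using pos t3 by (simp add: D_def)

lemma L_add: "L (a + b) = L a + L b"
  by (simp add: L_def complex_eq_iff distrib_left distrib_right add_divide_distrib diff_divide_distrib algebra_simps)

lemma L_scaleR: "L (c *\<^sub>R a) = c *\<^sub>R L a"
  by (simp add: L_def complex_eq_iff algebra_simps diff_divide_distrib)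

lemma bounded_linear_L: "bounded_linear L"
  using L_add L_scaleR by (simp add: linear_iff flip: linear_conv_bounded_linear)

lemma bounded_linear_Li: "bounded_linear Li"
proof -
  have "linear Li"
    unfolding linear_iff Li_def
    by (simp add: add_divide_distrib scaleR_conv_of_real algebra_simps)
  then show ?thesis by (simp add: linear_conv_bounded_linear)
qed

lemma L_Li: "L (Li z) = z"
proof -
  have "Im (z2 * cnj (Li z)) = Re z / (2 * n) * \<delta>" "Im (Li z * cnj z1) = Im z / (2 * n * r) * \<delta>"
  proof -
    have "Im (z2 * cnj (of_real x * z1 + of_real y * z2)) = x * Im (z2 * cnj z1)"
      "Im ((of_real x * z1 + of_real y * z2) * cnj z1) = y * Im (z2 * cnj z1)" for x y
      by (simp_all add: algebra_simps)
    then show "Im (z2 * cnj (Li z)) = Re z / (2 * n) * \<delta>" "Im (Li z * cnj z1) = Im z / (2 * n * r) * \<delta>"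
      unfolding Li_def \<delta>_def by blast+
  qed
  then show ?thesis using delta pos by (simp add: L_def complex_eq_iff)
qed

lemma Li_L: "Li (L z) = z"
  using plane_coordinates[of z2 z1 z] delta(1) pos by (simp add: Li_def L_def \<delta>_def)

text \<open>\<open>L\<close> scales areas by \<open>4 n^2 r / \<delta>\<close>. The relations
  \<open>4 \<delta> = K t3\<close> and \<open>2 n^2 r = K w\<close> identify this with the height
  factor \<open>D\<close>, which makes \<open>L\<close> and \<open>D\<close> together an
  automorphism of Nil.\<close>

lemma L_area: "Im (L a * cnj (L b)) = D * Im (a * cnj b)"
proof -
  have D: "D = 4 * n * n * r / \<delta>"
  proof -
    have "\<delta> = real K * t3 / 4" "4 * n * n * r = 2 * (real K * w)" using delta(2) nnr by simp_all
    then show ?thesis using pos t3 unfolding D_def by (simp only:) (simp add: field_simps)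
  qed
  \<comment> \<open>The Pluecker relation for four vectors in the plane.\<close>
  have "\<delta> * Im (a * cnj b) = Im (z2 * cnj b) * Im (a * cnj z1) - Im (z2 * cnj a) * Im (b * cnj z1)"
    by (simp add: \<delta>_def algebra_simps)
  moreover have "(2 * n * r * (a1 / c)) * (2 * n * (b2 / c)) - (2 * n * (a2 / c)) * (2 * n * r * (b1 / c)) = 4 * n * n * r / c * x"
    if "c * x = b2 * a1 - a2 * b1" "c \<noteq> 0" for a1 a2 b1 b2 c x :: real
  proof -
    have x: "x = (b2 * a1 - a2 * b1) / c" using that by (simp add: field_simps)
    show ?thesis unfolding x using that(2) by (simp add: field_simps)
  qed
  ultimately have "(2 * n * r * (Im (a * cnj z1) / \<delta>)) * (2 * n * (Im (z2 * cnj b) / \<delta>)) -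
      (2 * n * (Im (z2 * cnj a) / \<delta>)) * (2 * n * r * (Im (b * cnj z1) / \<delta>)) = D * Im (a * cnj b)"
    unfolding D using delta(1) by blast
  moreover have "Im (L a * cnj (L b)) = Im (L a) * Re (L b) - Re (L a) * Im (L b)" by simp
  ultimately show ?thesis by (simp only: L_def complex.sel)
qed

lemma bounded_linear_l: "bounded_linear l" "bounded_linear li"
proof -
  have *: "bounded_linear (\<lambda>x. Im (p * cnj x))" for p
    by (intro bounded_linear_compose[OF bounded_linear_Im] bounded_linear_compose[OF bounded_linear_mult_right] bounded_linear_cnj)
  show "bounded_linear l"
    unfolding l_def
    by (intro bounded_linear_Pair bounded_linear_compose[OF bounded_linear_L] bounded_linear_fst bounded_linear_add
      bounded_linear_compose[OF bounded_linear_mult_right] bounded_linear_snd bounded_linear_compose[OF *])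
  show "bounded_linear li"
    unfolding li_def
    by (intro bounded_linear_Pair bounded_linear_compose[OF bounded_linear_Li] bounded_linear_fst bounded_linear_sub
      bounded_linear_compose[OF bounded_linear_mult_right] bounded_linear_compose[OF bounded_linear_divide] bounded_linear_snd bounded_linear_compose[OF *])
qed

lemma l_li: "l (li q) = q" "li (l q) = q"
  using D0 by (simp_all add: l_def li_def L_Li Li_L)

text \<open>Left translation by \<open>(p, s)\<close> after the automorphism that sends
  \<open>(z, t)\<close> to \<open>(L z, D t)\<close>; it is affine because the cocycle is linear in
  its second argument.\<close>

definition phi :: "real \<Rightarrow> nil_point \<Rightarrow> nil_point" where
  "phi s q = (p, s) + l q"

lemma phi_surj: "\<exists>q. phi s q = y"
  by (rule exI[of _ "li (y - (p, s))"]) (simp add: phi_def l_li)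

lemma phi_inj: "phi s q = phi s q' \<longleftrightarrow> q = q'"
  by (metis phi_def add_left_cancel l_li(2))

section \<open>Conjugation of Nil isometries by the affine map\<close>

definition conj_to :: "real \<Rightarrow> (nil_point \<Rightarrow> nil_point) \<Rightarrow> (nil_point \<Rightarrow> nil_point) \<Rightarrow> bool" where
  "conj_to s g h \<longleftrightarrow> (\<forall>q. phi s (g q) = h (phi s q))"

lemma conj_to_comp: "conj_to s g h \<Longrightarrow> conj_to s g' h' \<Longrightarrow> conj_to s (g \<circ> g') (h \<circ> h')"
  by (simp add: conj_to_def del: split_paired_All)

lemma conj_to_funpow: "conj_to s g h \<Longrightarrow> conj_to s (g ^^ j) (h ^^ j)"
  by (induction j) (simp_all add: conj_to_def del: split_paired_All)

lemma conj_to_unique: "conj_to s g h \<Longrightarrow> conj_to s g h' \<Longrightarrow> h = h'"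
  unfolding conj_to_def by (metis phi_surj ext)

lemma conj_to_inverse:
  assumes "conj_to s g h" "g \<circ> g' = id" "h' \<circ> h = id"
  shows "conj_to s g' h'"
  unfolding conj_to_def
proof
  fix q
  have "phi s (g (g' q)) = h (phi s (g' q))" using assms(1) unfolding conj_to_def by blast
  then have "h' (phi s q) = h' (h (phi s (g' q)))" using fun_cong[OF assms(2), of q] by simp
  then show "phi s (g' q) = h' (phi s q)" using fun_cong[OF assms(3), of "phi s (g' q)"] by simp
qed

text \<open>When \<open>L\<close> intertwines the linear parts, the conjugate is again a Nil
  isometry. Its height contains \<open>s - neg_if e s\<close>, which is 0 without the flag and
  \<open>2 s\<close> with it; this is the freedom spent on glide reflections.\<close>

lemma conj_nil_isometry:
  assumes L: "\<And>z. L (u * cnj_if e z) = u' * cnj_if e (L z)" and u': "cmod u' = 1"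
  defines "a' \<equiv> \<lambda>a. p + L a - u' * cnj_if e p"
  shows "conj_to s (nil_isometry (a, \<tau>) u e)
    (nil_isometry (a' a, s - neg_if e s + D * \<tau> + 2 * Im (p * cnj (L a)) - 2 * Im (a' a * cnj (u' * cnj_if e p))) u' e)"
  unfolding conj_to_def
proof
  fix q :: nil_point
  obtain z t where q: "q = (z, t)" by (cases q)
  let ?y = "u' * cnj_if e (L z)"
  have 1: "Im (u' * cnj_if e p * cnj ?y) = neg_if e (Im (p * cnj (L z)))"
    using Im_mult_unit[OF u'] Im_cnj_if by metis
  have 2: "D * Im (a * cnj (u * cnj_if e z)) = Im (L a * cnj ?y)"
    unfolding L_area[symmetric] L ..
  have "phi s (nil_isometry (a, \<tau>) u e q) = (p + L a + ?y,
      s + D * \<tau> + D * neg_if e t + 2 * Im (L a * cnj ?y) + 2 * Im (p * cnj (L a)) + 2 * Im (p * cnj ?y))"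
    unfolding q phi_def l_def nil_isometry_apply 2[symmetric] fst_conv snd_conv L_add L
    by (simp add: algebra_simps)
  also have "\<dots> = nil_isometry (a' a, s - neg_if e s + D * \<tau> + 2 * Im (p * cnj (L a)) - 2 * Im (a' a * cnj (u' * cnj_if e p))) u' e (phi s q)"
  proof -
    have 3: "u' * cnj_if e (p + L z) = u' * cnj_if e p + ?y" by (simp add: distrib_left)
    have 4: "neg_if e (s + (D * t + 2 * Im (p * cnj (L z)))) = neg_if e s + D * neg_if e t + 2 * Im (u' * cnj_if e p * cnj ?y)"
      unfolding 1 by (simp add: neg_if_def)
    have 5: "L a + p = a' a + u' * cnj_if e p" by (simp add: a'_def)
    have 6: "Im (L a * cnj ?y) + Im (p * cnj ?y) = Im (a' a * cnj ?y) + Im (u' * cnj_if e p * cnj ?y)"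
      using arg_cong[OF 5, of "\<lambda>x. Im (x * cnj ?y)"] by (simp only: distrib_right plus_complex.simps)
    show ?thesis
      unfolding q phi_def l_def nil_isometry_apply fst_conv snd_conv add_Pair 3 4
      using 5 6 by (simp add: distrib_left) (simp add: algebra_simps)
  qed
  finally show "phi s (nil_isometry (a, \<tau>) u e q) = \<dots>" .
qed

lemma conj_translation:
  "conj_to s (nil_isometry (a, \<tau>) 1 False) (nil_isometry (L a, D * \<tau> + 4 * Im (p * cnj (L a))) 1 False)"
proof -
  have "Im (p * cnj (L a)) = - Im (L a * cnj p)" by simp
  then show ?thesis using conj_nil_isometry[of 1 False 1 s a \<tau>] by (simp add: neg_if_def del: times_complex.simps)
qed

text \<open>The point \<open>p\<close> is chosen so that the images of \<open>a\<close> and \<open>b\<close> have height 0.\<close>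

lemma conj_generators:
  "conj_to s (nil_isometry (z1, t1) 1 False) (cisom (2, 0, 0, 1, False))"
  "conj_to s (nil_isometry (z2, t2) 1 False) (cisom (0, 2, 0, 1, False))"
  "conj_to s (nil_isometry (0, t3) 1 False) (cisom (0, 0, 8, 1, False))"
proof -
  have "L z1 = Complex (2 * n) 0" "L z2 = Complex 0 (2 * n * r)" "L 0 = 0"
    using delta(1) by (simp_all add: L_def \<delta>_def complex_eq_iff)
  then show "conj_to s (nil_isometry (z1, t1) 1 False) (cisom (2, 0, 0, 1, False))"
    "conj_to s (nil_isometry (z2, t2) 1 False) (cisom (0, 2, 0, 1, False))"
    "conj_to s (nil_isometry (0, t3) 1 False) (cisom (0, 0, 8, 1, False))"
    using conj_translation[of s z1 t1] conj_translation[of s z2 t2] conj_translation[of s 0 t3] pos t3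
    by (simp_all add: vec_of_def p_def D_def ac_simps zero_complex.code)
qed

lemma cisom_translation_power: "(cisom (0, 0, c, 1, False) ^^ j) (z, t) = (z, t + w * of_int c * real j)"
  by (induction j) (auto simp: vec_of_def nil_isometry_apply neg_if_def complex_eq_iff zero_complex.code algebra_simps)

lemma cisom_cinv:
  assumes "s = 1 \<or> s = - 1"
  shows "cisom (cinv (i, j, m, s, e)) \<circ> cisom (i, j, m, s, e) = id"
proof -
  have c: "cmod (of_int s) = 1" and cs: "cnj_if e (cnj (of_int s)) = of_int s" using assms by (auto simp: cnj_if_def)
  show ?thesis
    using nil_isometry_inverse(3)[OF c, of e "vec_of i j m"] unfolding cs cinv_vec[OF assms] by simp
qed

end

lemma relation_from_commutator:
  assumes "f \<circ> h \<circ> fi \<circ> hi = w" "fi \<circ> f = id" "hi \<circ> h = id"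
  shows "f \<circ> h = w \<circ> h \<circ> f"
proof
  fix x
  have "w (h (f x)) = f (h (fi (hi (h (f x)))))" unfolding assms(1)[symmetric] by simp
  also have "hi (h (f x)) = f x" using fun_cong[OF assms(3), of "f x"] by simp
  also have "fi (f x) = x" using fun_cong[OF assms(2), of x] by simp
  finally show "(f \<circ> h) x = (w \<circ> h \<circ> f) x" by simp
qed

lemma funpow_comp_commute:
  assumes "c \<circ> h = h \<circ> c"
  shows "(c ^^ j) \<circ> h = h \<circ> (c ^^ j)"
proof -
  have 1: "c (h x) = h (c x)" for x using fun_cong[OF assms, of x] by simp
  have "(c ^^ j) (h x) = h ((c ^^ j) x)" for x
    by (induction j) (simp_all add: 1)
  then show ?thesis by (simp add: fun_eq_iff)
qed

lemma funpow_inverse: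
  fixes c ci :: "'a \<Rightarrow> 'a"
  assumes "c \<circ> ci = id"
  shows "(c ^^ j) ((ci ^^ j) x) = x"
proof (induction j arbitrary: x)
  case (Suc j)
  have "(c ^^ Suc j) ((ci ^^ Suc j) x) = c ((c ^^ j) ((ci ^^ j) (ci x)))"
    by (simp add: funpow_swap1)
  then show ?case using Suc fun_cong[OF assms, of x] by simp
qed simp

context nil_group
begin

text \<open>Normalisation is asked only of the twisting generators in \<open>Y\<close>; for
  \<open>a\<close>, \<open>b\<close> and \<open>c\<close> it follows from the three commutator
  relations.\<close>

theorem lattice_generators':
  assumes X: "X = {Ga, Gb, Gc} \<union> Y" and K: "K > 0"
    and C1: "g Gc False \<noteq> id"
    and CA: "g Gc False \<circ> g Ga False = g Ga False \<circ> g Gc False"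
    and CB: "g Gc False \<circ> g Gb False = g Gb False \<circ> g Gc False"
    and BA: "g Gb False \<circ> g Ga False = (g Gc False ^^ K) \<circ> g Ga False \<circ> g Gb False"
    and normC: "\<And>x. x \<in> Y \<Longrightarrow> \<exists>f. g x False \<circ> g Gc False = g Gc f \<circ> g x False"
    and normA: "\<And>x. x \<in> Y \<Longrightarrow> \<exists>f e j. g x False \<circ> g Ga False = g Ga f \<circ> g x False \<circ> (g Gc e ^^ j)"
    and normB: "\<And>x. x \<in> Y \<Longrightarrow> \<exists>f e j. g x False \<circ> g Gb False = g Gb f \<circ> g x False \<circ> (g Gc e ^^ j)"
  obtains z1 t1 z2 t2 t3 where "g Ga False = nil_isometry (z1, t1) 1 False"
    "g Gb False = nil_isometry (z2, t2) 1 False" "g Gc False = nil_isometry (0, t3) 1 False"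
    "t3 \<noteq> 0" "4 * Im (z2 * cnj z1) = real K * t3"
proof (rule lattice_generators[OF _ _ _ K C1 CA CB BA])
  let ?A = "g Ga False" and ?B = "g Gb False" and ?C = "g Gc False"
  have j0: "f \<circ> h = f \<circ> h \<circ> (g Gc e ^^ 0)" for f h :: "nil_point \<Rightarrow> nil_point" and e by simp
  have ABC: "?A \<circ> ?B \<circ> (?C ^^ K) = ?B \<circ> ?A"
  proof
    fix x
    have "(?C ^^ K) (?A (?B x)) = ?A (?B ((?C ^^ K) x))"
      using fun_cong[OF funpow_comp_commute[OF CA, of K], of "?B x"] fun_cong[OF funpow_comp_commute[OF CB, of K], of x] by simp
    then show "(?A \<circ> ?B \<circ> (?C ^^ K)) x = (?B \<circ> ?A) x" using BA by simp
  qed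
  show "\<exists>f. g x False \<circ> ?C = g Gc f \<circ> g x False" if "x \<in> X" for x
    using that normC CA CB unfolding X by (metis UnE empty_iff insertE)
  show "\<exists>f e j. g x False \<circ> ?A = g Ga f \<circ> g x False \<circ> (g Gc e ^^ j)" if "x \<in> X" for x
  proof -
    consider "x = Ga" | "x = Gb" | "x = Gc" | "x \<in> Y" using \<open>x \<in> X\<close> unfolding X by blast
    then show ?thesis
    proof cases
      case 1
      then show ?thesis using j0 by blast
    next
      case 2
      then show ?thesis using ABC[symmetric] by blast
    next
      case 3
      then show ?thesis using CA j0 by metis
    qed (rule normA)
  qed
  show "\<exists>f e j. g x False \<circ> ?B = g Gb f \<circ> g x False \<circ> (g Gc e ^^ j)" if "x \<in> X" for x
  proof -
    consider "x = Ga" | "x = Gb" | "x = Gc" | "x \<in> Y" using \<open>x \<in> X\<close> unfolding X by blast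
    then show ?thesis
    proof cases
      case 1
      have "g Gc False \<circ> g Gc True = id" by (rule inv_gen(2)) (simp add: X)
      then have "?A \<circ> ?B = ?B \<circ> ?A \<circ> (g Gc True ^^ K)"
        unfolding ABC[symmetric] by (simp add: fun_eq_iff funpow_inverse)
      then show ?thesis using 1 by blast
    next
      case 2
      then show ?thesis using j0 by blast
    next
      case 3
      then show ?thesis using CB j0 by metis
    qed (rule normB)
  qed
qed (use that X in blast)+

end

lemma nil_group_of_presentation:
  assumes man: "nil_manifold_group \<Delta>" and P: "presentation X R"
    and iso: "isom_nil\<lparr>carrier := \<Delta>\<rparr> \<cong> presented_group X R"
  obtains g where "nil_group \<Delta> X g" "\<And>u v. (u, v) \<in> R \<Longrightarrow> act g u = act g v"
    "\<And>u v. u \<in> lists (X \<times> UNIV) \<Longrightarrow> v \<in> lists (X \<times> UNIV) \<Longrightarrow> act g u = act g v \<Longrightarrow> word_eq X R u v"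
proof -
  let ?G = "isom_nil\<lparr>carrier := \<Delta>\<rparr>"
  have sub: "subgroup \<Delta> isom_nil" using man by (simp add: nil_manifold_group_def)
  have grp: "group ?G" by (rule subgroup.subgroup_is_group[OF sub group_isom_nil])
  have mult: "x \<otimes>\<^bsub>?G\<^esub> y = x \<circ> y" if "x \<in> carrier ?G" "y \<in> carrier ?G" for x y
  proof -
    have "x \<in> nil_isoms" "y \<in> nil_isoms" using that subgroup_isom_nil(1)[OF sub] by auto
    then show ?thesis by (simp add: mult_isom_nil)
  qed
  have one: "\<one>\<^bsub>?G\<^esub> = id" by (simp add: one_isom_nil)
  show thesis
  proof (rule presentation.generators_of_iso[OF P grp iso mult one])
    fix g assume g: "\<And>x e. x \<in> X \<Longrightarrow> g x e \<in> carrier ?G"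
      "\<And>x e. x \<in> X \<Longrightarrow> g x e \<circ> g x (\<not> e) = id" "\<And>u v. (u, v) \<in> R \<Longrightarrow> act g u = act g v"
      "carrier ?G = act g ` lists (X \<times> UNIV)"
      "\<And>u v. u \<in> lists (X \<times> UNIV) \<Longrightarrow> v \<in> lists (X \<times> UNIV) \<Longrightarrow> act g u = act g v \<Longrightarrow> word_eq X R u v"
    have "nil_group \<Delta> X g"
      by unfold_locales (use man g in simp_all)
    then show thesis using g(3,5) by (rule that)
  qed
qed

lemma act_gen: "act g (gen x) = g x False" "act g (winv (gen x)) = g x True"
  by (simp_all add: winv_def)

lemma act_wcomm: "act g (wcomm u v) = act g u \<circ> act g v \<circ> act g (winv u) \<circ> act g (winv v)"
  by (simp add: wcomm_def act_append comp_assoc)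

section \<open>Coordinates realised by elements of the given group\<close>

context coord_lattice
begin

definition realised :: "(nil_point \<Rightarrow> nil_point) set \<Rightarrow> real \<Rightarrow> coords \<Rightarrow> bool" where
  "realised \<Delta> s y \<longleftrightarrow> (\<exists>h\<in>\<Delta>. conj_to s h (cisom y))"

lemma realised_cmult:
  assumes "subgroup \<Delta> isom_nil" "realised \<Delta> s (i, j, m, t, e)" "realised \<Delta> s y" "t = 1 \<or> t = - 1"
  shows "realised \<Delta> s (cmult (i, j, m, t, e) y)"
proof -
  obtain h h' where h: "h \<in> \<Delta>" "conj_to s h (cisom (i, j, m, t, e))" "h' \<in> \<Delta>" "conj_to s h' (cisom y)"
    using assms(2,3) unfolding realised_def by blast
  then have "h \<circ> h' \<in> \<Delta>" "conj_to s (h \<circ> h') (cisom (cmult (i, j, m, t, e) y))"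
    using subgroup_isom_nil(3)[OF assms(1)] conj_to_comp unfolding cisom_cmult[OF assms(4)] by blast+
  then show ?thesis unfolding realised_def by blast
qed

lemma realised_cinv:
  assumes "subgroup \<Delta> isom_nil" "realised \<Delta> s (i, j, m, t, e)" "t = 1 \<or> t = - 1"
  shows "realised \<Delta> s (cinv (i, j, m, t, e))"
proof -
  obtain h where h: "h \<in> \<Delta>" "conj_to s h (cisom (i, j, m, t, e))"
    using assms(2) unfolding realised_def by blast
  obtain h' where h': "h' \<in> \<Delta>" "h \<circ> h' = id" using subgroup_isom_nil(4)[OF assms(1) h(1)] by blast
  show ?thesis
    unfolding realised_def using h'(1) conj_to_inverse[OF h(2) h'(2) cisom_cinv[OF assms(3)]] by blast
qed

lemma realised_multiples:
  assumes sub: "subgroup \<Delta> isom_nil" and r: "realised \<Delta> s (i, j, m, 1, False)"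
  shows "realised \<Delta> s (c * i, c * j, c * m, 1, False)"
proof -
  have "realised \<Delta> s (int a * i, int a * j, int a * m, 1, False)" for a
  proof (induction a)
    case 0
    show ?case
      using realised_cmult[OF sub r realised_cinv[OF sub r]] by simp
  next
    case (Suc a)
    show ?case using realised_cmult[OF sub r Suc] by (simp add: algebra_simps)
  qed
  note nonneg = this
  show ?thesis
  proof (cases "c \<ge> 0")
    case True
    then show ?thesis using nonneg[of "nat c"] by simp
  next
    case False
    then show ?thesis using realised_cinv[OF sub nonneg[of "nat (- c)"]] by simp
  qed
qed

text \<open>The normal form a^x b^y c^z has \<open>i = 2 x\<close>, \<open>j = 2 y\<close> and
  height \<open>8 z - K i j\<close>, whence the congruence.\<close>

lemma realised_translation:
  assumes sub: "subgroup \<Delta> isom_nil" and r: "realised \<Delta> s (2, 0, 0, 1, False)" "realised \<Delta> s (0, 2, 0, 1, False)"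
      "realised \<Delta> s (0, 0, 8, 1, False)"
    and ij: "even i" "even j" "8 dvd m + int K * i * j"
  shows "realised \<Delta> s (i, j, m, 1, False)"
proof -
  obtain a b c where abc: "i = a * 2" "j = b * 2" "m + int K * i * j = c * 8"
    using ij by (metis dvdE mult.commute)
  have "realised \<Delta> s (a * 2, 0, 0, 1, False)" "realised \<Delta> s (0, b * 2, 0, 1, False)" "realised \<Delta> s (0, 0, c * 8, 1, False)"
    using realised_multiples[OF sub r(1), of a] realised_multiples[OF sub r(2), of b] realised_multiples[OF sub r(3), of c]
    by simp_all
  then have "realised \<Delta> s (cmult (a * 2, 0, 0, 1, False) (cmult (0, b * 2, 0, 1, False) (0, 0, c * 8, 1, False)))"
    using sub by (intro realised_cmult) simp_all
  moreover have "m = c * 8 - int K * (a * 2) * (b * 2)" using abc by simp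
  then have "cmult (a * 2, 0, 0, 1, False) (cmult (0, b * 2, 0, 1, False) (0, 0, c * 8, 1, False)) = (i, j, m, 1, False)"
    using abc(1,2) by (simp add: algebra_simps)
  ultimately show ?thesis by (simp only:)
qed

text \<open>A translation is multiplied from the left to a coset representative; the last hypothesis
  is the condition of \<open>realised_translation\<close> for that translation.\<close>

lemma realised_coset:
  assumes sub: "subgroup \<Delta> isom_nil" and r: "realised \<Delta> s (2, 0, 0, 1, False)" "realised \<Delta> s (0, 2, 0, 1, False)"
      "realised \<Delta> s (0, 0, 8, 1, False)"
    and y: "realised \<Delta> s (i0, j0, m0, t, e)"
    and ij: "even (i - i0)" "even (j - j0)"
      "8 dvd m - m0 + int K * (i * j0 - j * i0) + int K * (i - i0) * (j - j0)"
  shows "realised \<Delta> s (i, j, m, t, e)"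
proof -
  have "realised \<Delta> s (i - i0, j - j0, m - m0 + int K * (i * j0 - j * i0), 1, False)"
    by (rule realised_translation[OF sub r ij])
  then have "realised \<Delta> s (cmult (i - i0, j - j0, m - m0 + int K * (i * j0 - j * i0), 1, False) (i0, j0, m0, t, e))"
    using sub y by (intro realised_cmult) simp_all
  then show ?thesis by (simp add: algebra_simps)
qed

text \<open>The hypotheses give the two inclusions between \<open>S\<close> and the conjugate of
  \<open>\<Delta>\<close>: the generators land in \<open>S\<close>, which is closed under
  composition and inversion, and every element of \<open>S\<close> is reached.\<close>

theorem occurs_if_realised:
  assumes G: "nil_group \<Delta> X g" and sq: "squarefree d"
    and gens: "\<And>x. x \<in> X \<Longrightarrow> \<exists>y\<in>S. conj_to s (g x False) (cisom y)"
    and all: "\<And>y. y \<in> S \<Longrightarrow> realised \<Delta> s y"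
  shows "occurs_as_cusp_cross_section \<Delta> d"
proof (rule cd.occurs_if_conjugate[OF sq bounded_linear_l l_li])
  interpret G: nil_group \<Delta> X g by (rule G)
  have gen: "\<exists>y\<in>S. conj_to s (g x e) (cisom y)" if x: "x \<in> X" for x e
  proof (cases e)
    case True
    obtain y where y: "y \<in> S" "conj_to s (g x False) (cisom y)" using gens[OF x] by blast
    obtain i j m t f where y': "y = (i, j, m, t, f)" by (cases y) auto
    have "t = 1 \<or> t = - 1" using S_unit y y' by blast
    then have "conj_to s (g x True) (cisom (cinv y))"
      using conj_to_inverse[OF y(2) G.inv_gen(2)[OF x]] cisom_cinv y' by blast
    moreover have "e = True" using True by simp
    ultimately show ?thesis using S_cinv[OF y(1)] by blast
  qed (use gens x in simp)
  have act: "\<exists>y\<in>S. conj_to s (act g v) (cisom y)" if "v \<in> lists (X \<times> UNIV)" for v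
    using that
  proof (induction v)
    case Nil
    have "(8 * 0, 8 * 0, 8 * 0, 1, False) \<in> S" by (rule S_deep)
    moreover have "cisom (8 * 0, 8 * 0, 8 * 0, 1, False) = id"
      using nil_isometry_id by (simp add: vec_of_def zero_prod_def zero_complex.code)
    ultimately show ?case by (intro bexI[of _ "(8 * 0, 8 * 0, 8 * 0, 1, False)"]) (simp_all only: act_simps, simp add: conj_to_def)
  next
    case (Cons a v)
    obtain x e where a: "a = (x, e)" "x \<in> X" using Cons by (cases a) auto
    obtain y where y: "y \<in> S" "conj_to s (g x e) (cisom y)" using gen[OF a(2)] by blast
    obtain y' where y': "y' \<in> S" "conj_to s (act g v) (cisom y')" using Cons by auto
    obtain i j m t f where yt: "y = (i, j, m, t, f)" by (cases y) auto
    have "t = 1 \<or> t = - 1" using S_unit y yt by blast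
    then have "conj_to s (act g (a # v)) (cisom (cmult y y'))"
      unfolding a act_simps yt cisom_cmult[OF \<open>t = 1 \<or> t = - 1\<close>] using conj_to_comp y(2) y'(2) yt by blast
    then show ?case using S_cmult[OF y(1) y'(1)] by blast
  qed
  fix q0 q
  show "(\<exists>h\<in>\<Delta>. q = h q0) \<longleftrightarrow> (\<exists>(v, u, e)\<in>embed ` S. (p, s) + l q = nil_isometry v u e ((p, s) + l q0))"
  proof
    assume "\<exists>h\<in>\<Delta>. q = h q0"
    then obtain h where h: "h \<in> \<Delta>" "q = h q0" by blast
    then obtain y where y: "y \<in> S" "conj_to s h (cisom y)" using act G.gens by blast
    obtain i j m t e where yt: "y = (i, j, m, t, e)" by (cases y) auto
    have "phi s q = nil_isometry (vec_of i j m) (of_int t) e (phi s q0)"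
      using y(2) unfolding h(2) conj_to_def yt by (simp del: split_paired_All)
    moreover have "(vec_of i j m, of_int t, e) \<in> embed ` S" using imageI[OF y(1), of embed] by (simp add: yt)
    ultimately show "\<exists>(v, u, e)\<in>embed ` S. (p, s) + l q = nil_isometry v u e ((p, s) + l q0)"
      unfolding phi_def by blast
  next
    assume "\<exists>(v, u, e)\<in>embed ` S. (p, s) + l q = nil_isometry v u e ((p, s) + l q0)"
    then obtain i j m t e where y: "(i, j, m, t, e) \<in> S" "phi s q = nil_isometry (vec_of i j m) (of_int t) e (phi s q0)"
      unfolding phi_def by auto
    obtain h where h: "h \<in> \<Delta>" "conj_to s h (cisom (i, j, m, t, e))" using all[OF y(1)] unfolding realised_def by blast
    then have "phi s (h q0) = phi s q" using y(2) unfolding conj_to_def by (simp del: split_paired_All)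
    then have "q = h q0" by (simp add: phi_inj)
    then show "\<exists>h\<in>\<Delta>. q = h q0" using h(1) by blast
  qed
qed

section \<open>Half-turns\<close>

lemma L_minus: "L (- 1 * cnj_if False z) = - 1 * cnj_if False (L z)"
  using L_scaleR[of "- 1" z] by simp

text \<open>The semilinear map fixes \<open>z1\<close> and negates \<open>z2\<close>. As
  \<open>L\<close> makes these real and imaginary, it becomes plain conjugation.\<close>

lemma L_conj:
  assumes "u * cnj z1 = z1" "u * cnj z2 = - z2"
  shows "L (u * cnj_if True z) = 1 * cnj_if True (L z)"
proof -
  have "cnj (u * cnj z1) = cnj z1" "cnj (u * cnj z2) = cnj (- z2)" using assms by simp_all
  then have c: "cnj u * z1 = cnj z1" "cnj u * z2 = - cnj z2" by simp_all
  have "z2 * cnj (u * cnj z) = (cnj u * z2) * z" "(u * cnj z) * cnj z1 = (u * cnj z1) * cnj z"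
    by (simp_all add: ac_simps)
  then have "Im (z2 * cnj (u * cnj z)) = Im (- cnj z2 * z)" "Im ((u * cnj z) * cnj z1) = Im (z1 * cnj z)"
    by (simp_all only: c assms)
  then have "Im (z2 * cnj (u * cnj z)) = Im (z2 * cnj z)" "Im ((u * cnj z) * cnj z1) = - Im (z * cnj z1)"
    by simp_all
  then show ?thesis unfolding L_def cnj_if_simps by (simp add: complex_eq_iff del: times_complex.simps)
qed

lemma z1_nz: "z1 \<noteq> 0"
  using delta(1) by (auto simp: \<delta>_def)

lemma fst_central_power:
  assumes "nil_isometry (0, t3) 1 False \<circ> Ci = id"
  shows "fst ((Ci ^^ j) q) = fst q"
proof (induction j)
  case (Suc j)
  have "fst (nil_isometry (0, t3) 1 False q) = fst q" for q by (cases q) (simp add: nil_isometry_apply)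
  then have "fst (nil_isometry (0, t3) 1 False (Ci q)) = fst (Ci q)" for q .
  moreover have "nil_isometry (0, t3) 1 False (Ci q) = q" for q using fun_cong[OF assms, of q] by simp
  ultimately have "fst (Ci q) = fst q" for q by simp
  then show ?case using Suc by simp
qed simp

lemma fst_translation_inverse:
  assumes "nil_isometry (a, t) 1 False \<circ> Ai = id"
  shows "fst (Ai q) = fst q - a"
proof -
  have "fst (nil_isometry (a, t) 1 False (Ai q)) = fst q" using fun_cong[OF assms, of q] by simp
  then show ?thesis by (cases "Ai q") (auto simp: nil_isometry_apply algebra_simps)
qed

text \<open>A flagged isometry reverses heights, so it cannot commute with a nontrivial vertical
  translation.\<close>

lemma orientation_of_commuting:
  assumes "nil_isometry v u e \<circ> nil_isometry (0, t3) 1 False = nil_isometry (0, t3) 1 False \<circ> nil_isometry v u e"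
  shows "\<not> e"
proof
  assume e
  have "snd (nil_isometry v u e (nil_isometry (0, t3) 1 False (0, 0))) = snd (nil_isometry (0, t3) 1 False (nil_isometry v u e (0, 0)))"
    using fun_cong[OF assms, of "(0, 0)"] by simp
  then show False using \<open>e\<close> t3 by (cases v) (simp add: nil_isometry_apply neg_if_def)
qed

text \<open>Isometries without the flag commute with vertical translations, so \<open>c\<close>
  would equal its own inverse.\<close>

lemma orientation_of_inverting:
  assumes "nil_isometry v u e \<circ> nil_isometry (0, t3) 1 False = Ci \<circ> nil_isometry v u e"
    and Ci: "nil_isometry (0, t3) 1 False \<circ> Ci = id"
  shows e
proof (rule ccontr)
  assume e: "\<not> e"
  let ?C = "nil_isometry (0, t3) 1 False"
  have "nil_isometry v u e (?C (0, 0)) = Ci (nil_isometry v u e (0, 0))"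
    using fun_cong[OF assms(1), of "(0, 0)"] by simp
  then have "?C (nil_isometry v u e (?C (0, 0))) = nil_isometry v u e (0, 0)"
    using fun_cong[OF Ci, of "nil_isometry v u e (0, 0)"] by simp
  then have "snd (?C (nil_isometry v u e (?C (0, 0)))) = snd (nil_isometry v u e (0, 0))" by simp
  then show False using e t3 by (cases v) (simp add: nil_isometry_apply neg_if_def)
qed

text \<open>Compare base points of both sides at 0. The correction \<open>W\<close>, a power of
  \<open>c\<close> in the applications, leaves base points alone and drops out.\<close>

lemma rotation_eqs:
  fixes v u e defines "h \<equiv> nil_isometry v u e"
  assumes W: "\<And>q. fst (W q) = fst q"
  shows "h \<circ> nil_isometry (a, t) 1 False = Ai \<circ> h \<circ> W \<Longrightarrow> nil_isometry (a, t) 1 False \<circ> Ai = id \<Longrightarrow> u * cnj_if e a = - a"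
    and "h \<circ> nil_isometry (a, t) 1 False = nil_isometry (a, t) 1 False \<circ> h \<Longrightarrow> u * cnj_if e a = a"
proof -
  have h: "fst (h q) = fst v + u * cnj_if e (fst q)" for q by (cases q) (simp add: h_def nil_isometry_apply)
  have A: "fst (nil_isometry (a, t) 1 False q) = a + fst q" for q by (cases q) (simp add: nil_isometry_apply)
  show "u * cnj_if e a = - a" if "h \<circ> nil_isometry (a, t) 1 False = Ai \<circ> h \<circ> W" "nil_isometry (a, t) 1 False \<circ> Ai = id"
  proof -
    have "fst (h (nil_isometry (a, t) 1 False 0)) = fst (Ai (h (W 0)))" using fun_cong[OF that(1), of 0] by simp
    then show ?thesis by (simp add: h A W fst_translation_inverse[OF that(2)])
  qed
  show "u * cnj_if e a = a" if "h \<circ> nil_isometry (a, t) 1 False = nil_isometry (a, t) 1 False \<circ> h"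
  proof -
    have "fst (h (nil_isometry (a, t) 1 False 0)) = fst (nil_isometry (a, t) 1 False (h 0))" using fun_cong[OF that, of 0] by simp
    then show ?thesis by (simp add: h A)
  qed
qed

lemma conj_inverse_generators:
  "nil_isometry (z1, t1) 1 False \<circ> Ai = id \<Longrightarrow> conj_to s Ai (cisom (- 2, 0, 0, 1, False))"
  "nil_isometry (z2, t2) 1 False \<circ> Bi = id \<Longrightarrow> conj_to s Bi (cisom (0, - 2, 0, 1, False))"
  "nil_isometry (0, t3) 1 False \<circ> Ci = id \<Longrightarrow> conj_to s Ci (cisom (0, 0, - 8, 1, False))"
  using conj_to_inverse[OF conj_generators(1)] conj_to_inverse[OF conj_generators(2)] conj_to_inverse[OF conj_generators(3)]
    cisom_cinv[of 1 2 0 0 False] cisom_cinv[of 1 0 2 0 False] cisom_cinv[of 1 0 0 8 False] by simp_all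

lemma conj_half_turn:
  obtains a' \<tau>' where "conj_to s (nil_isometry (a, \<tau>) (- 1) False) (nil_isometry (a', \<tau>') (- 1) False)"
  using conj_nil_isometry[of "- 1" False "- 1" s a \<tau>] L_minus by fastforce

text \<open>Squaring a rotation by -1 cancels the base part and doubles the height, and
  \<open>c\<close> has height \<open>8 w\<close>.\<close>

lemma half_turn_height:
  assumes "conj_to s al (nil_isometry (a', \<tau>') (- 1) False)" "al \<circ> al = nil_isometry (0, t3) 1 False"
  shows "\<tau>' = 4 * w"
proof -
  have "nil_isometry (a', \<tau>') (- 1) False \<circ> nil_isometry (a', \<tau>') (- 1) False = cisom (0, 0, 8, 1, False)"
    using conj_to_unique[OF conj_to_comp[OF assms(1,1)]] conj_generators(3) assms(2) by metis
  then have "snd ((nil_isometry (a', \<tau>') (- 1) False \<circ> nil_isometry (a', \<tau>') (- 1) False) (0, 0)) = snd (cisom (0, 0, 8, 1, False) (0, 0))"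
    by (simp only:)
  then show ?thesis by (simp add: nil_isometry_apply neg_if_def vec_of_def)
qed

text \<open>Conjugating the height 0 translations \<open>a\<close> and \<open>b\<close> by the
  half-turn creates heights proportional to the imaginary and the real part of \<open>a'\<close>.
  The relations contain no power of \<open>c\<close>, so both parts vanish.\<close>

lemma vertical_half_turn:
  assumes al: "al = nil_isometry (a, \<tau>) (- 1) False"
    and A: "al \<circ> nil_isometry (z1, t1) 1 False = Ai \<circ> al" "nil_isometry (z1, t1) 1 False \<circ> Ai = id"
    and B: "al \<circ> nil_isometry (z2, t2) 1 False = Bi \<circ> al" "nil_isometry (z2, t2) 1 False \<circ> Bi = id"
    and C: "al \<circ> al = nil_isometry (0, t3) 1 False"
  shows "conj_to s al (cisom (0, 0, 4, - 1, False))"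
proof -
  obtain a' \<tau>' where h: "conj_to s al (nil_isometry (a', \<tau>') (- 1) False)" unfolding al by (rule conj_half_turn)
  let ?h = "nil_isometry (a', \<tau>') (- 1) False"
  have "?h \<circ> cisom (2, 0, 0, 1, False) = cisom (- 2, 0, 0, 1, False) \<circ> ?h"
    using conj_to_unique[OF conj_to_comp[OF h conj_generators(1)]] conj_to_comp[OF conj_inverse_generators(1)[OF A(2)] h] A(1) by metis
  then have "snd ((?h \<circ> cisom (2, 0, 0, 1, False)) (0, 0)) = snd ((cisom (- 2, 0, 0, 1, False) \<circ> ?h) (0, 0))" by (simp only:)
  then have 1: "Im a' = 0" using pos by (simp add: nil_isometry_apply neg_if_def vec_of_def)
  have "?h \<circ> cisom (0, 2, 0, 1, False) = cisom (0, - 2, 0, 1, False) \<circ> ?h"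
    using conj_to_unique[OF conj_to_comp[OF h conj_generators(2)]] conj_to_comp[OF conj_inverse_generators(2)[OF B(2)] h] B(1) by metis
  then have "snd ((?h \<circ> cisom (0, 2, 0, 1, False)) (0, 0)) = snd ((cisom (0, - 2, 0, 1, False) \<circ> ?h) (0, 0))" by (simp only:)
  then have 2: "Re a' = 0" using pos by (simp add: nil_isometry_apply neg_if_def vec_of_def)
  have "a' = Complex 0 0" using 1 2 by (simp add: complex_eq_iff)
  then have "?h = cisom (0, 0, 4, - 1, False)"
    using half_turn_height[OF h C] by (simp add: vec_of_def mult.commute)
  then show ?thesis using h by simp
qed

text \<open>The free vertical shift \<open>s\<close> is chosen to annul the height of the glide
  reflection; its square then determines the base part as half the image of
  \<open>z1\<close>.\<close>

lemma glide_reflection: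
  assumes be: "be = nil_isometry (a, \<tau>) u True" and u: "u * cnj z1 = z1" "u * cnj z2 = - z2"
    and sq: "be \<circ> be = nil_isometry (z1, t1) 1 False"
  obtains s where "conj_to s be (cisom (1, 0, 0, 1, True))"
proof -
  define a' where "a' = p + L a - 1 * cnj_if True p"
  define \<tau>' where "\<tau>' = D * \<tau> + 2 * Im (p * cnj (L a)) - 2 * Im (a' * cnj (1 * cnj_if True p))"
  \<comment> \<open>The shift enters the height of a flagged map as \<open>2 s\<close>.\<close>
  define s where "s = - \<tau>' / 2"
  have "conj_to s be (nil_isometry (a', s - neg_if True s + D * \<tau> + 2 * Im (p * cnj (L a)) - 2 * Im (a' * cnj (1 * cnj_if True p))) 1 True)"
    unfolding be a'_def by (rule conj_nil_isometry[OF L_conj[OF u]]) simp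
  moreover have "s - neg_if True s + D * \<tau> + 2 * Im (p * cnj (L a)) - 2 * Im (a' * cnj (1 * cnj_if True p)) = 0"
    unfolding s_def \<tau>'_def neg_if_def by (simp add: field_simps del: times_complex.simps)
  ultimately have h: "conj_to s be (nil_isometry (a', 0) 1 True)" by (simp only:)
  let ?h = "nil_isometry (a', 0) 1 True"
  have "?h \<circ> ?h = cisom (2, 0, 0, 1, False)"
    using conj_to_unique[OF conj_to_comp[OF h h]] conj_generators(1) sq by metis
  then have "(?h \<circ> ?h) (0, 0) = cisom (2, 0, 0, 1, False) (0, 0)" by (simp only:)
  then have "Re a' = n" "Re a' * Im a' = 0"
    using pos by (auto simp: nil_isometry_apply neg_if_def vec_of_def complex_eq_iff)
  then have "a' = Complex n 0" using pos by (simp add: complex_eq_iff)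
  then have "?h = cisom (1, 0, 0, 1, True)" by (simp add: vec_of_def)
  then show thesis using that h by simp
qed

text \<open>The relation with \<open>b\<close> gives the real part of \<open>a'\<close>, the
  relation with \<beta> the imaginary part, and the square the height. The power
  \<open>c^(-k)\<close> makes the real part \<open>- n\<close>, because \<open>w k = n^2 r\<close>
  when \<open>K = 2 k\<close>.\<close>

lemma double_half_turn:
  assumes al: "al = nil_isometry (a, \<tau>) (- 1) False" and be: "conj_to s be (cisom (1, 0, 0, 1, True))"
    and K2: "K = 2 * k"
    and A: "nil_isometry (z1, t1) 1 False \<circ> Ai = id"
    and B: "al \<circ> nil_isometry (z2, t2) 1 False = Bi \<circ> al \<circ> (Ci ^^ k)" "nil_isometry (z2, t2) 1 False \<circ> Bi = id"
    and Ci: "nil_isometry (0, t3) 1 False \<circ> Ci = id"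
    and C: "al \<circ> al = nil_isometry (0, t3) 1 False"
    and ab: "al \<circ> be = Ai \<circ> Bi \<circ> be \<circ> al \<circ> (Ci ^^ (k + 1))"
  shows "conj_to s al (cisom (- 1, - 1, 4, - 1, False))"
proof -
  obtain a' \<tau>' where h: "conj_to s al (nil_isometry (a', \<tau>') (- 1) False)" unfolding al by (rule conj_half_turn)
  let ?h = "nil_isometry (a', \<tau>') (- 1) False" and ?Ci = "cisom (0, 0, - 8, 1, False)"
  note ci = conj_to_funpow[OF conj_inverse_generators(3)[OF Ci]]
  have Cp: "(?Ci ^^ j) (0, 0) = (0, - 8 * w * real j)" for j
    using cisom_translation_power[where c = "- 8" and j = j and z = 0 and t = 0] by simp
  have "?h \<circ> cisom (0, 2, 0, 1, False) = cisom (0, - 2, 0, 1, False) \<circ> ?h \<circ> (?Ci ^^ k)"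
    using conj_to_unique[OF conj_to_comp[OF h conj_generators(2)]]
      conj_to_comp[OF conj_to_comp[OF conj_inverse_generators(2)[OF B(2)] h] ci, of k] B(1) by metis
  then have "snd ((?h \<circ> cisom (0, 2, 0, 1, False)) (0, 0)) = snd ((cisom (0, - 2, 0, 1, False) \<circ> ?h \<circ> (?Ci ^^ k)) (0, 0))" by (simp only:)
  then have "8 * (n * r * Re a') = - 8 * w * real k"
    by (simp only: comp_apply Cp) (simp add: nil_isometry_apply neg_if_def vec_of_def algebra_simps)
  moreover have kk: "real K = 2 * real k" using K2 by simp
  have "n * r * n = w * real k" using nnr[unfolded kk] by (simp add: ac_simps)
  ultimately have "n * r * Re a' = - (n * r * n)" by (simp add: ac_simps)
  then have re: "Re a' = - n" using pos by (metis mult_left_cancel mult_minus_right mult_pos_pos less_irrefl)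
  have "?h \<circ> cisom (1, 0, 0, 1, True) = cisom (- 2, 0, 0, 1, False) \<circ> cisom (0, - 2, 0, 1, False) \<circ> cisom (1, 0, 0, 1, True) \<circ> ?h \<circ> (?Ci ^^ (k + 1))"
    using conj_to_unique[OF conj_to_comp[OF h be]]
      conj_to_comp[OF conj_to_comp[OF conj_to_comp[OF conj_to_comp[OF conj_inverse_generators(1)[OF A] conj_inverse_generators(2)[OF B(2)]] be] h] ci, of "k + 1"]
      ab by metis
  then have "fst ((?h \<circ> cisom (1, 0, 0, 1, True)) (0, 0)) = fst ((cisom (- 2, 0, 0, 1, False) \<circ> cisom (0, - 2, 0, 1, False) \<circ> cisom (1, 0, 0, 1, True) \<circ> ?h \<circ> (?Ci ^^ (k + 1))) (0, 0))"
    by (simp only:)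
  then have im: "Im a' = - (n * r)"
    by (simp only: comp_apply Cp) (simp add: nil_isometry_apply neg_if_def vec_of_def complex_eq_iff)
  have "a' = Complex (- n) (- (n * r))" using re im by (simp add: complex_eq_iff)
  then have "?h = cisom (- 1, - 1, 4, - 1, False)"
    using half_turn_height[OF h C] by (simp add: vec_of_def mult.commute)
  then show ?thesis using h by simp
qed

end

section \<open>The four families in integer coordinates\<close>

text \<open>The condition on \<open>m\<close> is that of the normal form a^x b^y c^z.\<close>

definition torus_coords :: "nat \<Rightarrow> coords set" where
  "torus_coords K = {(i, j, m, s, e). s = 1 \<and> \<not> e \<and> even i \<and> even j \<and> 8 dvd m + int K * i * j}"

text \<open>For even \<open>K\<close> the product \<open>K i j\<close> is a multiple of 8 and drops
  out of the condition on \<open>m\<close>; the half-turn shifts the height by 4.\<close>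

definition vertical_coords :: "coords set" where
  "vertical_coords = {(i, j, m, s, e). \<not> e \<and> even i \<and> even j \<and> (s = 1 \<and> 8 dvd m \<or> s = - 1 \<and> 8 dvd m - 4)}"

text \<open>Multiplying the glide reflection \<open>(1, 0, 0, 1, True)\<close> from the left by a
  translation with \<open>j = 2 b\<close> adds \<open>K j = 4 k b\<close> to the height.\<close>

definition horizontal_coords :: "nat \<Rightarrow> coords set" where
  "horizontal_coords k = {(i, j, m, s, e). s = 1 \<and> even j \<and>
     (if e then odd i \<and> 8 dvd m - 4 * (int k * (j div 2)) else even i \<and> 8 dvd m)}"

text \<open>The height modulo 8 on each of the four cosets, which the parities of \<open>i\<close>
  and \<open>j\<close> tell apart; \<open>4 + 2 k\<close> belongs to the product of \<alpha> and
  \<beta>.\<close>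

definition double_coords_height :: "nat \<Rightarrow> int \<Rightarrow> int \<Rightarrow> int" where
  "double_coords_height k i j = (if even j then 0 else if even i then 4 + 2 * int k else 4)"

definition double_coords :: "nat \<Rightarrow> coords set" where
  "double_coords k = {(i, j, m, s, e). e = odd (i + j) \<and> s = (if even j then 1 else - 1) \<and> 8 dvd m - double_coords_height k i j}"

lemma horizontal_coords_iff: "(i, 2 * b, m, 1, e) \<in> horizontal_coords k \<longleftrightarrow> (if e then odd i \<and> 8 dvd m - 4 * (int k * b) else even i \<and> 8 dvd m)"
  by (simp add: horizontal_coords_def)

lemma coords_cases: obtains i j m s e where "(x :: coords) = (i, j, m, s, e)"
  by (cases x) auto

context cusp_coords
begin

lemma torus_coords_cmult:
  assumes "x \<in> torus_coords K" "y \<in> torus_coords K"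
  shows "cmult x y \<in> torus_coords K"
proof -
  obtain i j m where x: "x = (i, j, m, 1, False)" "even i" "even j" "8 dvd m + int K * i * j"
    using assms(1) by (auto simp: torus_coords_def)
  obtain i' j' m' where y: "y = (i', j', m', 1, False)" "even i'" "even j'" "8 dvd m' + int K * i' * j'"
    using assms(2) by (auto simp: torus_coords_def)
  obtain b c where bc: "j = 2 * b" "i' = 2 * c" using x(3) y(2) by (auto elim!: evenE)
  \<comment> \<open>The mixed terms add up to \<open>2 K j i'\<close>.\<close>
  have "m + m' + int K * (j * i' - i * j') + int K * (i + i') * (j + j') =
      (m + int K * i * j) + (m' + int K * i' * j') + 8 * (int K * b * c)"
    unfolding bc by (simp add: algebra_simps)
  also have "8 dvd \<dots>" by (rule dvd_add[OF dvd_add[OF x(4) y(4)]]) simp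
  finally show ?thesis using x y by (simp add: torus_coords_def)
qed

lemma coord_group_torus_coords: "coord_group d k K (torus_coords K)"
proof unfold_locales
  show "cmult x y \<in> torus_coords K" if "x \<in> torus_coords K" "y \<in> torus_coords K" for x y using torus_coords_cmult that .
  show "cinv x \<in> torus_coords K" if "x \<in> torus_coords K" for x
  proof -
    obtain i j m where x: "x = (i, j, m, 1, False)" "even i" "even j" "8 dvd m + int K * i * j"
      using \<open>x \<in> torus_coords K\<close> by (auto simp: torus_coords_def)
    obtain a b where ab: "i = 2 * a" "j = 2 * b" using x(2,3) by (auto elim!: evenE)
    have "- m + int K * i * j = 8 * (int K * a * b) - (m + int K * i * j)"
      unfolding ab by (simp add: algebra_simps)
    also have "8 dvd \<dots>" using x(4) by (intro dvd_diff) simp_all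
    finally show ?thesis using x by (simp add: torus_coords_def)
  qed
  show "(8 * i, 8 * j, 8 * m, 1, False) \<in> torus_coords K" for i j m
  proof -
    have "8 * m + int K * (8 * i) * (8 * j) = 8 * (m + int K * i * (8 * j))" by (simp add: algebra_simps)
    then have "8 dvd 8 * m + int K * (8 * i) * (8 * j)" by (rule dvdI)
    then show ?thesis by (simp add: torus_coords_def)
  qed
qed (auto simp: torus_coords_def)

lemma vertical_coords_cmult:
  assumes "even K" "x \<in> vertical_coords" "y \<in> vertical_coords"
  shows "cmult x y \<in> vertical_coords"
proof -
  obtain i j m s where x: "x = (i, j, m, s, False)" "even i" "even j" "s = 1 \<and> 8 dvd m \<or> s = - 1 \<and> 8 dvd m - 4"
    using assms(2) by (auto simp: vertical_coords_def)
  obtain i' j' m' s' where y: "y = (i', j', m', s', False)" "even i'" "even j'" "s' = 1 \<and> 8 dvd m' \<or> s' = - 1 \<and> 8 dvd m' - 4"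
    using assms(3) by (auto simp: vertical_coords_def)
  obtain c a b a' b' where h: "int K = 2 * c" "i = 2 * a" "j = 2 * b" "i' = 2 * a'" "j' = 2 * b'"
    using assms(1) x(2,3) y(2,3) by (metis evenE even_of_nat)
  define P where "P = int K * (j * s * i' - i * s * j')"
  have "P = 8 * (c * s * (b * a' - a * b'))" unfolding P_def h by (simp add: algebra_simps)
  then have P: "8 dvd P" by simp
  have "even (s * i')" "even (s * j')" using y by simp_all
  moreover have "s * s' = 1 \<and> 8 dvd m + m' + P \<or> s * s' = - 1 \<and> 8 dvd m + m' + P - 4"
    using x(4) y(4) P by (elim disjE conjE) (simp_all, presburger+)
  ultimately show ?thesis using x y by (simp add: vertical_coords_def P_def)
qed

lemma coord_group_vertical_coords:
  assumes "even K"
  shows "coord_group d k K vertical_coords"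
proof unfold_locales
  show "cmult x y \<in> vertical_coords" if "x \<in> vertical_coords" "y \<in> vertical_coords" for x y using vertical_coords_cmult[OF assms that] .
  show "cinv x \<in> vertical_coords" if "x \<in> vertical_coords" for x
  proof (cases x rule: coords_cases)
    case (1 i j m s e)
    then have x: "\<not> e" "even i" "even j" "s = 1 \<and> 8 dvd m \<or> s = - 1 \<and> 8 dvd m - 4"
      using \<open>x \<in> vertical_coords\<close> by (auto simp: vertical_coords_def)
    then have "s = 1 \<and> 8 dvd - m \<or> s = - 1 \<and> 8 dvd - m - 4" by presburger
    then show ?thesis using x 1 by (simp add: vertical_coords_def)
  qed
  show "s = 1 \<and> \<not> e \<or> s = - 1 \<and> \<not> e \<and> m mod 8 = 4 \<or> s = 1 \<and> e \<and> odd i \<or> s = - 1 \<and> e \<and> odd j"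
    if "(i, j, m, s, e) \<in> vertical_coords" for i j m s e
  proof -
    have "8 dvd m - 4 \<Longrightarrow> m mod 8 = 4" by presburger
    then show ?thesis using that by (auto simp: vertical_coords_def)
  qed
qed (auto simp: vertical_coords_def)

lemma horizontal_coords_cmult:
  assumes K2: "K = 2 * k" and xy: "x \<in> horizontal_coords k" "y \<in> horizontal_coords k"
  shows "cmult x y \<in> horizontal_coords k"
proof -
  note iff = horizontal_coords_iff
  obtain i b m e where x: "x = (i, 2 * b, m, 1, e)" using xy(1) by (auto simp: horizontal_coords_def elim!: evenE)
  obtain i' b' m' e' where y: "y = (i', 2 * b', m', 1, e')" using xy(2) by (auto simp: horizontal_coords_def elim!: evenE)
  define Q where "Q = int k * b"
  define Q' where "Q' = int k * b'"
  \<comment> \<open>The cocycle is \<open>4 Z\<close>, so modulo 8 only the parity of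
    \<open>Z\<close> matters.\<close>
  define Z where "Z = Q * i' - i * (sgn_of e * Q')"
  have "odd (sgn_of e)" by (simp add: sgn_of_def)
  then have Z: "even Z \<longleftrightarrow> ((even Q \<or> even i') \<longleftrightarrow> (even i \<or> even Q'))" unfolding Z_def by simp
  have cmult: "cmult x y = (i + i', 2 * (b + sgn_of e * b'), m + sgn_of e * m' + 4 * Z, 1, e \<noteq> e')"
    unfolding x y Z_def Q_def Q'_def cmult.simps by (simp add: K2 algebra_simps)
  have kb: "int k * (b + sgn_of e * b') = Q + sgn_of e * Q'" by (simp add: Q_def Q'_def algebra_simps)
  have hx: "if e then odd i \<and> 8 dvd m - 4 * Q else even i \<and> 8 dvd m" using xy(1) unfolding x iff Q_def .
  have hy: "if e' then odd i' \<and> 8 dvd m' - 4 * Q' else even i' \<and> 8 dvd m'" using xy(2) unfolding y iff Q'_def .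
  have "if e \<noteq> e' then odd (i + i') \<and> 8 dvd m + sgn_of e * m' + 4 * Z - 4 * (Q + sgn_of e * Q')
      else even (i + i') \<and> 8 dvd m + sgn_of e * m' + 4 * Z"
    using hx hy Z by (cases e; cases e'; simp) presburger+
  then show ?thesis unfolding cmult iff kb .
qed

lemma coord_group_horizontal_coords:
  assumes "K = 2 * k"
  shows "coord_group d k K (horizontal_coords k)"
proof unfold_locales
  show "cmult x y \<in> horizontal_coords k" if "x \<in> horizontal_coords k" "y \<in> horizontal_coords k" for x y using horizontal_coords_cmult[OF assms that] .
  show "cinv x \<in> horizontal_coords k" if xS: "x \<in> horizontal_coords k" for x
  proof -
    obtain i b m e where x: "x = (i, 2 * b, m, 1, e)" using xS by (auto simp: horizontal_coords_def elim!: evenE)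
    define Q where "Q = int k * b"
    have "if e then odd i \<and> 8 dvd m - 4 * Q else even i \<and> 8 dvd m" using xS unfolding x horizontal_coords_iff Q_def .
    moreover have "cinv x = (- i, 2 * (- sgn_of e * b), - sgn_of e * m, 1, e)" by (simp add: x)
    moreover have "int k * (- sgn_of e * b) = - sgn_of e * Q" by (simp add: Q_def)
    moreover have "8 dvd m - 4 * Q \<Longrightarrow> 8 dvd m - 4 * (1 * Q)" "8 dvd m \<Longrightarrow> 8 dvd - m" by simp_all
    ultimately show ?thesis unfolding \<open>cinv x = _\<close> horizontal_coords_iff \<open>int k * (- sgn_of e * b) = _\<close> by (cases e) simp_all
  qed
qed (auto simp: horizontal_coords_def split: if_splits)

lemma double_coords_cmult:
  assumes K2: "K = 2 * k" "even k" and xy: "x \<in> double_coords k" "y \<in> double_coords k"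
  shows "cmult x y \<in> double_coords k"
proof -
  obtain i j m s e where x: "x = (i, j, m, s, e)" by (rule coords_cases)
  obtain i' j' m' s' e' where y: "y = (i', j', m', s', e')" by (rule coords_cases)
  obtain c where c: "int k = 2 * c" using K2(2) by (metis evenE even_of_nat)
  have hx: "e = odd (i + j)" "s = (if even j then 1 else - 1)" "8 dvd m - double_coords_height k i j"
    using xy(1) unfolding x double_coords_def by auto
  have hy: "e' = odd (i' + j')" "s' = (if even j' then 1 else - 1)" "8 dvd m' - double_coords_height k i' j'"
    using xy(2) unfolding y double_coords_def by auto
  have "odd s" using hx by simp
  have "odd (sgn_of e)" by (simp add: sgn_of_def)
  define i'' where "i'' = i + s * i'"
  define j'' where "j'' = j + s * sgn_of e * j'"
  have p: "even i'' \<longleftrightarrow> (even i \<longleftrightarrow> even i')" "even j'' \<longleftrightarrow> (even j \<longleftrightarrow> even j')"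
    using \<open>odd s\<close> \<open>odd (sgn_of e)\<close> by (simp_all add: i''_def j''_def)
  define Y where "Y = c * (j * s * i' - i * s * sgn_of e * j')"
  \<comment> \<open>A representative of \<open>Y\<close> modulo 2 that depends only on
    \<open>c\<close> and on parities; the claim becomes a check of 16 parity patterns.\<close>
  define t where "t = (if (even j \<or> even i') \<longleftrightarrow> (even i \<or> even j') then 0 else c)"
  have Y: "even (Y - t)"
    using \<open>odd s\<close> \<open>odd (sgn_of e)\<close> unfolding Y_def t_def by auto
  have cmult: "cmult x y = (i'', j'', m + sgn_of e * m' + 4 * Y, s * s', e \<noteq> e')"
    unfolding x y Y_def i''_def j''_def cmult.simps using c by (simp add: K2)
  have r: "8 dvd double_coords_height k i j + sgn_of e * double_coords_height k i' j' + 4 * t - double_coords_height k i'' j''"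
    unfolding double_coords_height_def c t_def p hx(1)
    by (cases "even i"; cases "even j"; cases "even i'"; cases "even j'") simp_all
  have "m + sgn_of e * m' + 4 * Y - double_coords_height k i'' j'' =
      (m - double_coords_height k i j) + sgn_of e * (m' - double_coords_height k i' j') + 4 * (Y - t) +
      (double_coords_height k i j + sgn_of e * double_coords_height k i' j' + 4 * t - double_coords_height k i'' j'')"
    by (simp add: algebra_simps)
  moreover have "8 dvd sgn_of e * (m' - double_coords_height k i' j')" using hy(3) by simp
  moreover obtain q where "Y - t = 2 * q" using Y by (rule evenE)
  then have "4 * (Y - t) = 8 * q" by (simp only:)
  then have "8 dvd 4 * (Y - t)" by (rule dvdI)
  ultimately have "8 dvd m + sgn_of e * m' + 4 * Y - double_coords_height k i'' j''"
    using hx(3) r by (simp only: dvd_add)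
  moreover have "(e \<noteq> e') = odd (i'' + j'')" unfolding hx(1) hy(1) using p by auto
  moreover have "s * s' = (if even j'' then 1 else - 1)" unfolding hx(2) hy(2) using p by simp
  ultimately show ?thesis unfolding cmult double_coords_def by simp
qed

lemma coord_group_double_coords:
  assumes K2: "K = 2 * k" "even k"
  shows "coord_group d k K (double_coords k)"
proof unfold_locales
  show "cmult x y \<in> double_coords k" if "x \<in> double_coords k" "y \<in> double_coords k" for x y using double_coords_cmult[OF assms that] .
  show "cinv x \<in> double_coords k" if xS: "x \<in> double_coords k" for x
  proof (cases x rule: coords_cases)
    case (1 i j m s e)
    obtain c where c: "int k = 2 * c" using K2(2) by (metis evenE even_of_nat)
    have h: "e = odd (i + j)" "s = (if even j then 1 else - 1)" "8 dvd m - double_coords_height k i j"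
      using xS unfolding 1 double_coords_def by auto
    have "8 dvd - sgn_of e * (m - double_coords_height k i j)" using h(3) by simp
    moreover have "8 dvd - sgn_of e * double_coords_height k i j - double_coords_height k i j"
      unfolding double_coords_height_def h(1) c by (cases "even i"; cases "even j") simp_all
    ultimately have "8 dvd - sgn_of e * (m - double_coords_height k i j) + (- sgn_of e * double_coords_height k i j - double_coords_height k i j)"
      by (rule dvd_add)
    then have "8 dvd - sgn_of e * m - double_coords_height k i j" by (simp add: algebra_simps)
    moreover have "double_coords_height k (- s * i) (- s * sgn_of e * j) = double_coords_height k i j"
      using h(2) by (simp add: double_coords_height_def sgn_of_def)
    ultimately show ?thesis unfolding 1 cinv.simps double_coords_def using h by (simp add: sgn_of_def)
  qed
  show "s = 1 \<and> \<not> e \<or> s = - 1 \<and> \<not> e \<and> m mod 8 = 4 \<or> s = 1 \<and> e \<and> odd i \<or> s = - 1 \<and> e \<and> odd j"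
    if "(i, j, m, s, e) \<in> double_coords k" for i j m s e
  proof -
    have "8 dvd m - 4 \<Longrightarrow> m mod 8 = 4" by presburger
    then show ?thesis using that by (auto simp: double_coords_def double_coords_height_def split: if_splits)
  qed
qed (auto simp: double_coords_def double_coords_height_def)

end

section \<open>Nontriviality of the central generator\<close>

lemma weight_gen: "weight h (gen x) = h x" "weight h (winv u) = - weight h u"
proof -
  show "weight h (winv u) = - weight h u"
  proof (induction u)
    case (Cons a u)
    have "winv (a # u) = winv u @ winv [a]" by (simp add: winv_def)
    moreover have "weight h (winv [a]) = - weight h [a]" by (cases a) (simp add: winv_def)
    moreover have "weight h (a # u) = weight h [a] + weight h u" by (cases a) simp
    ultimately show ?case using Cons by (simp add: weight_append)
  qed (simp add: winv_def)
qed simp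

lemma weight_wcomm: "weight h (wcomm u v) = 0"
  by (simp add: wcomm_def weight_append weight_gen)

lemmas weight_rules = weight_gen weight_wcomm weight_wpow weight_append weight_simps(1)

lemma gen_lists: "x \<in> X \<Longrightarrow> gen x \<in> lists (X \<times> UNIV)"
  by simp

lemma append_lists: "u \<in> lists A \<Longrightarrow> v \<in> lists A \<Longrightarrow> u @ v \<in> lists A"
  by simp

lemma wcomm_lists: "u \<in> lists (X \<times> UNIV) \<Longrightarrow> v \<in> lists (X \<times> UNIV) \<Longrightarrow> wcomm u v \<in> lists (X \<times> UNIV)"
  unfolding wcomm_def by (intro append_lists winv_lists)

lemmas word_lists = gen_lists append_lists wcomm_lists winv_lists wpow_lists lists.Nil insertI1 insertI2

abbreviation "ga \<equiv> gen Ga"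
abbreviation "gb \<equiv> gen Gb"
abbreviation "gc \<equiv> gen Gc"
abbreviation "gal \<equiv> gen Galpha"
abbreviation "gbe \<equiv> gen Gbeta"

abbreviation "torus_rels k \<equiv> {(wcomm gb ga, wpow gc k), (wcomm gc ga, []), (wcomm gc gb, [])}"
abbreviation "vertical_rels k \<equiv>
  {(wcomm gb ga, wpow gc k), (wcomm gc ga, []), (wcomm gc gb, []), (wcomm gc gal, []),
   (gal @ ga, winv ga @ gal), (gal @ gb, winv gb @ gal), (gal @ gal, gc)}"
abbreviation "horizontal_rels k \<equiv>
  {(wcomm gb ga, wpow gc (2 * k)), (wcomm gc ga, []), (wcomm gc gb, []), (wcomm ga gal, []),
   (gal @ gb, winv gb @ gal @ wpow (winv gc) k), (gal @ gc, winv gc @ gal), (gal @ gal, ga)}"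
abbreviation "double_rels k \<equiv>
  {(wcomm gb ga, wpow gc (2 * k)), (wcomm gc ga, []), (wcomm gc gb, []), (wcomm gc gal, []), (wcomm ga gbe, []),
   (gal @ ga, winv ga @ gal @ wpow gc k), (gal @ gb, winv gb @ gal @ wpow (winv gc) k),
   (gbe @ gb, winv gb @ gbe @ wpow (winv gc) k), (gbe @ gc, winv gc @ gbe),
   (gal @ gbe, winv ga @ winv gb @ gbe @ gal @ wpow (winv gc) (k + 1)), (gal @ gal, gc), (gbe @ gbe, ga)}"

lemma presentations:
  "presentation {Ga, Gb, Gc} (torus_rels k)"
  "presentation {Ga, Gb, Gc, Galpha} (vertical_rels k)"
  "presentation {Ga, Gb, Gc, Galpha} (horizontal_rels k)"
  "presentation {Ga, Gb, Gc, Galpha, Gbeta} (double_rels k)"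
  by (unfold_locales, elim insertE Pair_inject emptyE, (hypsubst, intro conjI word_lists)+)+

text \<open>The integral Heisenberg group acting on itself detects \<open>c\<close>.\<close>

fun heis :: "nat \<Rightarrow> nil_gen \<Rightarrow> bool \<Rightarrow> int \<times> int \<times> int \<Rightarrow> int \<times> int \<times> int" where
  "heis k Ga e (x, y, z) = (x - sgn_of (\<not> e), y, z)"
| "heis k Gb e (x, y, z) = (x, y - sgn_of (\<not> e), z - sgn_of (\<not> e) * int k * x)"
| "heis k Gc e (x, y, z) = (x, y, z - sgn_of (\<not> e))"
| "heis k h e p = p"

lemma torus_c_nontrivial:
  assumes "k > 0"
  shows "\<not> word_eq {Ga, Gb, Gc} (torus_rels k) gc []"
proof
  assume eq: "word_eq {Ga, Gb, Gc} (torus_rels k) gc []"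
  have inv: "heis k x e \<circ> heis k x (\<not> e) = id" if "x \<in> {Ga, Gb, Gc}" for x e
    using that by (cases e) (auto simp: fun_eq_iff)
  have pw: "(heis k Gc False ^^ j) (x, y, z) = (x, y, z + int j)" for j x y z
    by (induction j) simp_all
  have rel: "act (heis k) u = act (heis k) v" if "(u, v) \<in> torus_rels k" for u v
    using that
    by (elim insertE Pair_inject emptyE, hypsubst)
       (auto simp: act_wcomm act_gen act_wpow pw fun_eq_iff algebra_simps)
  have "act (heis k) gc (0, 0, 0) = act (heis k) [] (0, 0, 0)"
    using word_eq_act[OF eq inv rel] by simp
  then show False by simp
qed

text \<open>In the cyclic group of order \<open>2 k\<close> send \<alpha> to 1, \<open>c\<close> to
  2 and \<open>a\<close>, \<open>b\<close> to 0. As \<open>k\<close> is even and positive, 2 is not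
  0 there.\<close>

lemma vertical_c_nontrivial:
  assumes "k > 0" "even k"
  shows "\<not> word_eq {Ga, Gb, Gc, Galpha} (vertical_rels k) gc []"
proof
  assume eq: "word_eq {Ga, Gb, Gc, Galpha} (vertical_rels k) gc []"
  define h :: "nil_gen \<Rightarrow> int" where "h x = (if x = Gc then 2 else if x = Galpha then 1 else 0)" for x
  have "int (2 * k) dvd weight h u - weight h v" if "(u, v) \<in> vertical_rels k" for u v
    using that by (elim insertE Pair_inject emptyE, hypsubst) (simp_all add: weight_rules h_def)
  from word_eq_weight[OF eq this] have "int (2 * k) dvd 2" by (simp add: weight_rules h_def)
  then have "2 * k dvd 2" by presburger
  then show False using assms by (auto dest: dvd_imp_le elim!: evenE)
qed

text \<open>In the cyclic group of order 4 send \<open>c\<close> to 2, \<open>b\<close> to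
  \<open>k\<close> and the others to 0; the relation between \<alpha> and \<open>b\<close> then has
  total weight \<open>4 k\<close>.\<close>

lemma horizontal_c_nontrivial: "\<not> word_eq {Ga, Gb, Gc, Galpha} (horizontal_rels k) gc []"
proof
  assume eq: "word_eq {Ga, Gb, Gc, Galpha} (horizontal_rels k) gc []"
  define h :: "nil_gen \<Rightarrow> int" where "h x = (if x = Gc then 2 else if x = Gb then int k else 0)" for x
  have "4 dvd weight h u - weight h v" if "(u, v) \<in> horizontal_rels k" for u v
    using that by (elim insertE Pair_inject emptyE, hypsubst) (simp_all add: weight_rules h_def)
  from word_eq_weight[OF eq this] show False by (simp add: weight_rules h_def)
qed

text \<open>In the cyclic group of order 4 send \<alpha> and \<beta> to 1, their squares
  \<open>c\<close> and \<open>a\<close> to 2 and \<open>b\<close> to 0. The discrepancies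
  \<open>2 k\<close> that remain vanish because \<open>k\<close> is even.\<close>

lemma double_c_nontrivial:
  assumes "even k"
  shows "\<not> word_eq {Ga, Gb, Gc, Galpha, Gbeta} (double_rels k) gc []"
proof
  assume eq: "word_eq {Ga, Gb, Gc, Galpha, Gbeta} (double_rels k) gc []"
  define h :: "nil_gen \<Rightarrow> int" where "h x = (if x = Gc \<or> x = Ga then 2 else if x = Gb then 0 else 1)" for x
  obtain c where c: "int k = 2 * c" using assms by (metis evenE even_of_nat)
  have "4 dvd weight h u - weight h v" if "(u, v) \<in> double_rels k" for u v
    using that by (elim insertE Pair_inject emptyE, hypsubst) (simp_all add: weight_rules h_def c)
  from word_eq_weight[OF eq this] show False by (simp add: weight_rules h_def)
qed

section \<open>Realisation of the four families\<close>

context nil_group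
begin

lemma gen_nil_isometry:
  assumes "x \<in> X"
  obtains a \<tau> u e where "g x False = nil_isometry (a, \<tau>) u e"
proof -
  have "g x False \<in> nil_isoms" using gen_in[OF assms] Delta_isoms by blast
  then show thesis using that unfolding nil_isoms_def by fastforce
qed

lemma commutation:
  assumes "x \<in> X" "y \<in> X" "act g (wcomm (gen x) (gen y)) = act g w"
  shows "g x False \<circ> g y False = act g w \<circ> g y False \<circ> g x False"
  using assms(3) inv_gen(1)[OF assms(1)] inv_gen(1)[OF assms(2)]
  unfolding act_wcomm act_gen by (rule relation_from_commutator)

end

lemma torus_occurs:
  assumes man: "nil_manifold_group \<Delta>" and d: "d \<ge> 1" "squarefree d" and k: "k > 0"
    and iso: "isom_nil\<lparr>carrier := \<Delta>\<rparr> \<cong> nil_torus_group k"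
  shows "occurs_as_cusp_cross_section \<Delta> d"
proof -
  let ?X = "{Ga, Gb, Gc}"
  have "isom_nil\<lparr>carrier := \<Delta>\<rparr> \<cong> presented_group ?X (torus_rels k)"
    using iso unfolding nil_torus_group_def Let_def .
  from nil_group_of_presentation[OF man presentations(1) this]
  obtain g where G: "nil_group \<Delta> ?X g" and rel: "\<And>u v. (u, v) \<in> torus_rels k \<Longrightarrow> act g u = act g v"
    and weq: "\<And>u v. u \<in> lists (?X \<times> UNIV) \<Longrightarrow> v \<in> lists (?X \<times> UNIV) \<Longrightarrow> act g u = act g v \<Longrightarrow> word_eq ?X (torus_rels k) u v"
    by blast
  interpret G: nil_group \<Delta> ?X g by (rule G)
  let ?A = "g Ga False" and ?B = "g Gb False" and ?C = "g Gc False"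
  have C1: "?C \<noteq> id"
    using torus_c_nontrivial[OF k] weq[of gc "[]"] by auto
  have BA: "?B \<circ> ?A = (?C ^^ k) \<circ> ?A \<circ> ?B"
    using G.commutation[of Gb Ga "wpow gc k", OF _ _ rel] by (simp add: act_wpow act_gen)
  have CA: "?C \<circ> ?A = ?A \<circ> ?C"
    using G.commutation[of Gc Ga "[]", OF _ _ rel] by simp
  have CB: "?C \<circ> ?B = ?B \<circ> ?C"
    using G.commutation[of Gc Gb "[]", OF _ _ rel] by simp
  obtain z1 t1 z2 t2 t3 where A: "?A = nil_isometry (z1, t1) 1 False"
    and B: "?B = nil_isometry (z2, t2) 1 False" and C: "?C = nil_isometry (0, t3) 1 False"
    and t3: "t3 \<noteq> 0" "4 * Im (z2 * cnj z1) = real k * t3"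
    by (rule G.lattice_generators'[of "{}", OF _ k C1 CA CB BA]) auto
  interpret cc: cusp_coords d k k using d k by unfold_locales auto
  interpret cg: coord_group d k k "torus_coords k" by (rule cc.coord_group_torus_coords)
  interpret cl: coord_lattice d k k "torus_coords k" z1 z2 t1 t2 t3 using t3 by unfold_locales auto
  \<comment> \<open>No flagged generator has to be normalised, so the vertical shift is taken to be
    0.\<close>
  note T = cl.conj_generators[of 0, folded A B C]
  have r: "cl.realised \<Delta> 0 (2, 0, 0, 1, False)" "cl.realised \<Delta> 0 (0, 2, 0, 1, False)" "cl.realised \<Delta> 0 (0, 0, 8, 1, False)"
    unfolding cl.realised_def using T G.gen_in by blast+
  show ?thesis
  proof (rule cl.occurs_if_realised[OF G d(2)])
    show "\<exists>y\<in>torus_coords k. cl.conj_to 0 (g x False) (cc.cisom y)" if "x \<in> ?X" for x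
    proof -
      have "(2, 0, 0, 1, False) \<in> torus_coords k" "(0, 2, 0, 1, False) \<in> torus_coords k" "(0, 0, 8, 1, False) \<in> torus_coords k"
        by (simp_all add: torus_coords_def)
      with T that show ?thesis by blast
    qed
    show "cl.realised \<Delta> 0 y" if "y \<in> torus_coords k" for y
      using that cl.realised_translation[OF G.subgroup r] by (cases y rule: coords_cases) (auto simp: torus_coords_def)
  qed
qed

lemma vertical_occurs:
  assumes man: "nil_manifold_group \<Delta>" and d: "d \<ge> 1" "squarefree d" and k: "k > 0" "even k"
    and iso: "isom_nil\<lparr>carrier := \<Delta>\<rparr> \<cong> vertical_half_twist_group k"
  shows "occurs_as_cusp_cross_section \<Delta> d"
proof -
  let ?X = "{Ga, Gb, Gc, Galpha}"
  have "isom_nil\<lparr>carrier := \<Delta>\<rparr> \<cong> presented_group ?X (vertical_rels k)"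
    using iso unfolding vertical_half_twist_group_def Let_def .
  from nil_group_of_presentation[OF man presentations(2) this]
  obtain g where G: "nil_group \<Delta> ?X g" and rel: "\<And>u v. (u, v) \<in> vertical_rels k \<Longrightarrow> act g u = act g v"
    and weq: "\<And>u v. u \<in> lists (?X \<times> UNIV) \<Longrightarrow> v \<in> lists (?X \<times> UNIV) \<Longrightarrow> act g u = act g v \<Longrightarrow> word_eq ?X (vertical_rels k) u v"
    by blast
  interpret G: nil_group \<Delta> ?X g by (rule G)
  let ?A = "g Ga False" and ?Ai = "g Ga True" and ?B = "g Gb False" and ?Bi = "g Gb True"
    and ?C = "g Gc False" and ?\<alpha> = "g Galpha False"
  have C1: "?C \<noteq> id"
    using vertical_c_nontrivial[OF k] weq[of gc "[]"] by auto
  have BA: "?B \<circ> ?A = (?C ^^ k) \<circ> ?A \<circ> ?B"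
    using G.commutation[of Gb Ga "wpow gc k", OF _ _ rel] by (simp add: act_wpow act_gen)
  have CA: "?C \<circ> ?A = ?A \<circ> ?C"
    using G.commutation[of Gc Ga "[]", OF _ _ rel] by simp
  have CB: "?C \<circ> ?B = ?B \<circ> ?C"
    using G.commutation[of Gc Gb "[]", OF _ _ rel] by simp
  have Cal: "?C \<circ> ?\<alpha> = ?\<alpha> \<circ> ?C"
    using G.commutation[of Gc Galpha "[]", OF _ _ rel] by simp
  have alA: "?\<alpha> \<circ> ?A = ?Ai \<circ> ?\<alpha>"
    using rel[of "gal @ ga" "winv ga @ gal"] by (simp add: act_append act_gen del: act_simps(2) append_Cons)
  have alB: "?\<alpha> \<circ> ?B = ?Bi \<circ> ?\<alpha>"
    using rel[of "gal @ gb" "winv gb @ gal"] by (simp add: act_append act_gen del: act_simps(2) append_Cons)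
  have alal: "?\<alpha> \<circ> ?\<alpha> = ?C"
    using rel[of "gal @ gal" gc] by (simp add: act_append act_gen del: act_simps(2) append_Cons)
  have comp0: "f \<circ> h = f \<circ> h \<circ> (?C ^^ 0)" for f h :: "nil_point \<Rightarrow> nil_point" by simp
  obtain z1 t1 z2 t2 t3 where A: "?A = nil_isometry (z1, t1) 1 False"
    and B: "?B = nil_isometry (z2, t2) 1 False" and C: "?C = nil_isometry (0, t3) 1 False"
    and t3: "t3 \<noteq> 0" "4 * Im (z2 * cnj z1) = real k * t3"
  proof (rule G.lattice_generators'[of "{Galpha}", OF _ k(1) C1 CA CB BA])
    show "\<exists>f. g x False \<circ> ?C = g Gc f \<circ> g x False" if "x \<in> {Galpha}" for x
      using that Cal[symmetric] by blast
    show "\<exists>f e j. g x False \<circ> ?A = g Ga f \<circ> g x False \<circ> (g Gc e ^^ j)" if "x \<in> {Galpha}" for x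
      using that alA comp0 by (metis singletonD)
    show "\<exists>f e j. g x False \<circ> ?B = g Gb f \<circ> g x False \<circ> (g Gc e ^^ j)" if "x \<in> {Galpha}" for x
      using that alB comp0 by (metis singletonD)
  qed auto
  interpret cc: cusp_coords d k k using d k by unfold_locales auto
  interpret cg: coord_group d k k vertical_coords by (rule cc.coord_group_vertical_coords[OF k(2)])
  interpret cl: coord_lattice d k k vertical_coords z1 z2 t1 t2 t3 using t3 by unfold_locales auto
  have Ai: "nil_isometry (z1, t1) 1 False \<circ> ?Ai = id" using G.inv_gen(2)[of Ga] unfolding A by simp
  have Bi: "nil_isometry (z2, t2) 1 False \<circ> ?Bi = id" using G.inv_gen(2)[of Gb] unfolding B by simp
  obtain a \<tau> u e where al: "?\<alpha> = nil_isometry (a, \<tau>) u e" by (rule G.gen_nil_isometry[of Galpha]) auto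
  \<comment> \<open>\<alpha> commutes with \<open>c\<close> and inverts \<open>a\<close>, which
    makes it a rotation by -1.\<close>
  have e: "\<not> e" using cl.orientation_of_commuting[of "(a, \<tau>)" u e] Cal[symmetric] unfolding al C by blast
  have "u * cnj_if e z1 = - z1"
    using cl.rotation_eqs(1)[of id "(a, \<tau>)" u e z1 t1 "?Ai"] alA Ai unfolding al A by simp
  then have u: "u = - 1" using e cl.z1_nz by (simp add: cnj_if_def) (metis mult_cancel_right mult_minus1)
  have al': "?\<alpha> = nil_isometry (a, \<tau>) (- 1) False" using al e u by simp
  note T = cl.conj_generators[of 0, folded A B C]
  have Tal: "cl.conj_to 0 (?\<alpha>) (cc.cisom (0, 0, 4, - 1, False))"
    by (rule cl.vertical_half_turn[OF al' alA[unfolded A] Ai alB[unfolded B] Bi alal[unfolded C]])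
  have r: "cl.realised \<Delta> 0 (2, 0, 0, 1, False)" "cl.realised \<Delta> 0 (0, 2, 0, 1, False)" "cl.realised \<Delta> 0 (0, 0, 8, 1, False)"
    "cl.realised \<Delta> 0 (0, 0, 4, - 1, False)"
    unfolding cl.realised_def using T Tal G.gen_in by blast+
  show ?thesis
  proof (rule cl.occurs_if_realised[OF G d(2)])
    show "\<exists>y\<in>vertical_coords. cl.conj_to 0 (g x False) (cc.cisom y)" if "x \<in> ?X" for x
    proof -
      have "(2, 0, 0, 1, False) \<in> vertical_coords" "(0, 2, 0, 1, False) \<in> vertical_coords" "(0, 0, 8, 1, False) \<in> vertical_coords" "(0, 0, 4, - 1, False) \<in> vertical_coords"
        by (simp_all add: vertical_coords_def)
      with T Tal that show ?thesis by blast
    qed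
    show "cl.realised \<Delta> 0 y" if y: "y \<in> vertical_coords" for y
    proof (cases y rule: coords_cases)
      case (1 i j m s e)
      have h: "\<not> e" "even i" "even j" "s = 1 \<and> 8 dvd m \<or> s = - 1 \<and> 8 dvd m - 4"
        using y unfolding 1 vertical_coords_def by auto
      obtain b c where "int k = 2 * c" "i = 2 * b" using k(2) h(2) by (metis evenE even_of_nat)
      moreover obtain b' where "j = 2 * b'" using h(3) by (rule evenE)
      ultimately have "8 dvd int k * i * j" by simp
      then have "s = 1 \<and> 8 dvd m + int k * i * j \<or> s = - 1 \<and> 8 dvd m - 4 + int k * i * j"
        using h(4) by (auto intro: dvd_add)
      then show ?thesis
        using cl.realised_translation[OF G.subgroup r(1-3) h(2,3), of m] cl.realised_coset[OF G.subgroup r, of i j m] h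
        unfolding 1 by auto
    qed
  qed
qed


context coord_lattice
begin

lemma z2_nz: "z2 \<noteq> 0"
  using delta(1) by (auto simp: \<delta>_def)

end

lemma horizontal_occurs:
  assumes man: "nil_manifold_group \<Delta>" and d: "d \<ge> 1" "squarefree d" and k: "k > 0"
    and iso: "isom_nil\<lparr>carrier := \<Delta>\<rparr> \<cong> horizontal_half_twist_group k"
  shows "occurs_as_cusp_cross_section \<Delta> d"
proof -
  let ?X = "{Ga, Gb, Gc, Galpha}" and ?K = "2 * k"
  have "isom_nil\<lparr>carrier := \<Delta>\<rparr> \<cong> presented_group ?X (horizontal_rels k)"
    using iso unfolding horizontal_half_twist_group_def Let_def .
  from nil_group_of_presentation[OF man presentations(3) this]
  obtain g where G: "nil_group \<Delta> ?X g" and rel: "\<And>u v. (u, v) \<in> horizontal_rels k \<Longrightarrow> act g u = act g v"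
    and weq: "\<And>u v. u \<in> lists (?X \<times> UNIV) \<Longrightarrow> v \<in> lists (?X \<times> UNIV) \<Longrightarrow> act g u = act g v \<Longrightarrow> word_eq ?X (horizontal_rels k) u v"
    by blast
  interpret G: nil_group \<Delta> ?X g by (rule G)
  let ?A = "g Ga False" and ?B = "g Gb False" and ?Bi = "g Gb True" and ?C = "g Gc False"
    and ?Ci = "g Gc True" and ?\<alpha> = "g Galpha False"
  have K: "?K > 0" using k by simp
  have C1: "?C \<noteq> id"
    using horizontal_c_nontrivial[of k] weq[of gc "[]"] by auto
  have BA: "?B \<circ> ?A = (?C ^^ ?K) \<circ> ?A \<circ> ?B"
    using G.commutation[of Gb Ga "wpow gc ?K", OF _ _ rel] by (simp add: act_wpow act_gen)
  have CA: "?C \<circ> ?A = ?A \<circ> ?C"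
    using G.commutation[of Gc Ga "[]", OF _ _ rel] by simp
  have CB: "?C \<circ> ?B = ?B \<circ> ?C"
    using G.commutation[of Gc Gb "[]", OF _ _ rel] by simp
  have Aal: "?A \<circ> ?\<alpha> = ?\<alpha> \<circ> ?A"
    using G.commutation[of Ga Galpha "[]", OF _ _ rel] by simp
  have alB: "?\<alpha> \<circ> ?B = ?Bi \<circ> ?\<alpha> \<circ> (?Ci ^^ k)"
    using rel[of "gal @ gb" "winv gb @ gal @ wpow (winv gc) k"]
    by (simp add: act_append act_gen act_wpow comp_assoc del: act_simps(2) append_Cons)
  have alC: "?\<alpha> \<circ> ?C = ?Ci \<circ> ?\<alpha>"
    using rel[of "gal @ gc" "winv gc @ gal"] by (simp add: act_append act_gen del: act_simps(2) append_Cons)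
  have alal: "?\<alpha> \<circ> ?\<alpha> = ?A"
    using rel[of "gal @ gal" ga] by (simp add: act_append act_gen del: act_simps(2) append_Cons)
  have comp0: "f \<circ> h = f \<circ> h \<circ> (?C ^^ 0)" for f h :: "nil_point \<Rightarrow> nil_point" by simp
  obtain z1 t1 z2 t2 t3 where A: "?A = nil_isometry (z1, t1) 1 False"
    and B: "?B = nil_isometry (z2, t2) 1 False" and C: "?C = nil_isometry (0, t3) 1 False"
    and t3: "t3 \<noteq> 0" "4 * Im (z2 * cnj z1) = real ?K * t3"
  proof (rule G.lattice_generators'[of "{Galpha}", OF _ K C1 CA CB BA])
    show "\<exists>f. g x False \<circ> ?C = g Gc f \<circ> g x False" if "x \<in> {Galpha}" for x
      using that alC by blast
    show "\<exists>f e j. g x False \<circ> ?A = g Ga f \<circ> g x False \<circ> (g Gc e ^^ j)" if "x \<in> {Galpha}" for x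
      using that Aal comp0 by (metis singletonD)
    show "\<exists>f e j. g x False \<circ> ?B = g Gb f \<circ> g x False \<circ> (g Gc e ^^ j)" if "x \<in> {Galpha}" for x
      using that alB by blast
  qed auto
  interpret cc: cusp_coords d k ?K using d k by unfold_locales auto
  interpret cg: coord_group d k ?K "horizontal_coords k" by (rule cc.coord_group_horizontal_coords[OF HOL.refl])
  interpret cl: coord_lattice d k ?K "horizontal_coords k" z1 z2 t1 t2 t3 using t3 by unfold_locales auto
  have Ci: "nil_isometry (0, t3) 1 False \<circ> ?Ci = id" using G.inv_gen(2)[of Gc] unfolding C by simp
  have Bi: "nil_isometry (z2, t2) 1 False \<circ> ?Bi = id" using G.inv_gen(2)[of Gb] unfolding B by simp
  obtain a \<tau> u e where al: "?\<alpha> = nil_isometry (a, \<tau>) u e" by (rule G.gen_nil_isometry[of Galpha]) auto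
  \<comment> \<open>\<alpha> inverts \<open>c\<close>, fixes \<open>z1\<close> and negates
    \<open>z2\<close>: it is a glide reflection along \<open>a\<close>.\<close>
  have e: e using cl.orientation_of_inverting[OF _ Ci] alC unfolding al C by blast
  have u1: "u * cnj_if e z1 = z1"
    using cl.rotation_eqs(2)[of id "(a, \<tau>)" u e z1 t1] Aal[symmetric] unfolding al A by simp
  have u2: "u * cnj_if e z2 = - z2"
    using cl.rotation_eqs(1)[where W = "g Gc True ^^ k", OF cl.fst_central_power[OF Ci] _ Bi] alB unfolding al B by blast
  have al': "?\<alpha> = nil_isometry (a, \<tau>) u True" using al e by simp
  obtain s where Tal: "cl.conj_to s (?\<alpha>) (cc.cisom (1, 0, 0, 1, True))"
    using cl.glide_reflection[OF al' _ _ alal[unfolded A]] u1 u2 e by auto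
  note T = cl.conj_generators[of s, folded A B C]
  have r: "cl.realised \<Delta> s (2, 0, 0, 1, False)" "cl.realised \<Delta> s (0, 2, 0, 1, False)" "cl.realised \<Delta> s (0, 0, 8, 1, False)"
    "cl.realised \<Delta> s (1, 0, 0, 1, True)"
    unfolding cl.realised_def using T Tal G.gen_in by blast+
  show ?thesis
  proof (rule cl.occurs_if_realised[OF G d(2)])
    show "\<exists>y\<in>horizontal_coords k. cl.conj_to s (g x False) (cc.cisom y)" if "x \<in> ?X" for x
    proof -
      have "(2, 0, 0, 1, False) \<in> horizontal_coords k" "(0, 2, 0, 1, False) \<in> horizontal_coords k" "(0, 0, 8, 1, False) \<in> horizontal_coords k" "(1, 0, 0, 1, True) \<in> horizontal_coords k"
        by (simp_all add: horizontal_coords_def)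
      with T Tal that show ?thesis by blast
    qed
    show "cl.realised \<Delta> s y" if yS: "y \<in> horizontal_coords k" for y
    proof -
      obtain i b m e where y: "y = (i, 2 * b, m, 1, e)" using yS by (auto simp: horizontal_coords_def elim!: evenE)
      have h: "if e then odd i \<and> 8 dvd m - 4 * (int k * b) else even i \<and> 8 dvd m" using yS unfolding y horizontal_coords_iff .
      show ?thesis
      proof (cases e)
        case True
        then have "even (i - 1)" using h by simp
        then obtain c where c: "i - 1 = 2 * c" by (rule evenE)
        have "8 dvd m - 4 * (int k * b) + 8 * (int k * c * b)" using h True by (intro dvd_add) simp_all
        moreover have "m - 0 + int ?K * (i * 0 - 2 * b * 1) + int ?K * (i - 1) * (2 * b - 0) = m - 4 * (int k * b) + 8 * (int k * c * b)"
          unfolding c by (simp add: algebra_simps)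
        ultimately have "8 dvd m - 0 + int ?K * (i * 0 - 2 * b * 1) + int ?K * (i - 1) * (2 * b - 0)" by (simp only:)
        then have "cl.realised \<Delta> s (i, 2 * b, m, 1, True)"
          by (rule cl.realised_coset[OF G.subgroup r \<open>even (i - 1)\<close>, rotated]) simp
        then show ?thesis unfolding y using True by simp
      next
        case False
        then obtain c where c: "i = 2 * c" using h by (auto elim!: evenE)
        have "8 dvd m + 8 * (int k * c * b)" using h False by (intro dvd_add) simp_all
        moreover have "m + int ?K * i * (2 * b) = m + 8 * (int k * c * b)" unfolding c by (simp add: algebra_simps)
        ultimately have "8 dvd m + int ?K * i * (2 * b)" by (simp only:)
        then have "cl.realised \<Delta> s (i, 2 * b, m, 1, False)"
          by (rule cl.realised_translation[OF G.subgroup r(1-3), rotated 2]) (simp_all add: c)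
        then show ?thesis unfolding y using False by simp
      qed
    qed
  qed
qed

lemma double_occurs:
  assumes man: "nil_manifold_group \<Delta>" and d: "d \<ge> 1" "squarefree d" and k: "k > 0" "even k"
    and iso: "isom_nil\<lparr>carrier := \<Delta>\<rparr> \<cong> double_half_twist_group k"
  shows "occurs_as_cusp_cross_section \<Delta> d"
proof -
  let ?X = "{Ga, Gb, Gc, Galpha, Gbeta}" and ?K = "2 * k"
  have "isom_nil\<lparr>carrier := \<Delta>\<rparr> \<cong> presented_group ?X (double_rels k)"
    using iso unfolding double_half_twist_group_def Let_def .
  from nil_group_of_presentation[OF man presentations(4) this]
  obtain g where G: "nil_group \<Delta> ?X g" and rel: "\<And>u v. (u, v) \<in> double_rels k \<Longrightarrow> act g u = act g v"
    and weq: "\<And>u v. u \<in> lists (?X \<times> UNIV) \<Longrightarrow> v \<in> lists (?X \<times> UNIV) \<Longrightarrow> act g u = act g v \<Longrightarrow> word_eq ?X (double_rels k) u v"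
    by blast
  interpret G: nil_group \<Delta> ?X g by (rule G)
  let ?A = "g Ga False" and ?Ai = "g Ga True" and ?B = "g Gb False" and ?Bi = "g Gb True"
    and ?C = "g Gc False" and ?Ci = "g Gc True" and ?\<alpha> = "g Galpha False" and ?\<beta> = "g Gbeta False"
  have K: "?K > 0" using k by simp
  have C1: "?C \<noteq> id"
    using double_c_nontrivial[OF k(2)] weq[of gc "[]"] by auto
  have BA: "?B \<circ> ?A = (?C ^^ ?K) \<circ> ?A \<circ> ?B"
    using G.commutation[of Gb Ga "wpow gc ?K", OF _ _ rel] by (simp add: act_wpow act_gen)
  have CA: "?C \<circ> ?A = ?A \<circ> ?C"
    using G.commutation[of Gc Ga "[]", OF _ _ rel] by simp
  have CB: "?C \<circ> ?B = ?B \<circ> ?C"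
    using G.commutation[of Gc Gb "[]", OF _ _ rel] by simp
  have Cal: "?C \<circ> ?\<alpha> = ?\<alpha> \<circ> ?C"
    using G.commutation[of Gc Galpha "[]", OF _ _ rel] by simp
  have Abe: "?A \<circ> ?\<beta> = ?\<beta> \<circ> ?A"
    using G.commutation[of Ga Gbeta "[]", OF _ _ rel] by simp
  note ev = act_append act_gen act_wpow comp_assoc
  have alA: "?\<alpha> \<circ> ?A = ?Ai \<circ> ?\<alpha> \<circ> (?C ^^ k)"
    using rel[of "gal @ ga" "winv ga @ gal @ wpow gc k"] by (simp add: ev del: act_simps(2) append_Cons)
  have alB: "?\<alpha> \<circ> ?B = ?Bi \<circ> ?\<alpha> \<circ> (?Ci ^^ k)"
    using rel[of "gal @ gb" "winv gb @ gal @ wpow (winv gc) k"] by (simp add: ev del: act_simps(2) append_Cons)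
  have beB: "?\<beta> \<circ> ?B = ?Bi \<circ> ?\<beta> \<circ> (?Ci ^^ k)"
    using rel[of "gbe @ gb" "winv gb @ gbe @ wpow (winv gc) k"] by (simp add: ev del: act_simps(2) append_Cons)
  have beC: "?\<beta> \<circ> ?C = ?Ci \<circ> ?\<beta>"
    using rel[of "gbe @ gc" "winv gc @ gbe"] by (simp add: ev del: act_simps(2) append_Cons)
  have ab: "?\<alpha> \<circ> ?\<beta> =
      ?Ai \<circ> ?Bi \<circ> ?\<beta> \<circ> ?\<alpha> \<circ> (?Ci ^^ (k + 1))"
    using rel[of "gal @ gbe" "winv ga @ winv gb @ gbe @ gal @ wpow (winv gc) (k + 1)"]
    by (simp add: ev del: act_simps(2) append_Cons funpow.simps)
  have alal: "?\<alpha> \<circ> ?\<alpha> = ?C"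
    using rel[of "gal @ gal" gc] by (simp add: ev del: act_simps(2) append_Cons)
  have bebe: "?\<beta> \<circ> ?\<beta> = ?A"
    using rel[of "gbe @ gbe" ga] by (simp add: ev del: act_simps(2) append_Cons)
  have comp0: "f \<circ> h = f \<circ> h \<circ> (?C ^^ 0)" for f h :: "nil_point \<Rightarrow> nil_point" by simp
  obtain z1 t1 z2 t2 t3 where A: "?A = nil_isometry (z1, t1) 1 False"
    and B: "?B = nil_isometry (z2, t2) 1 False" and C: "?C = nil_isometry (0, t3) 1 False"
    and t3: "t3 \<noteq> 0" "4 * Im (z2 * cnj z1) = real ?K * t3"
  proof (rule G.lattice_generators'[of "{Galpha, Gbeta}", OF _ K C1 CA CB BA])
    show "\<exists>f. g x False \<circ> ?C = g Gc f \<circ> g x False" if "x \<in> {Galpha, Gbeta}" for x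
      using that Cal[symmetric] beC by blast
    have "\<exists>f e j. ?\<beta> \<circ> ?A = g Ga f \<circ> ?\<beta> \<circ> (g Gc e ^^ j)"
      using Abe comp0 by metis
    then show "\<exists>f e j. g x False \<circ> ?A = g Ga f \<circ> g x False \<circ> (g Gc e ^^ j)" if "x \<in> {Galpha, Gbeta}" for x
      using that alA by blast
    show "\<exists>f e j. g x False \<circ> ?B = g Gb f \<circ> g x False \<circ> (g Gc e ^^ j)" if "x \<in> {Galpha, Gbeta}" for x
      using that alB beB by blast
  qed auto
  interpret cc: cusp_coords d k ?K using d k by unfold_locales auto
  interpret cg: coord_group d k ?K "double_coords k" by (rule cc.coord_group_double_coords[OF HOL.refl k(2)])
  interpret cl: coord_lattice d k ?K "double_coords k" z1 z2 t1 t2 t3 using t3 by unfold_locales auto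
  have Ai: "nil_isometry (z1, t1) 1 False \<circ> ?Ai = id" using G.inv_gen(2)[of Ga] unfolding A by simp
  have Bi: "nil_isometry (z2, t2) 1 False \<circ> ?Bi = id" using G.inv_gen(2)[of Gb] unfolding B by simp
  have Ci: "nil_isometry (0, t3) 1 False \<circ> ?Ci = id" using G.inv_gen(2)[of Gc] unfolding C by simp
  obtain a \<tau> u e where al: "?\<alpha> = nil_isometry (a, \<tau>) u e" by (rule G.gen_nil_isometry[of Galpha]) auto
  have e: "\<not> e" using cl.orientation_of_commuting[of "(a, \<tau>)" u e] Cal[symmetric] unfolding al C by blast
  have "u * cnj_if e z2 = - z2"
    using cl.rotation_eqs(1)[where W = "g Gc True ^^ k", OF cl.fst_central_power[OF Ci] _ Bi] alB unfolding al B by blast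
  then have u: "u = - 1" using e cl.z2_nz by (simp add: cnj_if_def) (metis mult_cancel_right mult_minus1)
  have al': "?\<alpha> = nil_isometry (a, \<tau>) (- 1) False" using al e u by simp
  obtain a' \<tau>' u' e' where be: "?\<beta> = nil_isometry (a', \<tau>') u' e'" by (rule G.gen_nil_isometry[of Gbeta]) auto
  have e': e' using cl.orientation_of_inverting[OF _ Ci] beC unfolding be C by blast
  have u1: "u' * cnj_if e' z1 = z1"
    using cl.rotation_eqs(2)[of id "(a', \<tau>')" u' e' z1 t1] Abe[symmetric] unfolding be A by simp
  have u2: "u' * cnj_if e' z2 = - z2"
    using cl.rotation_eqs(1)[where W = "g Gc True ^^ k", OF cl.fst_central_power[OF Ci] _ Bi] beB unfolding be B by blast
  have be': "?\<beta> = nil_isometry (a', \<tau>') u' True" using be e' by simp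
  obtain s where Tbe: "cl.conj_to s (?\<beta>) (cc.cisom (1, 0, 0, 1, True))"
    using cl.glide_reflection[OF be' _ _ bebe[unfolded A]] u1 u2 e' by auto
  \<comment> \<open>Both half-turns have to be conjugated by the same map, so \<alpha> is computed
    with the shift \<open>s\<close> that \<beta> has fixed.\<close>
  have Tal: "cl.conj_to s (?\<alpha>) (cc.cisom (- 1, - 1, 4, - 1, False))"
    by (rule cl.double_half_turn[OF al' Tbe HOL.refl Ai alB[unfolded B] Bi Ci alal[unfolded C] ab])
  note T = cl.conj_generators[of s, folded A B C]
  have r: "cl.realised \<Delta> s (2, 0, 0, 1, False)" "cl.realised \<Delta> s (0, 2, 0, 1, False)" "cl.realised \<Delta> s (0, 0, 8, 1, False)"
    unfolding cl.realised_def using T G.gen_in by blast+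
  have ral: "cl.realised \<Delta> s (- 1, - 1, 4, - 1, False)" and rbe: "cl.realised \<Delta> s (1, 0, 0, 1, True)"
    unfolding cl.realised_def using Tal Tbe G.gen_in by blast+
  \<comment> \<open>The product of \<alpha> and \<beta> represents the fourth coset.\<close>
  have "cl.realised \<Delta> s (cc.cmult (- 1, - 1, 4, - 1, False) (1, 0, 0, 1, True))"
    by (rule cl.realised_cmult[OF G.subgroup ral rbe]) simp
  then have rab: "cl.realised \<Delta> s (- 2, - 1, 4 + 2 * int k, - 1, True)" by simp
  obtain c where c: "int k = 2 * c" using k(2) by (metis evenE even_of_nat)
  have K8: "8 dvd int ?K * x" if x: "even x" for x
  proof -
    obtain q where "x = 2 * q" using x by (rule evenE)
    then have "int ?K * x = 8 * (c * q)" using c by simp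
    then show ?thesis by (rule dvdI)
  qed
  show ?thesis
  proof (rule cl.occurs_if_realised[OF G d(2)])
    show "\<exists>y\<in>double_coords k. cl.conj_to s (g x False) (cc.cisom y)" if "x \<in> ?X" for x
    proof -
      have "(2, 0, 0, 1, False) \<in> double_coords k" "(0, 2, 0, 1, False) \<in> double_coords k" "(0, 0, 8, 1, False) \<in> double_coords k" "(1, 0, 0, 1, True) \<in> double_coords k"
        "(- 1, - 1, 4, - 1, False) \<in> double_coords k"
        by (simp_all add: double_coords_def double_coords_height_def)
      with T Tal Tbe that show ?thesis by blast
    qed
    show "cl.realised \<Delta> s y" if yS: "y \<in> double_coords k" for y
    proof (cases y rule: coords_cases)
      case (1 i j m t f)
      have h: "f = odd (i + j)" "t = (if even j then 1 else - 1)" "8 dvd m - double_coords_height k i j"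
        using yS unfolding 1 double_coords_def by auto
      \<comment> \<open>The parities select, in this order, the translations and the cosets of
        \<alpha>, \<beta> and their product.\<close>
      consider "even i" "even j" | "odd i" "odd j" | "odd i" "even j" | "even i" "odd j" by blast
      then show ?thesis
      proof cases
        case p: 1
        have "8 dvd m + int ?K * (i * j)" using h(3) K8[of "i * j"] p by (intro dvd_add) (simp_all add: double_coords_height_def)
        then show ?thesis unfolding 1 h(1,2) using p cl.realised_translation[OF G.subgroup r p] by (simp add: mult.assoc)
      next
        case p: 2
        have "8 dvd (m - 4) + int ?K * (i * j + 2 * j + 1)"
          using h(3) K8[of "i * j + 2 * j + 1"] p by (intro dvd_add) (simp_all add: double_coords_height_def)
        then have "8 dvd m - 4 + int ?K * (i * - 1 - j * - 1) + int ?K * (i - - 1) * (j - - 1)" by (simp add: algebra_simps)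
        then have "cl.realised \<Delta> s (i, j, m, - 1, False)"
          by (rule cl.realised_coset[OF G.subgroup r ral, rotated 2]) (use p in simp_all)
        then show ?thesis unfolding 1 h(1,2) using p by simp
      next
        case p: 3
        have "8 dvd m + int ?K * (j * (i - 2))"
          using h(3) K8[of "j * (i - 2)"] p by (intro dvd_add) (simp_all add: double_coords_height_def)
        then have "8 dvd m - 0 + int ?K * (i * 0 - j * 1) + int ?K * (i - 1) * (j - 0)" by (simp add: algebra_simps)
        then have "cl.realised \<Delta> s (i, j, m, 1, True)"
          by (rule cl.realised_coset[OF G.subgroup r rbe, rotated 2]) (use p in simp_all)
        then show ?thesis unfolding 1 h(1,2) using p by simp
      next
        case p: 4
        have "8 dvd (m - (4 + 2 * int k)) + int ?K * (i * j + 4 * j + 2)"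
          using h(3) K8[of "i * j + 4 * j + 2"] p by (intro dvd_add) (simp_all add: double_coords_height_def)
        then have "8 dvd m - (4 + 2 * int k) + int ?K * (i * - 1 - j * - 2) + int ?K * (i - - 2) * (j - - 1)" by (simp add: algebra_simps)
        then have "cl.realised \<Delta> s (i, j, m, - 1, True)"
          by (rule cl.realised_coset[OF G.subgroup r rab, rotated 2]) (use p in simp_all)
        then show ?thesis unfolding 1 h(1,2) using p by simp
      qed
    qed
  qed
qed

theorem theorem1:
  fixes \<Delta> :: "(nil_point \<Rightarrow> nil_point) set" and d :: nat
  assumes "nil_manifold_group \<Delta>"
    and "is_nil_torus \<Delta> \<or> is_vertical_half_twist \<Delta> \<or>
         is_horizontal_half_twist \<Delta> \<or> is_double_half_twist \<Delta>"
    and "d \<ge> 1" and "squarefree d"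
  shows "occurs_as_cusp_cross_section \<Delta> d"
  using assms(2) torus_occurs[OF assms(1,3,4)] vertical_occurs[OF assms(1,3,4)]
    horizontal_occurs[OF assms(1,3,4)] double_occurs[OF assms(1,3,4)]
  unfolding is_nil_torus_def is_vertical_half_twist_def is_horizontal_half_twist_def is_double_half_twist_def
  by blast

end
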